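(* Let $(M,g)$ be an extended recurrent Lorentzian manifold of dimension $n>3$ whose associated covector $A$ is time-like, i.e. $A^2:=A^mA_m<0$ at every point. Then $(M,g)$ is a Robertson-Walker space-time.
   Context: All objects are smooth, $\nabla$ is the Levi-Civita connection of $g$, and the Lorentzian signature is $(-,+,\dots,+)$. $R_{jklm}$ is the Riemann tensor, with the standard symmetries (antisymmetric in $j,k$ and in $l,m$, symmetric under exchange of pairs, first Bianchi identity). Extended recurrent manifold: a pseudo-Riemannian manifold $(M,g)$ on which there exist a closed one-form $A_i$ (the associated covector) and nowhere vanishing scalar functions $\beta$, $\psi$ with $\nabla_j\psi=\beta A_j$ such that $$\nabla_i R_{jklm} = A_i R_{jklm} +(\beta -\psi) A_iG_{jklm} + \tfrac{\beta}{2} \left[A_j G_{iklm}+A_k G_{jilm}+A_l G_{jkim}+A_m G_{jkli}\right],$$ where $G_{jklm}= g_{mj} g_{kl} - g_{mk} g_{jl}$. Generalized Robertson-Walker space-time: an $n\geq 3$ dimensional Lorentzian manifold whose metric may take the (local) form $$ds^2 = -(dx^1)^2 + q(x^1)^2\, g^*_{\alpha\beta} (x^2,\dots, x^n)\, dx^\alpha dx^\beta,\qquad \alpha,\beta=2,\dots,n,$$ with $g^*$ the metric of an $(n-1)$-dimensional Riemannian manifold $M^*$ and $q>0$; that is, every point has a coordinate neighbourhood in which the metric has this form. Robertson-Walker space-time: a generalized Robertson-Walker space-time in which $(M^*,g^* )$ has constant sectional curvature. *)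

theory Defs
  imports "HOL-Analysis.Analysis"
begin

section \<open>Smooth maps on open subsets of Euclidean spaces\<close>

definition dir_deriv ::
  "'a::euclidean_space \<Rightarrow> ('a \<Rightarrow> 'b::real_normed_vector) \<Rightarrow> 'a \<Rightarrow> 'b" where
  "dir_deriv v f x = frechet_derivative f (at x) v"

text \<open>Only used on open \<open>S\<close>.\<close>

primrec Ck_on ::
  "nat \<Rightarrow> 'a::euclidean_space set \<Rightarrow> ('a \<Rightarrow> 'b::real_normed_vector) \<Rightarrow> bool" where
  "Ck_on 0 S f \<longleftrightarrow> continuous_on S f"
| "Ck_on (Suc k) S f \<longleftrightarrow>
     (\<forall>x\<in>S. f differentiable (at x)) \<and> (\<forall>v. Ck_on k S (dir_deriv v f))"

definition smooth_on ::
  "'a::euclidean_space set \<Rightarrow> ('a \<Rightarrow> 'b::real_normed_vector) \<Rightarrow> bool" where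
  "smooth_on S f \<longleftrightarrow> (\<forall>k. Ck_on k S f)"

abbreviation partial :: "'n::finite \<Rightarrow> (real^'n \<Rightarrow> real) \<Rightarrow> real^'n \<Rightarrow> real" where
  "partial i \<equiv> dir_deriv (axis i 1)"


section \<open>Smooth manifolds\<close>

type_synonym ('a, 'n) chart = "'a set \<times> ('a \<Rightarrow> real^'n)"

definition chart_image :: "('a, 'n::finite) chart \<Rightarrow> (real^'n) set" where
  "chart_image c = snd c ` fst c"

definition chart_inv :: "('a, 'n::finite) chart \<Rightarrow> real^'n \<Rightarrow> 'a" where
  "chart_inv c = inv_into (fst c) (snd c)"

definition is_chart :: "'a topology \<Rightarrow> ('a, 'n::finite) chart \<Rightarrow> bool" where
  "is_chart X c \<longleftrightarrow>
     openin X (fst c) \<and> open (chart_image c) \<and>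
     homeomorphic_map (subtopology X (fst c)) (top_of_set (chart_image c)) (snd c)"

definition overlap :: "('a, 'n::finite) chart \<Rightarrow> ('a, 'n) chart \<Rightarrow> (real^'n) set" where
  "overlap c d = snd c ` (fst c \<inter> fst d)"

definition transition ::
  "('a, 'n::finite) chart \<Rightarrow> ('a, 'n) chart \<Rightarrow> real^'n \<Rightarrow> real^'n" where
  "transition c d = snd d \<circ> chart_inv c"

definition compatible :: "('a, 'n::finite) chart \<Rightarrow> ('a, 'n) chart \<Rightarrow> bool" where
  "compatible c d \<longleftrightarrow>
     smooth_on (overlap c d) (transition c d) \<and> smooth_on (overlap d c) (transition d c)"

text \<open>The atlas is maximal, so that its members are exactly the local coordinate systems
  of the manifold, whose dimension is \<open>CARD('n)\<close>.\<close>

definition smooth_manifold :: "'a topology \<Rightarrow> ('a, 'n::finite) chart set \<Rightarrow> bool" where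
  "smooth_manifold X \<A> \<longleftrightarrow>
     Hausdorff_space X \<and> second_countable X \<and>
     (\<forall>c\<in>\<A>. is_chart X c) \<and>
     (\<Union>c\<in>\<A>. fst c) = topspace X \<and>
     (\<forall>c\<in>\<A>. \<forall>d\<in>\<A>. compatible c d) \<and>
     (\<forall>c. is_chart X c \<and> (\<forall>d\<in>\<A>. compatible c d) \<longrightarrow> c \<in> \<A>)"


section \<open>Fields on a manifold\<close>

text \<open>A covariant tensor field is given by its components, in each chart of the atlas, as
  functions of the coordinates, subject to the tensor transformation law. Values outside the
  image of a chart carry no meaning.\<close>

type_synonym ('a, 'n) covector_field = "('a, 'n) chart \<Rightarrow> real^'n \<Rightarrow> real^'n"
type_synonym ('a, 'n) bilinear_field = "('a, 'n) chart \<Rightarrow> real^'n \<Rightarrow> real^'n^'n"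

definition smooth_function :: "('a, 'n::finite) chart set \<Rightarrow> ('a \<Rightarrow> real) \<Rightarrow> bool" where
  "smooth_function \<A> f \<longleftrightarrow> (\<forall>c\<in>\<A>. smooth_on (chart_image c) (f \<circ> chart_inv c))"

definition one_form :: "('a, 'n::finite) chart set \<Rightarrow> ('a, 'n) covector_field \<Rightarrow> bool" where
  "one_form \<A> A \<longleftrightarrow>
     (\<forall>c\<in>\<A>. smooth_on (chart_image c) (A c)) \<and>
     (\<forall>c\<in>\<A>. \<forall>d\<in>\<A>. \<forall>x\<in>overlap c d.
        A c x = transpose (jacobian (transition c d) (at x)) *v A d (transition c d x))"

definition closed_one_form :: "('a, 'n::finite) chart set \<Rightarrow> ('a, 'n) covector_field \<Rightarrow> bool" where
  "closed_one_form \<A> A \<longleftrightarrow> one_form \<A> A \<and>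
     (\<forall>c\<in>\<A>. \<forall>x\<in>chart_image c. \<forall>i j.
        partial i (\<lambda>y. A c y $ j) x = partial j (\<lambda>y. A c y $ i) x)"

definition bilinear_tensor ::
  "('a, 'n::finite) chart set \<Rightarrow> ('a, 'n) bilinear_field \<Rightarrow> bool" where
  "bilinear_tensor \<A> g \<longleftrightarrow>
     (\<forall>c\<in>\<A>. smooth_on (chart_image c) (g c)) \<and>
     (\<forall>c\<in>\<A>. \<forall>d\<in>\<A>. \<forall>x\<in>overlap c d.
        g c x = transpose (jacobian (transition c d) (at x)) ** g d (transition c d x)
                  ** jacobian (transition c d) (at x))"


section \<open>Pseudo-Riemannian metrics\<close>

definition pseudo_riemannian ::
  "'a topology \<Rightarrow> ('a, 'n::finite) chart set \<Rightarrow> ('a, 'n) bilinear_field \<Rightarrow> bool" where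
  "pseudo_riemannian X \<A> g \<longleftrightarrow>
     smooth_manifold X \<A> \<and> bilinear_tensor \<A> g \<and>
     (\<forall>c\<in>\<A>. \<forall>x\<in>chart_image c. transpose (g c x) = g c x \<and> invertible (g c x))"

definition lorentz_signature :: "real^'n::finite^'n \<Rightarrow> bool" where
  "lorentz_signature G \<longleftrightarrow>
     (\<exists>(P::real^'n^'n) t. invertible P \<and>
        transpose P ** G ** P =
          (\<chi> i j. if i = j then (if i = t then - 1 else 1) else 0))"

definition lorentzian ::
  "'a topology \<Rightarrow> ('a, 'n::finite) chart set \<Rightarrow> ('a, 'n) bilinear_field \<Rightarrow> bool" where
  "lorentzian X \<A> g \<longleftrightarrow>
     pseudo_riemannian X \<A> g \<and>
     (\<forall>c\<in>\<A>. \<forall>x\<in>chart_image c. lorentz_signature (g c x))"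

definition riemannian_metric_on :: "(real^'n) set \<Rightarrow> (real^'n \<Rightarrow> real^'n^'n) \<Rightarrow> bool" where
  "riemannian_metric_on V h \<longleftrightarrow>
     smooth_on V h \<and>
     (\<forall>x\<in>V. transpose (h x) = h x \<and> (\<forall>v. v \<noteq> 0 \<longrightarrow> v \<bullet> (h x *v v) > 0))"


section \<open>Connection and curvature in local coordinates\<close>

text \<open>In this section \<open>g\<close> is the component matrix of a metric in one coordinate system.
  \<open>christoffel g p j k\<close> is \<open>\<Gamma>\<close> with upper index \<open>p\<close>, for the Levi-Civita connection.\<close>

definition christoffel ::
  "(real^'n \<Rightarrow> real^'n^'n) \<Rightarrow> 'n::finite \<Rightarrow> 'n \<Rightarrow> 'n \<Rightarrow> real^'n \<Rightarrow> real" where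
  "christoffel g p j k x =
     (\<Sum>q\<in>UNIV. matrix_inv (g x) $ p $ q *
        (partial j (\<lambda>y. g y $ k $ q) x + partial k (\<lambda>y. g y $ j $ q) x
          - partial q (\<lambda>y. g y $ j $ k) x)) / 2"

text \<open>The upper index comes first: \<open>[\<nabla>\<^sub>l, \<nabla>\<^sub>m] X\<^sup>p = riemann_up g p k l m \<cdot> X\<^sup>k\<close>.\<close>

definition riemann_up ::
  "(real^'n \<Rightarrow> real^'n^'n) \<Rightarrow> 'n::finite \<Rightarrow> 'n \<Rightarrow> 'n \<Rightarrow> 'n \<Rightarrow> real^'n \<Rightarrow> real" where
  "riemann_up g p k l m x =
     partial l (christoffel g p m k) x - partial m (christoffel g p l k) x
     + (\<Sum>q\<in>UNIV. christoffel g p l q x * christoffel g q m k x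
                  - christoffel g p m q x * christoffel g q l k x)"

definition riemann ::
  "(real^'n \<Rightarrow> real^'n^'n) \<Rightarrow> 'n::finite \<Rightarrow> 'n \<Rightarrow> 'n \<Rightarrow> 'n \<Rightarrow> real^'n \<Rightarrow> real" where
  "riemann g j k l m x = (\<Sum>p\<in>UNIV. g x $ j $ p * riemann_up g p k l m x)"

definition cov_deriv4 ::
  "(real^'n \<Rightarrow> real^'n^'n) \<Rightarrow> ('n::finite \<Rightarrow> 'n \<Rightarrow> 'n \<Rightarrow> 'n \<Rightarrow> real^'n \<Rightarrow> real) \<Rightarrow>
   'n \<Rightarrow> 'n \<Rightarrow> 'n \<Rightarrow> 'n \<Rightarrow> 'n \<Rightarrow> real^'n \<Rightarrow> real" where
  "cov_deriv4 g T i j k l m x =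
     partial i (T j k l m) x
     - (\<Sum>p\<in>UNIV. christoffel g p i j x * T p k l m x + christoffel g p i k x * T j p l m x
                  + christoffel g p i l x * T j k p m x + christoffel g p i m x * T j k l p x)"

definition metric_G ::
  "(real^'n \<Rightarrow> real^'n^'n) \<Rightarrow> 'n::finite \<Rightarrow> 'n \<Rightarrow> 'n \<Rightarrow> 'n \<Rightarrow> real^'n \<Rightarrow> real" where
  "metric_G g j k l m x = g x $ m $ j * g x $ k $ l - g x $ m $ k * g x $ j $ l"

definition sectional_curvature ::
  "(real^'n \<Rightarrow> real^'n^'n) \<Rightarrow> real^'n::finite \<Rightarrow> real^'n \<Rightarrow> real^'n \<Rightarrow> real" where
  "sectional_curvature g x u v =
     (\<Sum>j\<in>UNIV. \<Sum>k\<in>UNIV. \<Sum>l\<in>UNIV. \<Sum>m\<in>UNIV.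
        riemann g j k l m x * u $ j * v $ k * u $ l * v $ m) /
     ((u \<bullet> (g x *v u)) * (v \<bullet> (g x *v v)) - (u \<bullet> (g x *v v))\<^sup>2)"

definition constant_sectional_curvature_on ::
  "(real^'n::finite) set \<Rightarrow> (real^'n \<Rightarrow> real^'n^'n) \<Rightarrow> bool" where
  "constant_sectional_curvature_on V h \<longleftrightarrow>
     (\<exists>\<kappa>. \<forall>x\<in>V. \<forall>u v. u \<noteq> v \<and> independent {u, v} \<longrightarrow> sectional_curvature h x u v = \<kappa>)"


section \<open>Extended recurrent manifolds\<close>

definition extended_recurrent ::
  "'a topology \<Rightarrow> ('a, 'n::finite) chart set \<Rightarrow> ('a, 'n) bilinear_field \<Rightarrow>
   ('a, 'n) covector_field \<Rightarrow> bool" where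
  "extended_recurrent X \<A> g A \<longleftrightarrow>
     pseudo_riemannian X \<A> g \<and> closed_one_form \<A> A \<and>
     (\<exists>\<beta> \<psi>. smooth_function \<A> \<beta> \<and> smooth_function \<A> \<psi> \<and>
        (\<forall>p\<in>topspace X. \<beta> p \<noteq> 0 \<and> \<psi> p \<noteq> 0) \<and>
        (\<forall>c\<in>\<A>. \<forall>x\<in>chart_image c.
           let b = \<beta> (chart_inv c x); s = \<psi> (chart_inv c x); a = A c x; G = metric_G (g c) in
           (\<forall>j. partial j (\<psi> \<circ> chart_inv c) x = b * a $ j) \<and>
           (\<forall>i j k l m.
              cov_deriv4 (g c) (riemann (g c)) i j k l m x =
                a $ i * riemann (g c) j k l m x + (b - s) * a $ i * G j k l m x
                + b / 2 * (a $ j * G i k l m x + a $ k * G j i l m x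
                           + a $ l * G j k i m x + a $ m * G j k l i x))))"

definition timelike ::
  "('a, 'n::finite) chart set \<Rightarrow> ('a, 'n) bilinear_field \<Rightarrow> ('a, 'n) covector_field \<Rightarrow> bool" where
  "timelike \<A> g A \<longleftrightarrow>
     (\<forall>c\<in>\<A>. \<forall>x\<in>chart_image c. A c x \<bullet> (matrix_inv (g c x) *v A c x) < 0)"


section \<open>Generalized Robertson-Walker and Robertson-Walker space-times\<close>

text \<open>The coordinates of an \<open>n\<close>-dimensional space-time are indexed by \<open>'m option\<close> with
  \<open>CARD('m) = n - 1\<close>: \<open>None\<close> is the first coordinate, the \<open>Some \<alpha>\<close> are the others.\<close>

definition spatial :: "real^('m::finite option) \<Rightarrow> real^'m" where
  "spatial x = (\<chi> \<alpha>. x $ Some \<alpha>)"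

definition warped_form ::
  "('a, 'm::finite option) bilinear_field \<Rightarrow> ('a, 'm option) chart \<Rightarrow>
   real set \<Rightarrow> (real \<Rightarrow> real) \<Rightarrow> (real^'m) set \<Rightarrow> (real^'m \<Rightarrow> real^'m^'m) \<Rightarrow> bool" where
  "warped_form g c I q V h \<longleftrightarrow>
     open I \<and> is_interval I \<and> open V \<and> connected V \<and>
     chart_image c = {x. x $ None \<in> I \<and> spatial x \<in> V} \<and>
     smooth_on I q \<and> (\<forall>t\<in>I. q t > 0) \<and> riemannian_metric_on V h \<and>
     (\<forall>x\<in>chart_image c.
        g c x $ None $ None = - 1 \<and>
        (\<forall>\<alpha>. g c x $ None $ Some \<alpha> = 0 \<and> g c x $ Some \<alpha> $ None = 0) \<and>
        (\<forall>\<alpha> \<gamma>. g c x $ Some \<alpha> $ Some \<gamma> = (q (x $ None))\<^sup>2 * h (spatial x) $ \<alpha> $ \<gamma>))"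

definition generalized_robertson_walker ::
  "'a topology \<Rightarrow> ('a, 'm::finite option) chart set \<Rightarrow> ('a, 'm option) bilinear_field \<Rightarrow> bool" where
  "generalized_robertson_walker X \<A> g \<longleftrightarrow>
     lorentzian X \<A> g \<and> CARD('m option) \<ge> 3 \<and>
     (\<forall>p\<in>topspace X. \<exists>c\<in>\<A>. p \<in> fst c \<and> (\<exists>I q V h. warped_form g c I q V h))"

definition robertson_walker ::
  "'a topology \<Rightarrow> ('a, 'm::finite option) chart set \<Rightarrow> ('a, 'm option) bilinear_field \<Rightarrow> bool" where
  "robertson_walker X \<A> g \<longleftrightarrow>
     generalized_robertson_walker X \<A> g \<and>
     (\<forall>p\<in>topspace X. \<exists>c\<in>\<A>. p \<in> fst c \<and>
        (\<exists>I q V h. warped_form g c I q V h \<and> constant_sectional_curvature_on V h))"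

end

theory Submission
  imports Defs
begin

text \<open>
  Put \<open>K = R - \<psi> G\<close>. The second Bianchi identity turns the recurrence equation into
  \<open>A\<^sub>[\<^sub>i K\<^sub>|\<^sub>j\<^sub>k\<^sub>|\<^sub>l\<^sub>m\<^sub>] = 0\<close>. Differentiating this and substituting the equation once more gives, with
  \<open>n > 3\<close>, \<open>\<beta> \<noteq> 0\<close> and \<open>A\<close> time-like, that the spatial part of \<open>\<nabla>A\<close> is a multiple of the metric and
  the mixed part vanishes. Since \<open>d\<psi> = \<beta> A\<close>, the function \<open>\<psi>\<close> is itself a time coordinate;
  flowing along its gradient makes the metric block diagonal, and the shape of \<open>\<nabla>A\<close> says that the lapse depends on
  time only and that every time derivative of the spatial block is a multiple of this block.
  Proper time then gives the warped product; the Codazzi equation makes the warping factor depend on time only, and the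
  Gauss equation with \<open>R = \<psi> G\<close> on spatial directions makes the fibre a space of constant curvature.

  All curvature computations take place in adapted charts of the maximal atlas, in which the
  recurrence equation holds by assumption, so that no transformation law of the curvature tensor is needed.
\<close>

section \<open>Calculus of smooth maps\<close>

text \<open>In the cyclic sum over i, l, m of the recurrence equation, the \<beta> terms with A_j or
  A_k cancel by the first Bianchi identity of G, and those with A_l or A_m cancel the terms \<beta>
  A_i G. This is why exactly R - \<psi> G remains. The \<beta> terms return when the equation is
  read on a component of R that vanishes identically. There they equal products of Christoffel
  symbols with K: E_pb S_qa - E_pa S_qb = c (h_pb h_qa - h_pa h_qb), where E is the second
  fundamental form up to a factor, S the time-time part of K, h the spatial metric and c = \<beta>
  A_0 / 2. Three spatial directions make E and S multiples of h. Two would not: if h is the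
  identity, every E = S of determinant c is a solution. This is where n > 3 enters.

  A chart showing the warped form must belong to the atlas, which by maximality means smooth
  compatibility with every chart. Hence each change of coordinates must be smooth in both
  directions. Straightening along the gradient needs a flow that is jointly smooth in time and
  initial value, and an inverse function theorem that returns a smooth inverse; the analytic half
  supplies these.\<close>

lemma dir_deriv_eq: "(f has_derivative f') (at x) \<Longrightarrow> dir_deriv v f x = f' v"
  by (metis dir_deriv_def frechet_derivative_at)

lemma differentiable_has_derivative_dir_deriv:
  "f differentiable (at x) \<Longrightarrow> (f has_derivative (\<lambda>v. dir_deriv v f x)) (at x)"
  by (simp add: dir_deriv_def frechet_derivative_works)

lemma Ck_on_Suc_derivative:
  assumes "Ck_on (Suc k) S f" "x \<in> S"
  shows "(f has_derivative (\<lambda>v. dir_deriv v f x)) (at x)"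
  using assms differentiable_has_derivative_dir_deriv by auto

lemma Ck_on_subset: "Ck_on k S f \<Longrightarrow> T \<subseteq> S \<Longrightarrow> Ck_on k T f"
  by (induction k arbitrary: f) (auto intro: continuous_on_subset)

lemma dir_deriv_cong:
  assumes "open S" "x \<in> S" "\<And>x. x \<in> S \<Longrightarrow> f x = g x"
  shows "dir_deriv v f x = dir_deriv v g x"
proof -
  have "(f has_derivative D) (at x) \<longleftrightarrow> (g has_derivative D) (at x)" for D
    using assms has_derivative_transform_within_open[of f D x UNIV S g]
      has_derivative_transform_within_open[of g D x UNIV S f] by auto
  then show ?thesis
    by (simp add: dir_deriv_def frechet_derivative_def)
qed

lemma Ck_on_cong:
  assumes "open S" "\<And>x. x \<in> S \<Longrightarrow> f x = g x"
  shows "Ck_on k S f \<longleftrightarrow> Ck_on k S g"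
  using assms(2)
proof (induction k arbitrary: f g)
  case 0
  then show ?case using continuous_on_cong by (metis Ck_on.simps(1))
next
  case (Suc k)
  have "(f has_derivative D) (at x) \<longleftrightarrow> (g has_derivative D) (at x)" if "x \<in> S" for x D
    using assms(1) that Suc.prems has_derivative_transform_within_open[of f D x UNIV S g]
      has_derivative_transform_within_open[of g D x UNIV S f] by auto
  then have "f differentiable (at x) \<longleftrightarrow> g differentiable (at x)" if "x \<in> S" for x
    using that by (simp add: differentiable_def)
  moreover have "Ck_on k S (dir_deriv v f) \<longleftrightarrow> Ck_on k S (dir_deriv v g)" for v
    by (rule Suc.IH) (rule dir_deriv_cong[OF assms(1) _ Suc.prems])
  ultimately show ?case by simp
qed

text \<open>Lets membership in the next class be checked on an explicit formula for the derivative.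
  Openness of \<open>S\<close> makes that formula agree with \<open>dir_deriv\<close> near every
  point, so that the two have the same class.\<close>

lemma Ck_on_SucI:
  assumes "open S" "\<And>x. x \<in> S \<Longrightarrow> (f has_derivative f' x) (at x)"
    and "\<And>v. Ck_on k S (\<lambda>x. f' x v)"
  shows "Ck_on (Suc k) S f"
proof -
  have "Ck_on k S (dir_deriv v f)" for v
    using assms(3) Ck_on_cong[OF assms(1), of "dir_deriv v f" "\<lambda>x. f' x v"]
      dir_deriv_eq[OF assms(2)] by blast
  then show ?thesis
    using assms(2) by (auto simp: differentiable_def)
qed

lemma Ck_on_Suc_imp: "Ck_on (Suc k) S f \<Longrightarrow> Ck_on k S f"
proof (induction k arbitrary: f)
  case 0
  then show ?case
    by (auto intro!: continuous_at_imp_continuous_on differentiable_imp_continuous_within)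
qed auto

lemma Ck_on_mono: "Ck_on k S f \<Longrightarrow> j \<le> k \<Longrightarrow> Ck_on j S f"
  by (induction k) (auto simp: le_Suc_eq dest: Ck_on_Suc_imp simp del: Ck_on.simps)

lemma Ck_on_continuous: "Ck_on k S f \<Longrightarrow> continuous_on S f"
  using Ck_on_mono[of k S f 0] by simp

section \<open>Closure properties of the classes \<open>Ck_on\<close>\<close>

lemma Ck_on_const: "Ck_on k S (\<lambda>x. c)"
proof (induction k arbitrary: c)
  case (Suc k)
  have "dir_deriv v (\<lambda>x. c) = (\<lambda>x. 0)" for v :: 'a
    using dir_deriv_eq[OF has_derivative_const] by blast
  then show ?case using Suc by simp
qed simp

lemma Ck_on_add:
  assumes "open S" "Ck_on k S f" "Ck_on k S g"
  shows "Ck_on k S (\<lambda>x. f x + g x)"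
  using assms(2,3)
proof (induction k arbitrary: f g)
  case 0
  then show ?case by (simp add: continuous_on_add)
next
  case (Suc k)
  note D = Ck_on_Suc_derivative[OF Suc.prems(1)] Ck_on_Suc_derivative[OF Suc.prems(2)]
  show ?case
  proof (rule Ck_on_SucI)
    show "x \<in> S \<Longrightarrow> ((\<lambda>x. f x + g x) has_derivative (\<lambda>v. dir_deriv v f x + dir_deriv v g x)) (at x)" for x
      using D by (intro has_derivative_add)
    show "Ck_on k S (\<lambda>x. dir_deriv v f x + dir_deriv v g x)" for v
      using Suc by auto
  qed (fact assms(1))
qed

lemma Ck_on_bounded_linear:
  assumes "bounded_linear h" "open S" "Ck_on k S f"
  shows "Ck_on k S (\<lambda>x. h (f x))"
  using assms(3)
proof (induction k arbitrary: f)
  case 0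
  then show ?case using assms(1) by (simp add: linear_continuous_on_compose linear_linear bounded_linear.continuous_on)
next
  case (Suc k)
  note D = Ck_on_Suc_derivative[OF Suc.prems(1)]
  show ?case
  proof (rule Ck_on_SucI)
    show "x \<in> S \<Longrightarrow> ((\<lambda>x. h (f x)) has_derivative (\<lambda>v. h (dir_deriv v f x))) (at x)" for x
      using bounded_linear.has_derivative[OF assms(1) D] .
    show "Ck_on k S (\<lambda>x. h (dir_deriv v f x))" for v
      using Suc by auto
  qed (fact assms(2))
qed

lemma Ck_on_bilinear:
  assumes "bounded_bilinear p" "open S" "Ck_on k S f" "Ck_on k S g"
  shows "Ck_on k S (\<lambda>x. p (f x) (g x))"
  using assms(3,4)
proof (induction k arbitrary: f g)
  case 0
  then show ?case using assms(1) by (simp add: bounded_bilinear.continuous_on)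
next
  case (Suc k)
  note D = Ck_on_Suc_derivative[OF Suc.prems(1)] Ck_on_Suc_derivative[OF Suc.prems(2)]
  show ?case
  proof (rule Ck_on_SucI)
    show "x \<in> S \<Longrightarrow> ((\<lambda>x. p (f x) (g x)) has_derivative
        (\<lambda>v. p (f x) (dir_deriv v g x) + p (dir_deriv v f x) (g x))) (at x)" for x
      using bounded_bilinear.FDERIV[OF assms(1) D] .
    show "Ck_on k S (\<lambda>x. p (f x) (dir_deriv v g x) + p (dir_deriv v f x) (g x))" for v
      using Suc.prems Ck_on_Suc_imp[OF Suc.prems(1)] Ck_on_Suc_imp[OF Suc.prems(2)]
      by (intro Ck_on_add assms Suc.IH) auto
  qed (fact assms(2))
qed

lemma Ck_on_sum:
  assumes "open S" "\<And>i. i \<in> I \<Longrightarrow> Ck_on k S (f i)"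
  shows "Ck_on k S (\<lambda>x. \<Sum>i\<in>I. f i x)"
  using assms(2) by (induction I rule: infinite_finite_induct) (auto intro: Ck_on_add Ck_on_const assms(1))

lemma Ck_on_mult:
  fixes f g :: "'a::euclidean_space \<Rightarrow> real"
  assumes "open S" "Ck_on k S f" "Ck_on k S g"
  shows "Ck_on k S (\<lambda>x. f x * g x)"
  using Ck_on_bilinear[OF bounded_bilinear_mult] assms by blast

lemma Ck_on_prod:
  fixes f :: "'i \<Rightarrow> 'a::euclidean_space \<Rightarrow> real"
  assumes "open S" "\<And>i. i \<in> I \<Longrightarrow> Ck_on k S (f i)"
  shows "Ck_on k S (\<lambda>x. \<Prod>i\<in>I. f i x)"
  using assms(2) by (induction I rule: infinite_finite_induct) (auto intro: Ck_on_mult Ck_on_const assms(1))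

lemma Ck_on_minus: "open S \<Longrightarrow> Ck_on k S f \<Longrightarrow> Ck_on k S (\<lambda>x. - f x)"
  by (rule Ck_on_bounded_linear[OF bounded_linear_minus[OF bounded_linear_ident]])

lemma Ck_on_diff: "open S \<Longrightarrow> Ck_on k S f \<Longrightarrow> Ck_on k S g \<Longrightarrow> Ck_on k S (\<lambda>x. f x - g x)"
  using Ck_on_add[of S k f "\<lambda>x. - g x"] Ck_on_minus by force

lemma Ck_on_linear:
  assumes "bounded_linear h" "open S"
  shows "Ck_on k S h"
proof (cases k)
  case 0
  then show ?thesis using assms by (simp add: linear_continuous_on)
next
  case (Suc j)
  have "dir_deriv v h = (\<lambda>x. h v)" for v
    using dir_deriv_eq[OF bounded_linear_imp_has_derivative[OF assms(1)]] by blast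
  then show ?thesis
    using Suc Ck_on_const bounded_linear_imp_differentiable[OF assms(1)] by auto
qed

lemma Ck_on_compose:
  fixes f :: "'a::euclidean_space \<Rightarrow> 'b::euclidean_space" and h :: "'b \<Rightarrow> 'c::real_normed_vector"
  assumes "open S" "open T" "f ` S \<subseteq> T" "Ck_on k S f" "Ck_on k T h"
  shows "Ck_on k S (\<lambda>x. h (f x))"
  using assms(4,5)
proof (induction k arbitrary: h)
  case 0
  then show ?case using assms(3) by (auto intro: continuous_on_compose2)
next
  case (Suc k)
  show ?case
  proof (rule Ck_on_SucI[OF assms(1)])
    fix x assume x: "x \<in> S"
    have h: "(h has_derivative (\<lambda>v. dir_deriv v h (f x))) (at (f x))"
      using Ck_on_Suc_derivative Suc.prems assms(3) x by blast
    show "((\<lambda>x. h (f x)) has_derivative (\<lambda>v. dir_deriv (dir_deriv v f x) h (f x))) (at x)"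
      using has_derivative_compose[OF Ck_on_Suc_derivative[OF Suc.prems(1) x] h] .
  next
    fix v
    \<comment> \<open>The direction \<open>dir_deriv v f x\<close> moves with \<open>x\<close>,
      while the induction hypothesis only covers derivatives of \<open>h\<close> in fixed
      directions. Expanding the direction in the basis separates the two dependences.\<close>
    have eq: "dir_deriv (dir_deriv v f x) h (f x) = (\<Sum>b\<in>Basis. (dir_deriv v f x \<bullet> b) *\<^sub>R dir_deriv b h (f x))"
      if x: "x \<in> S" for x
    proof -
      have h: "(h has_derivative (\<lambda>v. dir_deriv v h (f x))) (at (f x))"
        using Ck_on_Suc_derivative Suc.prems assms(3) x by blast
      have "dir_deriv (dir_deriv v f x) h (f x) = dir_deriv (\<Sum>b\<in>Basis. (dir_deriv v f x \<bullet> b) *\<^sub>R b) h (f x)"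
        by (simp add: euclidean_representation)
      also have "\<dots> = (\<Sum>b\<in>Basis. (dir_deriv v f x \<bullet> b) *\<^sub>R dir_deriv b h (f x))"
        by (simp only: linear_sum[OF has_derivative_linear[OF h]] linear_scale[OF has_derivative_linear[OF h]])
      finally show ?thesis .
    qed
    have "Ck_on k S (\<lambda>x. \<Sum>b\<in>Basis. (dir_deriv v f x \<bullet> b) *\<^sub>R dir_deriv b h (f x))"
    proof (intro Ck_on_sum Ck_on_bilinear[OF bounded_bilinear_scaleR] assms(1))
      show "Ck_on k S (\<lambda>x. dir_deriv v f x \<bullet> b)" for b
        using Suc.prems by (intro Ck_on_bounded_linear[OF bounded_linear_inner_left] assms(1)) auto
      show "Ck_on k S (\<lambda>x. dir_deriv b h (f x))" for b
        using Suc.prems Suc.IH Ck_on_Suc_imp by (metis Ck_on.simps(2))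
    qed
    then show "Ck_on k S (\<lambda>x. dir_deriv (dir_deriv v f x) h (f x))"
      using eq by (subst Ck_on_cong[OF assms(1), of _ "\<lambda>x. \<Sum>b\<in>Basis. (dir_deriv v f x \<bullet> b) *\<^sub>R dir_deriv b h (f x)"])
  qed
qed

lemma Ck_on_inverse:
  fixes f :: "'a::euclidean_space \<Rightarrow> real"
  assumes "open S" "Ck_on k S f" "\<And>x. x \<in> S \<Longrightarrow> f x \<noteq> 0"
  shows "Ck_on k S (\<lambda>x. inverse (f x))"
  using assms(2)
proof (induction k)
  case 0
  then show ?case using assms(3) by (auto intro: continuous_on_inverse)
next
  case (Suc k)
  show ?case
  proof (rule Ck_on_SucI)
    show "x \<in> S \<Longrightarrow> ((\<lambda>x. inverse (f x)) has_derivative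
        (\<lambda>v. - (inverse (f x) * dir_deriv v f x * inverse (f x)))) (at x)" for x
      using assms(3) Ck_on_Suc_derivative[OF Suc.prems] by (intro Deriv.has_derivative_inverse) auto
    show "Ck_on k S (\<lambda>x. - (inverse (f x) * dir_deriv v f x * inverse (f x)))" for v
      using Suc.prems Suc.IH[OF Ck_on_Suc_imp[OF Suc.prems]]
      by (intro Ck_on_minus Ck_on_mult assms(1)) auto
  qed (fact assms(1))
qed

lemma Ck_on_divide:
  fixes f g :: "'a::euclidean_space \<Rightarrow> real"
  assumes "open S" "Ck_on k S f" "Ck_on k S g" "\<And>x. x \<in> S \<Longrightarrow> g x \<noteq> 0"
  shows "Ck_on k S (\<lambda>x. f x / g x)"
  unfolding divide_inverse using assms by (intro Ck_on_mult Ck_on_inverse)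

lemma Ck_on_sqrt:
  fixes f :: "'a::euclidean_space \<Rightarrow> real"
  assumes "open S" "Ck_on k S f" "\<And>x. x \<in> S \<Longrightarrow> f x > 0"
  shows "Ck_on k S (\<lambda>x. sqrt (f x))"
  using assms(2)
proof (induction k)
  case 0
  then show ?case by (auto intro: continuous_on_real_sqrt)
next
  case (Suc k)
  show ?case
  proof (rule Ck_on_SucI)
    show "x \<in> S \<Longrightarrow> ((\<lambda>x. sqrt (f x)) has_derivative
        (\<lambda>v. dir_deriv v f x / (2 * sqrt (f x)))) (at x)" for x
      using has_derivative_real_sqrt[OF assms(3) Ck_on_Suc_derivative[OF Suc.prems]]
      by (simp add: field_simps)
    show "Ck_on k S (\<lambda>x. dir_deriv v f x / (2 * sqrt (f x)))" for v
      using Suc.prems Suc.IH[OF Ck_on_Suc_imp[OF Suc.prems]] assms(3)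
      by (intro Ck_on_divide Ck_on_mult Ck_on_const assms(1)) fastforce+
  qed (fact assms(1))
qed

section \<open>Vector- and matrix-valued maps\<close>

lemma has_derivative_vec:
  fixes f :: "'a::real_normed_vector \<Rightarrow> ('b::euclidean_space)^'n::finite"
  assumes "\<And>i. ((\<lambda>x. f x $ i) has_derivative (\<lambda>v. f' v $ i)) (at a within S)"
  shows "(f has_derivative f') (at a within S)"
  by (subst has_derivative_componentwise_within)
    (auto simp: Basis_vec_def inner_axis intro!: has_derivative_inner_left assms)

lemma Ck_on_vec:
  fixes f :: "'a::euclidean_space \<Rightarrow> ('b::euclidean_space)^'n::finite"
  assumes "open S" "\<And>i. Ck_on k S (\<lambda>x. f x $ i)"
  shows "Ck_on k S f"
  using assms(2)
proof (induction k arbitrary: f)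
  case 0
  then show ?case using continuous_on_vec_lambda[of S "\<lambda>i x. f x $ i"] by simp
next
  case (Suc k)
  have d: "(f has_derivative (\<lambda>v. \<chi> i. dir_deriv v (\<lambda>x. f x $ i) x)) (at x)" if "x \<in> S" for x
  proof -
    have "((\<lambda>x. f x $ i) has_derivative (\<lambda>v. dir_deriv v (\<lambda>x. f x $ i) x)) (at x)" for i
      using Ck_on_Suc_derivative[OF Suc.prems that] .
    then show ?thesis by (intro has_derivative_vec) simp
  qed
  show ?case
    using Suc by (intro Ck_on_SucI[OF assms(1) d]) auto
qed

lemma Ck_on_component:
  fixes f :: "'a::euclidean_space \<Rightarrow> ('b::real_normed_vector)^'n::finite"
  shows "open S \<Longrightarrow> Ck_on k S f \<Longrightarrow> Ck_on k S (\<lambda>x. f x $ i)"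
  by (rule Ck_on_bounded_linear[OF bounded_linear_vec_nth])

lemma Ck_on_component2:
  fixes f :: "'a::euclidean_space \<Rightarrow> ('b::real_normed_vector)^'n::finite^'m::finite"
  shows "open S \<Longrightarrow> Ck_on k S f \<Longrightarrow> Ck_on k S (\<lambda>x. f x $ i $ j)"
  by (intro Ck_on_component)

lemma matrix_inv_works:
  fixes A :: "real^'n^'n"
  assumes "invertible A"
  shows "A ** matrix_inv A = mat 1" "matrix_inv A ** A = mat 1"
  using assms someI_ex[of "\<lambda>A'. A ** A' = mat 1 \<and> A' ** A = mat 1"]
  unfolding invertible_def matrix_inv_def by auto

text \<open>Cramer's rule. It reduces the smoothness of the inverse matrix to that of determinants,
  which are polynomials in the entries.\<close>

lemma matrix_inv_component:
  fixes A :: "real^'n^'n"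
  assumes "invertible A"
  shows "matrix_inv A $ k $ l = det (\<chi> i j. if j = k then if i = l then 1 else 0 else A $ i $ j) / det A"
proof -
  let ?x = "matrix_inv A *v axis l 1"
  have "A *v ?x = axis l 1"
    by (simp add: matrix_vector_mul_assoc matrix_inv_works[OF assms])
  then have "?x = (\<chi> k. det (\<chi> i j. if j = k then axis l 1 $ i else A $ i $ j) / det A)"
    using cramer[of A ?x "axis l 1"] assms invertible_det_nz[of A] by blast
  from arg_cong[OF this, of "\<lambda>v. v $ k"]
  have "?x $ k = det (\<chi> i j. if j = k then axis l 1 $ i else A $ i $ j) / det A"
    by (simp only: vec_lambda_beta)
  moreover have "?x $ k = matrix_inv A $ k $ l"
    by (simp add: matrix_vector_mult_basis column_def)
  moreover have "(\<chi> i j. if j = k then (axis l 1 :: real^'n) $ i else A $ i $ j)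
      = (\<chi> i j. if j = k then if i = l then 1 else 0 else A $ i $ j)"
    by (auto simp: vec_eq_iff axis_def)
  ultimately show ?thesis by simp
qed

lemma Ck_on_det:
  fixes M :: "'a::euclidean_space \<Rightarrow> real^'n::finite^'n"
  assumes "open S" "\<And>i j. Ck_on k S (\<lambda>x. M x $ i $ j)"
  shows "Ck_on k S (\<lambda>x. det (M x))"
  unfolding det_def using assms by (intro Ck_on_sum Ck_on_mult Ck_on_prod Ck_on_const)

lemma Ck_on_matrix_inv:
  fixes M :: "'a::euclidean_space \<Rightarrow> real^'n::finite^'n"
  assumes "open S" "Ck_on k S M" "\<And>x. x \<in> S \<Longrightarrow> invertible (M x)"
  shows "Ck_on k S (\<lambda>x. matrix_inv (M x))"
proof (intro Ck_on_vec assms(1))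
  fix i j
  have "Ck_on k S (\<lambda>x. (if b = i then if a = j then 1 else 0 else M x $ a $ b))" for a b
    using Ck_on_component2[OF assms(1,2)] by (cases "b = i"; cases "a = j") (auto intro: Ck_on_const)
  then have "Ck_on k S (\<lambda>x. det (\<chi> a b. if b = i then if a = j then 1 else 0 else M x $ a $ b))"
    by (intro Ck_on_det assms(1)) simp
  moreover have "Ck_on k S (\<lambda>x. det (M x))"
    by (intro Ck_on_det Ck_on_component2 assms)
  ultimately have "Ck_on k S (\<lambda>x. det (\<chi> a b. if b = i then if a = j then 1 else 0 else M x $ a $ b) / det (M x))"
    using assms(3) invertible_det_nz by (intro Ck_on_divide assms(1)) auto
  then show "Ck_on k S (\<lambda>x. matrix_inv (M x) $ i $ j)"
    using assms by (subst Ck_on_cong[OF assms(1) matrix_inv_component]) auto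
qed

lemma smooth_on_partial: "smooth_on S f \<Longrightarrow> smooth_on S (dir_deriv v f)"
  unfolding smooth_on_def by (metis Ck_on.simps(2))

lemma smooth_on_derivative:
  "smooth_on S f \<Longrightarrow> x \<in> S \<Longrightarrow> (f has_derivative (\<lambda>v. dir_deriv v f x)) (at x)"
  unfolding smooth_on_def using Ck_on_Suc_derivative by blast

section \<open>Symmetry of second derivatives\<close>

lemma has_real_derivative_along_line:
  fixes f :: "'a::euclidean_space \<Rightarrow> real"
  assumes "(f has_derivative D) (at (p + r *\<^sub>R u))"
  shows "((\<lambda>r. f (p + r *\<^sub>R u)) has_real_derivative D u) (at r)"
proof -
  have "((\<lambda>r. p + r *\<^sub>R u) has_derivative (\<lambda>h. h *\<^sub>R u)) (at r)"
    by (auto intro!: derivative_eq_intros)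
  from has_derivative_compose[OF this assms]
  show ?thesis
    using has_derivative_linear[OF assms]
    by (simp add: has_field_derivative_def linear_scale mult_commute_abs)
qed

text \<open>Two applications of the mean value theorem: along \<open>u\<close> to the difference of
  \<open>f\<close> on two parallel edges of the parallelogram, then along \<open>v\<close> to the
  derivative so obtained.\<close>

lemma second_difference:
  fixes f :: "'a::euclidean_space \<Rightarrow> real"
  assumes "Ck_on 2 S f" "s > 0" "\<And>r q. 0 \<le> r \<Longrightarrow> r \<le> s \<Longrightarrow> 0 \<le> q \<Longrightarrow> q \<le> s \<Longrightarrow> x + r *\<^sub>R u + q *\<^sub>R v \<in> S"
  obtains r q where "0 \<le> r" "r \<le> s" "0 \<le> q" "q \<le> s"
    "f (x + s *\<^sub>R u + s *\<^sub>R v) - f (x + s *\<^sub>R u) - f (x + s *\<^sub>R v) + f x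
      = s\<^sup>2 * dir_deriv v (dir_deriv u f) (x + r *\<^sub>R u + q *\<^sub>R v)"
proof -
  have f1: "(f has_derivative (\<lambda>v. dir_deriv v f y)) (at y)"
    and f2: "(dir_deriv u f has_derivative (\<lambda>v. dir_deriv v (dir_deriv u f) y)) (at y)" if "y \<in> S" for y
    using assms(1) that by (auto simp: numeral_2_eq_2 intro: differentiable_has_derivative_dir_deriv)
  define \<phi> where "\<phi> r = f (x + s *\<^sub>R v + r *\<^sub>R u) - f (x + r *\<^sub>R u)" for r
  have "(\<phi> has_real_derivative dir_deriv u f (x + s *\<^sub>R v + r *\<^sub>R u) - dir_deriv u f (x + r *\<^sub>R u)) (at r)"
    if "0 \<le> r" "r \<le> s" for r
    unfolding \<phi>_def
    using assms(3)[of r s] assms(3)[of r 0] that assms(2)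
    by (intro DERIV_diff has_real_derivative_along_line[OF f1]) (auto simp: add_ac)
  from MVT2[OF assms(2) this] obtain r where r: "0 < r" "r < s"
    "\<phi> s - \<phi> 0 = s * (dir_deriv u f (x + s *\<^sub>R v + r *\<^sub>R u) - dir_deriv u f (x + r *\<^sub>R u))" by auto
  have "((\<lambda>q. dir_deriv u f (x + r *\<^sub>R u + q *\<^sub>R v)) has_real_derivative
      dir_deriv v (dir_deriv u f) (x + r *\<^sub>R u + q *\<^sub>R v)) (at q)" if "0 \<le> q" "q \<le> s" for q
    using assms(3)[of r q] r that by (intro has_real_derivative_along_line[OF f2]) auto
  from MVT2[OF assms(2) this] obtain q where q: "0 < q" "q < s"
    "dir_deriv u f (x + r *\<^sub>R u + s *\<^sub>R v) - dir_deriv u f (x + r *\<^sub>R u + 0 *\<^sub>R v)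
      = s * dir_deriv v (dir_deriv u f) (x + r *\<^sub>R u + q *\<^sub>R v)" by auto
  have "\<phi> s - \<phi> 0 = s\<^sup>2 * dir_deriv v (dir_deriv u f) (x + r *\<^sub>R u + q *\<^sub>R v)"
    using r(3) q(3) by (simp add: power2_eq_square add_ac)
  then show ?thesis
    using that[of r q] r q by (auto simp: \<phi>_def add_ac)
qed

text \<open>One and the same second difference over a small parallelogram equals
  \<open>s\<^sup>2\<close> times a value of either mixed derivative at some point of it. Both
  derivatives are continuous at \<open>x\<close>, so different values at \<open>x\<close> would
  contradict this once the parallelogram is small.\<close>

lemma dir_deriv_commute:
  fixes f :: "'a::euclidean_space \<Rightarrow> real"
  assumes "open S" "Ck_on 2 S f" "x \<in> S"
  shows "dir_deriv u (dir_deriv v f) x = dir_deriv v (dir_deriv u f) x"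
proof (rule ccontr)
  let ?a = "dir_deriv v (dir_deriv u f)" and ?b = "dir_deriv u (dir_deriv v f)"
  assume "?b x \<noteq> ?a x"
  define e where "e = \<bar>?a x - ?b x\<bar> / 2"
  have e: "e > 0" using \<open>?b x \<noteq> ?a x\<close> by (simp add: e_def)
  have "continuous_on S ?a" "continuous_on S ?b"
    using assms(2) by (auto simp: numeral_2_eq_2)
  then have "isCont ?a x" "isCont ?b x"
    using assms(1,3) by (auto simp: continuous_on_eq_continuous_at)
  then obtain d1 d2 where d: "d1 > 0" "\<And>y. dist y x < d1 \<Longrightarrow> dist (?a y) (?a x) < e"
      "d2 > 0" "\<And>y. dist y x < d2 \<Longrightarrow> dist (?b y) (?b x) < e"
    using e unfolding continuous_at_eps_delta by metis
  obtain d3 where d3: "d3 > 0" "ball x d3 \<subseteq> S"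
    using assms(1,3) openE by blast
  define m where "m = min d1 (min d2 d3)"
  define N where "N = norm u + norm v + 1"
  \<comment> \<open>With this side length every point of the parallelogram is closer than
    \<open>m\<close> to \<open>x\<close>. The summand 1 in \<open>N\<close> keeps the quotient
    meaningful when both directions vanish.\<close>
  define s where "s = m / (2 * N)"
  have m: "m > 0" using d d3 by (simp add: m_def)
  have n: "N > 0" unfolding N_def by (smt (verit) norm_ge_zero)
  have s: "s > 0" using m n by (simp add: s_def)
  have near: "norm (r *\<^sub>R u + q *\<^sub>R v) < m" if "0 \<le> r" "r \<le> s" "0 \<le> q" "q \<le> s" for r q
  proof -
    have "norm (r *\<^sub>R u + q *\<^sub>R v) \<le> r * norm u + q * norm v"
      using that by (metis abs_of_nonneg norm_scaleR norm_triangle_ineq)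
    also have "\<dots> \<le> s * norm u + s * norm v"
      using that by (intro add_mono mult_right_mono) auto
    also have "\<dots> \<le> s * N"
      using s by (simp add: N_def algebra_simps)
    also have "\<dots> = m / 2" using n by (simp add: s_def)
    finally show ?thesis using m by linarith
  qed
  have inS: "x + r *\<^sub>R u + q *\<^sub>R v \<in> S" if "0 \<le> r" "r \<le> s" "0 \<le> q" "q \<le> s" for r q
  proof -
    have "x + (r *\<^sub>R u + q *\<^sub>R v) \<in> ball x d3"
      using near[OF that] by (subst mem_ball, subst dist_commute) (simp add: m_def dist_norm)
    then show ?thesis using d3(2) by (auto simp: add.assoc)
  qed
  obtain r q where rq: "0 \<le> r" "r \<le> s" "0 \<le> q" "q \<le> s"
    and 1: "f (x + s *\<^sub>R u + s *\<^sub>R v) - f (x + s *\<^sub>R u) - f (x + s *\<^sub>R v) + f x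
      = s\<^sup>2 * ?a (x + r *\<^sub>R u + q *\<^sub>R v)"
    using second_difference[OF assms(2) s, of x u v] inS by blast
  have "x + r *\<^sub>R v + q *\<^sub>R u \<in> S" if "0 \<le> r" "r \<le> s" "0 \<le> q" "q \<le> s" for r q
    using inS[of q r] that by (simp add: add_ac)
  then obtain r' q' where rq': "0 \<le> r'" "r' \<le> s" "0 \<le> q'" "q' \<le> s"
    and 2: "f (x + s *\<^sub>R v + s *\<^sub>R u) - f (x + s *\<^sub>R v) - f (x + s *\<^sub>R u) + f x
      = s\<^sup>2 * ?b (x + r' *\<^sub>R v + q' *\<^sub>R u)"
    using second_difference[OF assms(2) s, of x v u] by blast
  have "s\<^sup>2 * ?a (x + r *\<^sub>R u + q *\<^sub>R v) = s\<^sup>2 * ?b (x + r' *\<^sub>R v + q' *\<^sub>R u)"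
    using 1 2
    unfolding add.assoc[of x "s *\<^sub>R v"] add.assoc[of x "s *\<^sub>R u" "s *\<^sub>R v"] add.commute[of "s *\<^sub>R v" "s *\<^sub>R u"]
    by linarith
  then have "?a (x + r *\<^sub>R u + q *\<^sub>R v) = ?b (x + r' *\<^sub>R v + q' *\<^sub>R u)"
    using s by simp
  moreover have "dist (?a (x + r *\<^sub>R u + q *\<^sub>R v)) (?a x) < e"
    using near[OF rq] by (intro d(2)) (auto simp: m_def dist_norm add.assoc)
  moreover have "dist (?b (x + r' *\<^sub>R v + q' *\<^sub>R u)) (?b x) < e"
    using near[OF rq'(3,4,1,2)] by (intro d(4)) (auto simp: m_def dist_norm add_ac)
  ultimately have "dist (?a x) (?b x) < e + e"
    using dist_triangle2[of "?a x" "?b x" "?a (x + r *\<^sub>R u + q *\<^sub>R v)"] by (simp add: dist_commute)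
  then show False
    by (simp add: e_def dist_real_def)
qed

section \<open>The smooth inverse function theorem\<close>

text \<open>Bootstrapping: the inverse \<open>g\<close> has derivative
  \<open>matrix_inv (J (g y))\<close>, which is as regular as \<open>g\<close> itself, so each step
  of the induction gains one class.\<close>

lemma smooth_local_inverse:
  fixes f :: "real^'n::finite \<Rightarrow> real^'n"
  assumes "open U" "smooth_on U f" "x0 \<in> U" "\<And>v. dir_deriv v f x0 = 0 \<Longrightarrow> v = 0"
  obtains U' V g where "open U'" "U' \<subseteq> U" "x0 \<in> U'" "open V" "homeomorphism U' V f g"
    "smooth_on V g"
proof -
  define J where "J x = matrix (\<lambda>v. dir_deriv v f x)" for x
  have D: "(f has_derivative (\<lambda>v. dir_deriv v f x)) (at x)" if "x \<in> U" for x
    using smooth_on_derivative[OF assms(2) that] .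
  have J: "J x *v v = dir_deriv v f x" if "x \<in> U" for x v
    using fun_cong[OF matrix_vector_mul(2)[OF has_derivative_linear[OF D[OF that]]]] by (simp add: J_def)
  have Jij: "J x $ i $ j = dir_deriv (axis j 1) f x $ i" for x i j
    by (simp add: J_def matrix_def)
  have JC: "Ck_on k U J" for k
    using assms(1,2) smooth_on_partial[OF assms(2)]
    by (intro Ck_on_vec) (auto simp: Jij smooth_on_def intro!: Ck_on_component)
  \<comment> \<open>Multiplication by a matrix is linear at every \<open>x\<close>, even where
    \<open>f\<close> is not differentiable, so \<open>Blinfun\<close> is never applied to a map on
    which it is unspecified.\<close>
  define f' where "f' x = Blinfun (\<lambda>v. J x *v v)" for x
  have f': "blinfun_apply (f' x) = (\<lambda>v. J x *v v)" for x
    by (simp add: f'_def bounded_linear_Blinfun_apply)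
  have cont: "continuous_on U f'"
  proof -
    have "continuous_on U (\<lambda>x. J x *v b)" for b
    proof -
      have "Ck_on 0 U (\<lambda>x. dir_deriv b f x)"
        using smooth_on_partial[OF assms(2)] unfolding smooth_on_def by blast
      moreover have "continuous_on U (\<lambda>x. J x *v b) \<longleftrightarrow> continuous_on U (\<lambda>x. dir_deriv b f x)"
        by (rule continuous_on_cong) (auto simp: J)
      ultimately show ?thesis by simp
    qed
    then show ?thesis
      by (intro continuous_on_blinfun_componentwise) (simp add: f')
  qed
  have inv0: "invertible (J x0)"
  proof -
    have "J x0 *v v = 0 \<Longrightarrow> v = 0" for v
      using assms(4) J[OF assms(3)] by metis
    then show ?thesis
      by (simp add: invertible_left_inverse matrix_left_invertible_ker)
  qed
  have comp: "Blinfun (\<lambda>v. matrix_inv (J x0) *v v) o\<^sub>L f' x0 = id_blinfun"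
    by (rule blinfun_eqI)
      (simp add: f' bounded_linear_Blinfun_apply matrix_vector_mul_assoc matrix_inv_works[OF inv0])
  have D': "(f has_derivative blinfun_apply (f' x)) (at x)" if "x \<in> U" for x
    using D[OF that] J[OF that] by (simp add: f')
  obtain U' V g g' where h: "open U'" "U' \<subseteq> U" "x0 \<in> U'" "open V" "homeomorphism U' V f g"
    and g': "\<And>y. y \<in> V \<Longrightarrow> (g has_derivative (g' y)) (at y)"
    "\<And>y. y \<in> V \<Longrightarrow> g' y = inv (blinfun_apply (f' (g y)))"
    "\<And>y. y \<in> V \<Longrightarrow> bij (blinfun_apply (f' (g y)))"
    using inverse_function_theorem[OF assms(1) D' cont assms(3) comp] by metis
  have gU: "g ` V \<subseteq> U" using h by (auto simp: homeomorphism_def)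
  have inv: "invertible (J (g y))" if "y \<in> V" for y
    using g'(3)[OF that] unfolding f' invertible_eq_bij by simp
  have gd: "(g has_derivative (\<lambda>v. matrix_inv (J (g y)) *v v)) (at y)" if "y \<in> V" for y
  proof -
    have "inv (\<lambda>v. J (g y) *v v) = (\<lambda>v. matrix_inv (J (g y)) *v v)"
      by (rule inv_equality) (simp_all add: matrix_vector_mul_assoc matrix_inv_works[OF inv[OF that]])
    then show ?thesis using g'(1,2)[OF that] by (simp add: f')
  qed
  have "Ck_on k V g" for k
  proof (induction k)
    case 0
    then show ?case using h by (simp add: homeomorphism_def)
  next
    case (Suc k)
    show ?case
    proof (rule Ck_on_SucI[OF h(4) gd])
      fix v
      have M: "Ck_on k V (\<lambda>y. matrix_inv (J (g y)))"
        using inv by (intro Ck_on_matrix_inv h(4) Ck_on_compose[OF h(4) assms(1) gU Suc JC])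
      have "Ck_on k V (\<lambda>y. \<Sum>j\<in>UNIV. matrix_inv (J (g y)) $ i $ j * v $ j)" for i
        by (intro Ck_on_sum Ck_on_mult Ck_on_const Ck_on_component2 M h(4))
      then show "Ck_on k V (\<lambda>y. matrix_inv (J (g y)) *v v)"
        by (intro Ck_on_vec h(4)) (simp add: matrix_vector_mult_def)
    qed
  qed
  then show ?thesis
    using that[of U' V g] h by (simp add: smooth_on_def)
qed

section \<open>Fixed points depending on parameters\<close>

lemma half_contraction_unique:
  fixes x y :: "'e::real_normed_vector"
  assumes "bounded_linear A" "\<And>\<zeta>. norm (A \<zeta>) \<le> norm \<zeta> / 2" "x = c + A x" "y = c + A y"
  shows "x = y"
proof -
  have "x - y = (c + A x) - (c + A y)"
    by (rule arg_cong2[OF assms(3,4)])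
  also have "\<dots> = A (x - y)"
    by (simp add: linear_diff[OF bounded_linear.linear[OF assms(1)]])
  finally have "x - y = A (x - y)" .
  then have "norm (x - y) \<le> norm (x - y) / 2" using assms(2) by metis
  then show ?thesis using norm_ge_zero[of "x - y"] by (simp add: field_simps)
qed

lemma half_contraction_fixed_point:
  fixes A :: "'e::banach \<Rightarrow> 'e"
  assumes "bounded_linear A" "\<And>\<zeta>. norm (A \<zeta>) \<le> norm \<zeta> / 2"
  shows "\<exists>\<zeta>. \<zeta> = c + A \<zeta>"
proof -
  have "\<forall>x y. dist (c + A x) (c + A y) \<le> (1/2) * dist x y"
    using assms(2) bounded_linear.linear[OF assms(1)]
    by (auto simp: dist_norm linear_diff[symmetric])
  then obtain \<zeta> where "c + A \<zeta> = \<zeta>"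
    using banach_fix_type[of "1/2" "\<lambda>\<zeta>. c + A \<zeta>"] by auto
  from this[symmetric] show ?thesis by (rule exI)
qed

text \<open>Linearising \<open>z \<mu> = \<Psi> \<mu> (z \<mu>)\<close> gives the equation for
  \<open>z'\<close>. Since \<open>A\<close> halves norms, its solution is unique, hence linear in
  \<open>h\<close>, and the error of the linearisation is at most doubled when passing to
  \<open>z\<close>. The derivative of \<open>\<Psi>\<close> is taken within
  \<open>S \<times> C\<close> because in the application \<open>C\<close> consists of the paths that
  stay in a compact set.\<close>

lemma implicit_has_derivative:
  fixes z :: "'l::real_normed_vector \<Rightarrow> 'e::banach"
  assumes \<Psi>: "((\<lambda>p. \<Psi> (fst p) (snd p)) has_derivative (\<lambda>p. B (fst p) + A (snd p)))
      (at (l, z l) within S \<times> C)"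
    and fp: "\<And>\<mu>. \<mu> \<in> S \<Longrightarrow> z \<mu> \<in> C \<and> z \<mu> = \<Psi> \<mu> (z \<mu>)"
    and "l \<in> S"
    and cont: "continuous (at l within S) z"
    and A: "bounded_linear A" "\<And>\<zeta>. norm (A \<zeta>) \<le> norm \<zeta> / 2"
    and z': "\<And>h. z' h = B h + A (z' h)"
  shows "(z has_derivative z') (at l within S)"
proof -
  have lin: "bounded_linear (\<lambda>p. B (fst p) + A (snd p))"
    using \<Psi> by (rule has_derivative_bounded_linear)
  have A0: "A 0 = 0" using A(1) by (simp add: linear_simps)
  have linB: "bounded_linear B"
    using bounded_linear_compose[OF lin bounded_linear_Pair[OF bounded_linear_ident bounded_linear_zero]]
    by (simp add: A0)
  obtain K where K: "K \<ge> 0" "\<And>h. norm (B h) \<le> norm h * K"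
    using bounded_linear.nonneg_bounded[OF linB] by blast
  note lA = bounded_linear.linear[OF A(1)] and lB = bounded_linear.linear[OF linB]
  have z'_bound: "norm (z' h) \<le> norm h * (2 * K)" for h
  proof -
    have "norm (z' h) \<le> norm (B h) + norm (A (z' h))"
      using z'[of h] norm_triangle_ineq by metis
    then show ?thesis using A(2)[of "z' h"] K(2)[of h] by simp
  qed
  have linz: "bounded_linear z'"
  proof (rule bounded_linear_intro[OF _ _ z'_bound])
    show "z' (x + y) = z' x + z' y" for x y
    proof (rule half_contraction_unique[OF A z'])
      have "z' x + z' y = (B x + A (z' x)) + (B y + A (z' y))"
        by (rule arg_cong2[OF z' z'])
      also have "\<dots> = B (x + y) + A (z' x + z' y)"
        by (simp add: linear_add[OF lA] linear_add[OF lB])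
      finally show "z' x + z' y = B (x + y) + A (z' x + z' y)" .
    qed
    show "z' (r *\<^sub>R x) = r *\<^sub>R z' x" for r x
    proof (rule half_contraction_unique[OF A z'])
      have "r *\<^sub>R z' x = r *\<^sub>R (B x + A (z' x))"
        by (rule arg_cong[OF z'])
      also have "\<dots> = B (r *\<^sub>R x) + A (r *\<^sub>R z' x)"
        by (simp add: linear_scale[OF lA] linear_scale[OF lB] scaleR_add_right)
      finally show "r *\<^sub>R z' x = B (r *\<^sub>R x) + A (r *\<^sub>R z' x)" .
    qed
  qed
  show ?thesis
    unfolding has_derivative_within_alt
  proof (intro conjI allI impI linz)
    fix e :: real assume e: "e > 0"
    \<comment> \<open>The bound 1/4 allows the remainder to be absorbed next to the factor 1/2 of
      \<open>A\<close>, which yields \<open>norm \<Delta> \<le> norm h * (4 * K + 1)\<close>. The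
      second bound then makes twice the remainder at most \<open>e * norm h\<close>.\<close>
    define e' where "e' = min (1/4) (e / (2 * (4 * K + 2)))"
    have e': "e' > 0" "e' \<le> 1/4" "2 * e' * (4 * K + 2) \<le> e"
    proof -
      show "e' > 0" using e K(1) by (simp add: e'_def)
      show "e' \<le> 1/4" unfolding e'_def by (rule min.cobounded1)
      have "e' \<le> e / (2 * (4 * K + 2))" by (simp add: e'_def)
      then show "2 * e' * (4 * K + 2) \<le> e" using K by (simp add: field_simps)
    qed
    obtain d1 where d1: "d1 > 0" "\<And>p. p \<in> S \<times> C \<Longrightarrow> norm (p - (l, z l)) < d1 \<Longrightarrow>
        norm (\<Psi> (fst p) (snd p) - \<Psi> l (z l) - (B (fst (p - (l, z l))) + A (snd (p - (l, z l)))))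
          \<le> e' * norm (p - (l, z l))"
      using \<Psi> e'(1) unfolding has_derivative_within_alt fst_conv snd_conv by blast
    obtain d2 where d2: "d2 > 0" "\<And>\<mu>. \<mu> \<in> S \<Longrightarrow> dist \<mu> l < d2 \<Longrightarrow> dist (z \<mu>) (z l) < d1 / 2"
      using cont d1(1) unfolding continuous_within_eps_delta by (metis half_gt_zero)
    show "\<exists>d>0. \<forall>\<mu>\<in>S. norm (\<mu> - l) < d \<longrightarrow> norm (z \<mu> - z l - z' (\<mu> - l)) \<le> e * norm (\<mu> - l)"
    proof (intro exI[of _ "min d2 (d1/2)"] conjI ballI impI)
      show "0 < min d2 (d1/2)" using d1 d2 by simp
      fix \<mu> assume \<mu>: "\<mu> \<in> S" "norm (\<mu> - l) < min d2 (d1/2)"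
      define h \<Delta> where "h = \<mu> - l" and "\<Delta> = z \<mu> - z l"
      have n: "norm (h, \<Delta>) \<le> norm h + norm \<Delta>" by (simp add: norm_Pair_le)
      have "norm (\<Delta> - (B h + A \<Delta>)) \<le> e' * norm (h, \<Delta>)"
        using d1(2)[of "(\<mu>, z \<mu>)"] fp[OF \<mu>(1)] fp[OF assms(3)] \<mu> d2(2)[OF \<mu>(1)] n
        by (auto simp: h_def \<Delta>_def dist_norm)
      also have "\<dots> \<le> e' * (norm h + norm \<Delta>)" using n e'(1) by (intro mult_left_mono) auto
      finally have *: "norm (\<Delta> - (B h + A \<Delta>)) \<le> e' * (norm h + norm \<Delta>)" .
      have "norm \<Delta> \<le> norm (\<Delta> - (B h + A \<Delta>)) + (norm (B h) + norm (A \<Delta>))"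
        by (smt (verit) norm_triangle_ineq norm_triangle_sub)
      also have "\<dots> \<le> (norm h + norm \<Delta>) / 4 + (norm h * K + norm \<Delta> / 2)"
      proof -
        have "e' * (norm h + norm \<Delta>) \<le> (1/4) * (norm h + norm \<Delta>)"
          by (rule mult_right_mono[OF e'(2)]) simp
        then show ?thesis using * K(2)[of h] A(2)[of \<Delta>] by linarith
      qed
      finally have \<Delta>: "norm \<Delta> \<le> norm h * (4 * K + 1)"
        by (simp add: field_simps)
      have "\<Delta> - z' h = (\<Delta> - (B h + A \<Delta>)) + A (\<Delta> - z' h)"
        using z'[of h] by (simp add: linear_diff[OF lA] algebra_simps)
      then have "norm (\<Delta> - z' h) \<le> norm (\<Delta> - (B h + A \<Delta>)) + norm (A (\<Delta> - z' h))"
        using norm_triangle_ineq by metis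
      then have "norm (\<Delta> - z' h) \<le> 2 * (e' * (norm h + norm \<Delta>))"
        using * A(2)[of "\<Delta> - z' h"] by linarith
      also have "\<dots> \<le> 2 * (e' * (norm h * (4 * K + 2)))"
      proof -
        have "norm h + norm \<Delta> \<le> norm h * (4 * K + 2)"
          using \<Delta> by (simp add: algebra_simps)
        then show ?thesis using e'(1) by (intro mult_left_mono) auto
      qed
      also have "\<dots> = (2 * e' * (4 * K + 2)) * norm h" by (simp add: algebra_simps)
      also have "\<dots> \<le> e * norm h" using e'(3) by (intro mult_right_mono) auto
      finally show "norm (z \<mu> - z l - z' (\<mu> - l)) \<le> e * norm (\<mu> - l)"
        by (simp add: h_def \<Delta>_def)
    qed
  qed
qed

text \<open>A derivative of the solution satisfies an equation of the same form, with the same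
  \<open>A\<close> and with \<open>b\<close> replaced by
  \<open>dir_deriv v b l + dir_deriv v A l (z l)\<close>. Hence the induction on the class keeps
  \<open>A\<close> and varies \<open>b\<close> and \<open>z\<close>.\<close>

lemma Ck_on_linear_fixed_point:
  fixes A :: "'l::euclidean_space \<Rightarrow> ('e::banach \<Rightarrow>\<^sub>L 'e)"
  assumes "open S" "Ck_on k S A" "Ck_on k S b"
    and half: "\<And>l \<zeta>. l \<in> S \<Longrightarrow> norm (A l \<zeta>) \<le> norm \<zeta> / 2"
    and "\<And>l. l \<in> S \<Longrightarrow> z l = b l + A l (z l)"
  shows "Ck_on k S z"
  using assms(2,3,5)
proof (induction k arbitrary: b z)
  case 0
  show ?case
    unfolding Ck_on.simps continuous_on_def
  proof
    fix l assume l: "l \<in> S"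
    have "((\<lambda>\<mu>. 2 * norm (b \<mu> - b l + (A \<mu> - A l) (z l))) \<longlongrightarrow> 2 * norm (b l - b l + (A l - A l) (z l))) (at l within S)"
      using 0 l by (intro tendsto_intros) (auto simp: continuous_on_def)
    then have lim: "((\<lambda>\<mu>. 2 * norm (b \<mu> - b l + (A \<mu> - A l) (z l))) \<longlongrightarrow> 0) (at l within S)"
      by simp
    have "norm (z \<mu> - z l) \<le> 2 * norm (b \<mu> - b l + (A \<mu> - A l) (z l))" if "\<mu> \<in> S" for \<mu>
    proof -
      have "z \<mu> - z l = (b \<mu> - b l + (A \<mu> - A l) (z l)) + A \<mu> (z \<mu> - z l)"
        using 0(3)[OF that] 0(3)[OF l] by (simp add: blinfun.bilinear_simps algebra_simps)
      then have "norm (z \<mu> - z l) \<le> norm (b \<mu> - b l + (A \<mu> - A l) (z l)) + norm (A \<mu> (z \<mu> - z l))"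
        using norm_triangle_ineq by metis
      then show ?thesis using half[OF that, of "z \<mu> - z l"] by linarith
    qed
    then have "((\<lambda>\<mu>. z \<mu> - z l) \<longlongrightarrow> 0) (at l within S)"
      by (intro Lim_null_comparison[OF _ lim]) (auto simp: eventually_at_filter)
    then show "(z \<longlongrightarrow> z l) (at l within S)" by (simp add: LIM_zero_iff)
  qed
next
  case (Suc k)
  have zk: "Ck_on k S z"
    by (rule Suc.IH[OF Ck_on_Suc_imp[OF Suc.prems(1)] Ck_on_Suc_imp[OF Suc.prems(2)] Suc.prems(3)])
  define b' where "b' v l = dir_deriv v b l + dir_deriv v A l (z l)" for v l
  define z' where "z' v l = (SOME \<zeta>. \<zeta> = b' v l + A l \<zeta>)" for v l
  have z': "z' v l = b' v l + A l (z' v l)" if "l \<in> S" for v l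
    unfolding z'_def
    by (rule someI_ex[OF half_contraction_fixed_point[OF blinfun.bounded_linear_right half[OF that]]])
  show ?case
  proof (rule Ck_on_SucI[OF assms(1)])
    fix l assume l: "l \<in> S"
    have "(z has_derivative (\<lambda>v. z' v l)) (at l within S)"
    proof (rule implicit_has_derivative[where \<Psi> = "\<lambda>\<mu> \<zeta>. b \<mu> + A \<mu> \<zeta>" and C = UNIV])
      have d1: "((\<lambda>p. b (fst p)) has_derivative (\<lambda>p. dir_deriv (fst p) b l)) (at (l, z l))"
        by (rule has_derivative_compose[OF has_derivative_fst[OF has_derivative_ident]])
          (simp add: Ck_on_Suc_derivative[OF Suc.prems(2) l] del: Ck_on.simps)
      have d2: "((\<lambda>p. A (fst p)) has_derivative (\<lambda>p. dir_deriv (fst p) A l)) (at (l, z l))"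
        by (rule has_derivative_compose[OF has_derivative_fst[OF has_derivative_ident]])
          (simp add: Ck_on_Suc_derivative[OF Suc.prems(1) l] del: Ck_on.simps)
      have "((\<lambda>p. b (fst p) + A (fst p) (snd p)) has_derivative
          (\<lambda>p. dir_deriv (fst p) b l + (A l (snd p) + dir_deriv (fst p) A l (z l)))) (at (l, z l))"
        by (rule has_derivative_eq_rhs[OF has_derivative_add[OF d1 blinfun.FDERIV[OF d2 has_derivative_snd[OF has_derivative_ident]]]])
          (simp add: fun_eq_iff)
      then show "((\<lambda>p. b (fst p) + A (fst p) (snd p)) has_derivative
          (\<lambda>p. b' (fst p) l + A l (snd p))) (at (l, z l) within S \<times> UNIV)"
        by (rule has_derivative_at_withinI[OF has_derivative_eq_rhs]) (simp add: b'_def fun_eq_iff add_ac)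
      show "continuous (at l within S) z"
        using Ck_on_continuous[OF zk] l by (simp add: continuous_on_eq_continuous_within)
      show "z \<mu> \<in> UNIV \<and> z \<mu> = b \<mu> + A \<mu> (z \<mu>)" if "\<mu> \<in> S" for \<mu>
        using Suc.prems(3)[OF that] by (rule conjI[OF UNIV_I])
    qed (fact l blinfun.bounded_linear_right half[OF l] z'[OF l])+
    then show "(z has_derivative (\<lambda>v. z' v l)) (at l)"
      using at_within_open[OF l assms(1)] by simp
  next
    fix v
    show "Ck_on k S (\<lambda>x. z' v x)"
    proof (rule Suc.IH)
      show "Ck_on k S A" using Suc.prems(1) by (rule Ck_on_Suc_imp)
      show "Ck_on k S (b' v)"
        unfolding b'_def[abs_def] using Suc.prems zk
        by (intro Ck_on_add Ck_on_bilinear[OF bounded_bilinear_blinfun_apply] assms(1)) auto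
    qed (rule z')
  qed
qed

section \<open>Smooth dependence of flows on the initial value\<close>

abbreviation clamp01 :: "real \<Rightarrow> real" where
  "clamp01 s \<equiv> max 0 (min 1 s)"

lemma bounded_linear_apply_bcontfun:
  "bounded_linear (\<lambda>z :: 's::topological_space \<Rightarrow>\<^sub>C 'b::real_normed_vector. apply_bcontfun z s)"
  by (rule bounded_linear_intro[where K = 1]) (auto intro: norm_bounded)

lemma apply_Bcontfun:
  fixes f :: "'s::topological_space \<Rightarrow> 'b::real_normed_vector"
  assumes "continuous_on UNIV f" "\<And>s. norm (f s) \<le> B"
  shows "apply_bcontfun (Bcontfun f) = f"
  using bcontfun_normI[OF assms] by (rule Bcontfun_inverse)

lemma norm_integral_clamp01_le:
  fixes z :: "real \<Rightarrow>\<^sub>C 'x::euclidean_space"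
  shows "norm (integral {0..clamp01 s} z) \<le> norm z"
proof -
  have "norm (integral {0..clamp01 s} z) \<le> norm z * (clamp01 s - 0)"
    by (rule integral_bound) (auto intro: norm_bounded)
  also have "\<dots> \<le> norm z * 1" by (rule mult_left_mono) auto
  finally show ?thesis by simp
qed

text \<open>The primitive of a path, frozen outside the unit interval. The clamping keeps it bounded
  on all of \<open>real\<close>, so that paths form one Banach space under the supremum
  norm.\<close>

definition path_integral :: "(real \<Rightarrow>\<^sub>C 'x::euclidean_space) \<Rightarrow> (real \<Rightarrow>\<^sub>C 'x)" where
  "path_integral z = Bcontfun (\<lambda>s. integral {0..clamp01 s} z)"

lemma apply_path_integral: "apply_bcontfun (path_integral z) = (\<lambda>s. integral {0..clamp01 s} z)"
  unfolding path_integral_def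
proof (rule apply_Bcontfun[OF _ norm_integral_clamp01_le])
  have "continuous_on {0..1} (\<lambda>x. integral {0..x} z)"
    by (intro indefinite_integral_continuous_1 integrable_continuous_real) simp
  then show "continuous_on UNIV (\<lambda>s. integral {0..clamp01 s} z)"
    by (rule continuous_on_compose2) (auto intro!: continuous_intros)
qed

lemma bounded_linear_path_integral:
  "bounded_linear (path_integral :: (real \<Rightarrow>\<^sub>C 'x::euclidean_space) \<Rightarrow> _)"
proof (rule bounded_linear_intro[where K = 1])
  have i: "apply_bcontfun z integrable_on {0..t}" for z :: "real \<Rightarrow>\<^sub>C 'x" and t
    by (intro integrable_continuous_real) simp
  show "path_integral (z + w) = path_integral z + path_integral w" for z w :: "real \<Rightarrow>\<^sub>C 'x"
    by (rule bcontfun_eqI) (simp add: apply_path_integral integral_add[OF i i])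
  show "path_integral (r *\<^sub>R z) = r *\<^sub>R path_integral z" for r and z :: "real \<Rightarrow>\<^sub>C 'x"
    by (rule bcontfun_eqI) (simp add: apply_path_integral)
  show "norm (path_integral z) \<le> norm z * 1" for z :: "real \<Rightarrow>\<^sub>C 'x"
    by (rule norm_bound) (simp add: apply_path_integral norm_integral_clamp01_le)
qed

lemma norm_path_integral_le: "norm (path_integral z) \<le> norm z"
  by (rule norm_bound) (simp add: apply_path_integral norm_integral_clamp01_le)

section \<open>Superposition operators on spaces of paths\<close>

definition coord_mult ::
    "'x::euclidean_space \<Rightarrow> (real \<Rightarrow>\<^sub>C 'b::real_normed_vector) \<Rightarrow> (real \<Rightarrow>\<^sub>C 'x) \<Rightarrow> (real \<Rightarrow>\<^sub>C 'b)" where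
  "coord_mult i a z = Bcontfun (\<lambda>s. (z s \<bullet> i) *\<^sub>R a s)"

lemma apply_coord_mult: "apply_bcontfun (coord_mult i a z) = (\<lambda>s. (z s \<bullet> i) *\<^sub>R a s)"
  unfolding coord_mult_def
proof (rule apply_Bcontfun)
  show "continuous_on UNIV (\<lambda>s. (z s \<bullet> i) *\<^sub>R a s)"
    by (intro continuous_intros) auto
  have "\<bar>z s \<bullet> i\<bar> \<le> norm z * norm i" for s
    by (rule order_trans[OF Cauchy_Schwarz_ineq2]) (intro mult_right_mono norm_bounded norm_ge_zero)
  then show "norm ((z s \<bullet> i) *\<^sub>R a s) \<le> (norm z * norm i) * norm a" for s
    by (simp add: mult_mono norm_bounded)
qed

lemma bounded_bilinear_coord_mult:
  "bounded_bilinear (coord_mult i :: (real \<Rightarrow>\<^sub>C 'b::real_normed_vector) \<Rightarrow> (real \<Rightarrow>\<^sub>C 'x::euclidean_space) \<Rightarrow> _)"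
proof
  show "\<exists>K. \<forall>(a :: real \<Rightarrow>\<^sub>C 'b) z. norm (coord_mult i a z) \<le> norm a * norm z * K"
  proof (intro exI allI)
    fix a :: "real \<Rightarrow>\<^sub>C 'b" and z
    show "norm (coord_mult i a z) \<le> norm a * norm z * norm i"
    proof (rule norm_bound)
      fix s
      have "\<bar>z s \<bullet> i\<bar> \<le> norm z * norm i"
        by (rule order_trans[OF Cauchy_Schwarz_ineq2]) (intro mult_right_mono norm_bounded norm_ge_zero)
      then have "\<bar>z s \<bullet> i\<bar> * norm (a s) \<le> (norm z * norm i) * norm a"
        by (intro mult_mono norm_bounded) auto
      then show "norm (apply_bcontfun (coord_mult i a z) s) \<le> norm a * norm z * norm i"
        by (simp add: apply_coord_mult mult_ac)
    qed
  qed
qed (auto intro!: bcontfun_eqI simp: apply_coord_mult algebra_simps inner_add_left)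

text \<open>\<open>Bcontfun\<close> is unspecified off the bounded continuous functions, so \<open>nemytskii f z\<close> is
  meaningful only if \<open>z\<close> stays in a compact set on which \<open>f\<close> is continuous.\<close>

definition nemytskii :: "('x::euclidean_space \<Rightarrow> 'b::real_normed_vector) \<Rightarrow> (real \<Rightarrow>\<^sub>C 'x) \<Rightarrow> (real \<Rightarrow>\<^sub>C 'b)" where
  "nemytskii f z = Bcontfun (\<lambda>s. f (z s))"

definition paths_in :: "'x::euclidean_space set \<Rightarrow> (real \<Rightarrow>\<^sub>C 'x) set" where
  "paths_in K = {z. \<forall>s. apply_bcontfun z s \<in> K}"

lemma apply_nemytskii:
  assumes "compact K" "continuous_on K f" "z \<in> paths_in K"
  shows "apply_bcontfun (nemytskii f z) = (\<lambda>s. f (z s))"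
proof -
  obtain B where "\<And>x. x \<in> K \<Longrightarrow> norm (f x) \<le> B"
    using compact_continuous_image[OF assms(2,1)] compact_imp_bounded
    by (metis bounded_iff imageI)
  moreover have "continuous_on UNIV (\<lambda>s. f (z s))"
    using assms(3) by (intro continuous_on_compose2[OF assms(2)]) (auto simp: paths_in_def)
  ultimately show ?thesis
    unfolding nemytskii_def using assms(3) by (intro apply_Bcontfun) (auto simp: paths_in_def)
qed

text \<open>The pointwise value is \<open>dir_deriv (\<zeta> s) f (z s)\<close>. Written as a sum
  over \<open>Basis\<close>, the dependence on \<open>z\<close> passes only through Nemytskii
  operators of the partial derivatives of \<open>f\<close>, which is what an induction over the
  class can handle.\<close>

definition nemytskii_deriv ::
    "('x::euclidean_space \<Rightarrow> 'b::real_normed_vector) \<Rightarrow> (real \<Rightarrow>\<^sub>C 'x) \<Rightarrow> (real \<Rightarrow>\<^sub>C 'x) \<Rightarrow> (real \<Rightarrow>\<^sub>C 'b)" where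
  "nemytskii_deriv f z \<zeta> = (\<Sum>i\<in>Basis. coord_mult i (nemytskii (dir_deriv i f) z) \<zeta>)"

lemma bounded_linear_nemytskii_deriv: "bounded_linear (nemytskii_deriv f z)"
  unfolding nemytskii_deriv_def[abs_def]
  by (intro bounded_linear_sum bounded_bilinear.bounded_linear_right[OF bounded_bilinear_coord_mult])

lemma dir_deriv_Basis:
  fixes f :: "'x::euclidean_space \<Rightarrow> 'b::real_normed_vector"
  assumes "f differentiable (at x)"
  shows "dir_deriv v f x = (\<Sum>i\<in>Basis. (v \<bullet> i) *\<^sub>R dir_deriv i f x)"
proof -
  have l: "linear (\<lambda>v. dir_deriv v f x)"
    using assms by (intro has_derivative_linear[OF differentiable_has_derivative_dir_deriv])
  have "dir_deriv v f x = dir_deriv (\<Sum>i\<in>Basis. (v \<bullet> i) *\<^sub>R i) f x"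
    by (simp add: euclidean_representation)
  then show ?thesis
    by (simp only: linear_sum[OF l] linear_scale[OF l])
qed

lemma C1_continuous:
  assumes "Ck_on 1 U f" "K \<subseteq> U"
  shows "continuous_on K f" "continuous_on K (dir_deriv v f)"
  using assms Ck_on_continuous[OF assms(1)] by (auto intro: continuous_on_subset)

lemma apply_nemytskii_deriv:
  assumes "compact K" "K \<subseteq> U" "Ck_on 1 U f" "z \<in> paths_in K"
  shows "apply_bcontfun (nemytskii_deriv f z \<zeta>) s = dir_deriv (\<zeta> s) f (z s)"
proof -
  have "apply_bcontfun (nemytskii_deriv f z \<zeta>) s
      = (\<Sum>i\<in>Basis. apply_bcontfun (coord_mult i (nemytskii (dir_deriv i f) z) \<zeta>) s)"
    unfolding nemytskii_deriv_def
    by (rule linear_sum[OF bounded_linear.linear[OF bounded_linear_apply_bcontfun]])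
  also have "\<dots> = (\<Sum>i\<in>Basis. (\<zeta> s \<bullet> i) *\<^sub>R dir_deriv i f (z s))"
    using apply_nemytskii[OF assms(1) C1_continuous(2)[OF assms(3,2)] assms(4)]
    by (simp add: apply_coord_mult)
  also have "\<dots> = dir_deriv (\<zeta> s) f (z s)"
    using assms by (subst dir_deriv_Basis) (auto simp: paths_in_def)
  finally show ?thesis .
qed

text \<open>The partial derivatives are uniformly continuous on the compact set \<open>K\<close>,
  and convexity keeps the segment from \<open>a\<close> to \<open>b\<close> inside \<open>K\<close>,
  so one \<open>d\<close> serves all base points. Each of the \<open>DIM('x)\<close> coordinates
  contributes at most \<open>e / ?n\<close> to the operator norm.\<close>

lemma C1_uniformly_differentiable:
  fixes f :: "'x::euclidean_space \<Rightarrow> 'b::real_normed_vector"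
  assumes K: "compact K" "convex K" "K \<subseteq> U" and f: "Ck_on 1 U f" and "e > 0"
  obtains d where "d > 0" "\<And>a b. a \<in> K \<Longrightarrow> b \<in> K \<Longrightarrow> norm (b - a) < d \<Longrightarrow>
    norm (f b - f a - dir_deriv (b - a) f a) \<le> e * norm (b - a)"
proof -
  let ?n = "real DIM('x)"
  have "\<exists>d>0. \<forall>x\<in>K. \<forall>y\<in>K. dist y x < d \<longrightarrow> dist (dir_deriv i f y) (dir_deriv i f x) < e / ?n" for i
    using compact_uniformly_continuous[OF C1_continuous(2)[OF f K(3)] K(1), of i] \<open>e > 0\<close>
    unfolding uniformly_continuous_on_def by (simp add: DIM_positive)
  then obtain d where d: "\<And>i. d i > 0"
    "\<And>i x y. x \<in> K \<Longrightarrow> y \<in> K \<Longrightarrow> dist y x < d i \<Longrightarrow> dist (dir_deriv i f y) (dir_deriv i f x) < e / ?n"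
    by metis
  define d0 where "d0 = Min (d ` Basis)"
  have d0: "d0 > 0" "\<And>i. i \<in> Basis \<Longrightarrow> d0 \<le> d i"
    using d(1) by (auto simp: d0_def)
  show ?thesis
  proof (rule that[OF d0(1)])
    fix a b assume ab: "a \<in> K" "b \<in> K" "norm (b - a) < d0"
    let ?S = "closed_segment a b"
    have SK: "?S \<subseteq> K" using ab K(2) by (simp add: closed_segment_subset)
    have diff: "f differentiable (at x)" if "x \<in> K" for x using f K(3) that by auto
    have "norm (f b - f a - dir_deriv (b - a) f a) \<le> norm (b - a) * e"
    proof (rule differentiable_bound_linearization[where S = ?S and f' = "\<lambda>x v. dir_deriv v f x"])
      show "a + t *\<^sub>R (b - a) \<in> ?S" if "t \<in> {0..1}" for t
        using that by (auto simp: in_segment algebra_simps intro!: exI[of _ t])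
      show "(f has_derivative (\<lambda>v. dir_deriv v f x)) (at x within ?S)" if "x \<in> ?S" for x
        using diff SK that by (blast intro: has_derivative_at_withinI differentiable_has_derivative_dir_deriv)
      show "onorm ((\<lambda>v. dir_deriv v f x) - (\<lambda>v. dir_deriv v f a)) \<le> e" if "x \<in> ?S" for x
      proof (rule onorm_bound)
        fix v
        have xK: "x \<in> K" using SK that by auto
        have xa: "dist x a < d0"
          using segment_bound(1)[OF that] ab(3) by (simp add: dist_norm)
        have "norm (dir_deriv v f x - dir_deriv v f a)
            = norm (\<Sum>i\<in>Basis. (v \<bullet> i) *\<^sub>R (dir_deriv i f x - dir_deriv i f a))"
          by (simp add: dir_deriv_Basis[OF diff[OF xK], of v] dir_deriv_Basis[OF diff[OF ab(1)], of v]
              scaleR_diff_right sum_subtractf)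
        also have "\<dots> \<le> (\<Sum>i\<in>(Basis::'x set). norm v * (e / ?n))"
        proof (rule sum_norm_le)
          fix i :: 'x assume i: "i \<in> Basis"
          have "norm (dir_deriv i f x - dir_deriv i f a) \<le> e / ?n"
            using d(2)[OF ab(1) xK, of i] xa d0(2)[OF i] by (auto simp: dist_norm intro: less_imp_le)
          then show "norm ((v \<bullet> i) *\<^sub>R (dir_deriv i f x - dir_deriv i f a)) \<le> norm v * (e / ?n)"
            using Basis_le_norm[OF i, of v] unfolding norm_scaleR real_norm_def
            by (intro mult_mono) auto
        qed
        also have "\<dots> = e * norm v" by simp
        finally show "norm (((\<lambda>v. dir_deriv v f x) - (\<lambda>v. dir_deriv v f a)) v) \<le> e * norm v"
          by simp
      qed (use \<open>e > 0\<close> in simp)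
    qed simp
    then show "norm (f b - f a - dir_deriv (b - a) f a) \<le> e * norm (b - a)"
      by (simp add: mult.commute)
  qed
qed

text \<open>In the supremum norm the first-order remainder must be small at all points of the path
  at once. This is the uniformity provided by \<open>C1_uniformly_differentiable\<close>.\<close>

lemma nemytskii_has_derivative:
  assumes "compact K" "convex K" "K \<subseteq> U" "Ck_on 1 U f" "z \<in> paths_in K"
  shows "(nemytskii f has_derivative nemytskii_deriv f z) (at z within paths_in K)"
  unfolding has_derivative_within_alt
proof (intro conjI allI impI bounded_linear_nemytskii_deriv)
  fix e :: real assume "e > 0"
  from C1_uniformly_differentiable[OF assms(1-4) this]
  obtain d where d: "d > 0" "\<And>a b. a \<in> K \<Longrightarrow> b \<in> K \<Longrightarrow> norm (b - a) < d \<Longrightarrow>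
    norm (f b - f a - dir_deriv (b - a) f a) \<le> e * norm (b - a)" by blast
  show "\<exists>d>0. \<forall>y\<in>paths_in K. norm (y - z) < d \<longrightarrow>
      norm (nemytskii f y - nemytskii f z - nemytskii_deriv f z (y - z)) \<le> e * norm (y - z)"
  proof (intro exI[of _ d] conjI ballI impI d(1))
    fix y assume y: "y \<in> paths_in K" "norm (y - z) < d"
    show "norm (nemytskii f y - nemytskii f z - nemytskii_deriv f z (y - z)) \<le> e * norm (y - z)"
    proof (rule norm_bound)
      fix s
      have n: "norm (y s - z s) \<le> norm (y - z)"
        using norm_bounded[of "y - z" s] by simp
      have "norm (f (y s) - f (z s) - dir_deriv (y s - z s) f (z s)) \<le> e * norm (y s - z s)"
        using assms(5) y n by (intro d(2)) (auto simp: paths_in_def)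
      also have "\<dots> \<le> e * norm (y - z)" using n \<open>e > 0\<close> by simp
      finally show "norm (apply_bcontfun (nemytskii f y - nemytskii f z - nemytskii_deriv f z (y - z)) s)
          \<le> e * norm (y - z)"
        using apply_nemytskii[OF assms(1) C1_continuous(1)[OF assms(4,3)]] y(1) assms(5)
        by (simp add: apply_nemytskii_deriv[OF assms(1,3,4,5)])
    qed
  qed
qed

text \<open>Induction over the class with \<open>f\<close> varying, since the derivative involves
  the operators of the partial derivatives of \<open>f\<close>. The additional class of
  \<open>f\<close> pays for the base case, where continuity is read off from
  differentiability.\<close>

lemma Ck_on_nemytskii:
  fixes Z :: "'l::euclidean_space \<Rightarrow> (real \<Rightarrow>\<^sub>C 'x::euclidean_space)"
  assumes "open S" "compact K" "convex K" "K \<subseteq> U" "Ck_on (Suc k) U f" "Ck_on k S Z"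
    "\<And>l. l \<in> S \<Longrightarrow> Z l \<in> paths_in K"
  shows "Ck_on k S (\<lambda>l. nemytskii f (Z l))"
  using assms(5,6)
proof (induction k arbitrary: f)
  case 0
  have "continuous_on (paths_in K) (nemytskii f)"
    using has_derivative_continuous[OF nemytskii_has_derivative[OF assms(2-4)]] 0
    by (auto simp: continuous_on_eq_continuous_within)
  then show ?case
    using 0 assms(7) by (auto intro: continuous_on_compose2)
next
  case (Suc k)
  have f1: "Ck_on 1 U f" using Suc.prems(1) by (rule Ck_on_mono) simp
  show ?case
  proof (rule Ck_on_SucI[OF assms(1)])
    fix l assume l: "l \<in> S"
    have "((\<lambda>l. nemytskii f (Z l)) has_derivative (\<lambda>v. nemytskii_deriv f (Z l) (dir_deriv v Z l)))
        (at l within S)"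
    proof -
      have "(nemytskii f has_derivative nemytskii_deriv f (Z l)) (at (Z l) within Z ` S)"
        using assms(7) l by (intro has_derivative_subset[OF nemytskii_has_derivative[OF assms(2-4) f1]]) auto
      then show ?thesis
        by (rule has_derivative_in_compose[OF
              has_derivative_at_withinI[OF Ck_on_Suc_derivative[OF Suc.prems(2) l]]])
    qed
    then show "((\<lambda>l. nemytskii f (Z l)) has_derivative
        (\<lambda>v. nemytskii_deriv f (Z l) (dir_deriv v Z l))) (at l)"
      using at_within_open[OF l assms(1)] by simp
  next
    fix v
    have "Ck_on k S (\<lambda>l. nemytskii (dir_deriv i f) (Z l))" for i
    proof (rule Suc.IH)
      show "Ck_on (Suc k) U (dir_deriv i f)" using Suc.prems(1) by simp
      show "Ck_on k S Z" by (rule Ck_on_Suc_imp[OF Suc.prems(2)])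
    qed
    then show "Ck_on k S (\<lambda>l. nemytskii_deriv f (Z l) (dir_deriv v Z l))"
      unfolding nemytskii_deriv_def using Suc.prems(2)
      by (intro Ck_on_sum Ck_on_bilinear[OF bounded_bilinear_coord_mult] assms(1)) auto
  qed
qed

section \<open>Smooth dependence of Picard fixed points on their parameters\<close>

instance bcontfun :: (metric_space, banach) banach ..

lemma bounded_linear_const_bcontfun:
  "bounded_linear (const_bcontfun :: 'b::real_normed_vector \<Rightarrow> ('s::topological_space \<Rightarrow>\<^sub>C 'b))"
proof (rule bounded_linear_intro[where K = 1])
  show "norm (const_bcontfun x :: 's \<Rightarrow>\<^sub>C 'b) \<le> norm x * 1" for x
    by (rule norm_bound) (simp add: const_bcontfun.rep_eq)
qed (auto intro!: bcontfun_eqI simp: const_bcontfun.rep_eq)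

text \<open>Currying: a coefficient path becomes an element of the space of bounded operators, so
  that operator-valued maps inherit their class from the coefficients.\<close>

lemma bounded_linear_Blinfun_bilinear:
  assumes "bounded_bilinear h"
  shows "bounded_linear (\<lambda>a. Blinfun (h a))"
proof -
  have ap: "blinfun_apply (Blinfun (h a)) = h a" for a
    by (rule bounded_linear_Blinfun_apply[OF bounded_bilinear.bounded_linear_right[OF assms]])
  obtain K where K: "K > 0" "\<And>a b. norm (h a b) \<le> norm a * norm b * K"
    using bounded_bilinear.pos_bounded[OF assms] by blast
  show ?thesis
  proof (rule bounded_linear_intro[where K = K])
    show "norm (Blinfun (h a)) \<le> norm a * K" for a
      using K by (intro norm_blinfun_bound) (auto simp: ap mult_ac)
  qed (auto intro!: blinfun_eqI simp: ap blinfun.bilinear_simps bounded_bilinear.add_left[OF assms]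
      bounded_bilinear.scaleR_left[OF assms])
qed

text \<open>The flow of \<open>f\<close> is studied through \<open>z' = t \<cdot> f z\<close>, \<open>z 0 = y\<close> on the unit interval,
  so that time \<open>t\<close> becomes a parameter on the same footing as the initial value \<open>y\<close>.\<close>

definition picard ::
    "('x::euclidean_space \<Rightarrow> 'x) \<Rightarrow> real \<times> 'x \<Rightarrow> (real \<Rightarrow>\<^sub>C 'x) \<Rightarrow> (real \<Rightarrow>\<^sub>C 'x)" where
  "picard f l z = const_bcontfun (snd l) + fst l *\<^sub>R path_integral (nemytskii f z)"

lemma picard_has_derivative:
  assumes "compact K" "convex K" "K \<subseteq> U" "Ck_on 1 U f" "z \<in> paths_in K"
  shows "((\<lambda>q. picard f (fst q) (snd q)) has_derivative
    (\<lambda>q. (const_bcontfun (snd (fst q)) + fst (fst q) *\<^sub>R path_integral (nemytskii f z))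
      + fst l *\<^sub>R path_integral (nemytskii_deriv f z (snd q)))) (at (l, z) within S \<times> paths_in K)"
proof -
  have sub: "snd ` (S \<times> paths_in K) \<subseteq> paths_in K" by auto
  have N: "((\<lambda>q. nemytskii f (snd q)) has_derivative (\<lambda>q. nemytskii_deriv f z (snd q)))
      (at (l, z) within S \<times> paths_in K)"
    by (rule has_derivative_in_compose[OF has_derivative_snd[OF has_derivative_ident]])
      (simp only: snd_conv has_derivative_subset[OF nemytskii_has_derivative[OF assms] sub])
  have c: "((\<lambda>q. const_bcontfun (snd (fst q))) has_derivative (\<lambda>q. const_bcontfun (snd (fst q))))
      (at (l, z) within S \<times> paths_in K)"
    by (intro bounded_linear.has_derivative[OF bounded_linear_const_bcontfun]
        has_derivative_snd has_derivative_fst has_derivative_ident)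
  have t: "((\<lambda>q. fst (fst q)) has_derivative (\<lambda>q. fst (fst q))) (at (l, z) within S \<times> paths_in K)"
    by (intro has_derivative_fst has_derivative_ident)
  have "((\<lambda>q. const_bcontfun (snd (fst q)) + fst (fst q) *\<^sub>R path_integral (nemytskii f (snd q)))
      has_derivative (\<lambda>q. const_bcontfun (snd (fst q)) + (fst (fst (l, z)) *\<^sub>R
        path_integral (nemytskii_deriv f z (snd q)) + fst (fst q) *\<^sub>R path_integral (nemytskii f (snd (l, z))))))
      (at (l, z) within S \<times> paths_in K)"
    by (rule has_derivative_add[OF c has_derivative_scaleR[OF t
            bounded_linear.has_derivative[OF bounded_linear_path_integral N]]])
  then show ?thesis
    unfolding picard_def by (rule has_derivative_eq_rhs) (simp add: fun_eq_iff add_ac)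
qed

text \<open>If \<open>Z\<close> has class k, so have the operator and the right-hand side of the
  linearised equation, hence also its solution, which is the derivative of \<open>Z\<close>; thus
  \<open>Z\<close> gains a class. The linearised equation is itself exported, because the time
  derivative is later identified by uniqueness of its solution.\<close>

lemma smooth_picard_fixed_point:
  fixes f :: "'x::euclidean_space \<Rightarrow> 'x"
  assumes "open S" and K: "compact K" "convex K" "K \<subseteq> U" and f: "smooth_on U f"
    and fp: "\<And>l. l \<in> S \<Longrightarrow> Z l \<in> paths_in K \<and> Z l = picard f l (Z l)"
    and half: "\<And>l z \<zeta>. l \<in> S \<Longrightarrow> z \<in> paths_in K \<Longrightarrow>
      norm (fst l *\<^sub>R path_integral (nemytskii_deriv f z \<zeta>)) \<le> norm \<zeta> / 2"
    and cont: "continuous_on S Z"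
  shows "smooth_on S Z"
    and "\<And>l v. l \<in> S \<Longrightarrow> dir_deriv v Z l =
      (const_bcontfun (snd v) + fst v *\<^sub>R path_integral (nemytskii f (Z l)))
      + fst l *\<^sub>R path_integral (nemytskii_deriv f (Z l) (dir_deriv v Z l))"
proof -
  have f1: "Ck_on k U f" for k using f by (simp add: smooth_on_def)
  define b where "b v l = const_bcontfun (snd v) + fst v *\<^sub>R path_integral (nemytskii f (Z l))" for v l
  define A where "A l \<zeta> = fst l *\<^sub>R path_integral (nemytskii_deriv f (Z l) \<zeta>)" for l :: "real \<times> 'x" and \<zeta>
  have linA: "bounded_linear (A l)" for l
    unfolding A_def[abs_def]
    by (intro bounded_linear_const_scaleR bounded_linear_compose[OF bounded_linear_path_integral]
        bounded_linear_nemytskii_deriv)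
  have halfA: "norm (A l \<zeta>) \<le> norm \<zeta> / 2" if "l \<in> S" for l \<zeta>
    unfolding A_def using half fp that by blast
  define z' where "z' v l = (SOME \<zeta>. \<zeta> = b v l + A l \<zeta>)" for v l
  have z': "z' v l = b v l + A l (z' v l)" if "l \<in> S" for v l
    unfolding z'_def by (rule someI_ex[OF half_contraction_fixed_point[OF linA halfA[OF that]]])
  have D: "(Z has_derivative (\<lambda>v. z' v l)) (at l)" if l: "l \<in> S" for l
  proof -
    have "(Z has_derivative (\<lambda>v. z' v l)) (at l within S)"
    proof (rule implicit_has_derivative[where \<Psi> = "picard f" and C = "paths_in K"])
      show "((\<lambda>q. picard f (fst q) (snd q)) has_derivative (\<lambda>q. b (fst q) l + A l (snd q)))
          (at (l, Z l) within S \<times> paths_in K)"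
        unfolding b_def A_def using fp[OF l] by (intro picard_has_derivative[OF K f1]) simp
      show "continuous (at l within S) Z"
        using cont l by (simp add: continuous_on_eq_continuous_within)
    qed (fact fp l linA halfA[OF l] z'[OF l])+
    then show ?thesis
      using at_within_open[OF l assms(1)] by simp
  qed
  show *: "dir_deriv v Z l =
      (const_bcontfun (snd v) + fst v *\<^sub>R path_integral (nemytskii f (Z l)))
      + fst l *\<^sub>R path_integral (nemytskii_deriv f (Z l) (dir_deriv v Z l))" if "l \<in> S" for v l
    using z'[OF that] unfolding dir_deriv_eq[OF D[OF that]] b_def A_def .
  \<comment> \<open>The operator \<open>A l\<close> as an element of a normed space of operators, in
    which its dependence on \<open>l\<close> has a class.\<close>
  define A' where "A' l = fst l *\<^sub>R (Blinfun path_integral o\<^sub>L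
      (\<Sum>i\<in>Basis. Blinfun (coord_mult i (nemytskii (dir_deriv i f) (Z l)))))" for l :: "real \<times> 'x"
  have A': "blinfun_apply (A' l) = A l" for l
    by (rule ext) (simp add: A'_def A_def nemytskii_deriv_def blinfun.bilinear_simps
        bounded_linear_Blinfun_apply[OF bounded_linear_path_integral]
        bounded_linear_Blinfun_apply[OF bounded_bilinear.bounded_linear_right[OF bounded_bilinear_coord_mult]])
  have "Ck_on k S Z" for k
  proof (induction k)
    case 0
    then show ?case using cont by simp
  next
    case (Suc k)
    have N: "Ck_on k S (\<lambda>l. nemytskii h (Z l))" if "\<And>k. Ck_on k U h" for h :: "'x \<Rightarrow> 'x"
      using fp by (intro Ck_on_nemytskii[OF assms(1) K that Suc]) auto
    have Nd: "Ck_on k S (\<lambda>l. nemytskii (dir_deriv i f) (Z l))" for i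
      using f1 by (intro N) (metis Ck_on.simps(2))
    show ?case
    proof (rule Ck_on_SucI[OF assms(1) D])
      fix v
      show "Ck_on k S (z' v)"
      proof (rule Ck_on_linear_fixed_point[OF assms(1), where A = A' and b = "b v"])
        show "Ck_on k S A'"
          unfolding A'_def[abs_def]
          by (intro Ck_on_bilinear[OF bounded_bilinear_scaleR] assms(1) Ck_on_linear[OF bounded_linear_fst]
              Ck_on_bilinear[OF bounded_bilinear_blinfun_compose] Ck_on_const Ck_on_sum
              Ck_on_bounded_linear[OF bounded_linear_Blinfun_bilinear[OF bounded_bilinear_coord_mult]] Nd)
        show "Ck_on k S (b v)"
          unfolding b_def[abs_def]
          by (intro Ck_on_add assms(1) Ck_on_const Ck_on_bounded_linear[OF bounded_linear_scaleR_right]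
              Ck_on_bounded_linear[OF bounded_linear_path_integral] N f1)
      qed (use z' halfA A' in simp_all)
    qed
  qed
  then show "smooth_on S Z" by (simp add: smooth_on_def)
qed

lemma picard_fixed_point_solves:
  assumes K: "compact K" and f: "continuous_on K f" and z: "z \<in> paths_in K" "z = picard f l z"
    and s: "s \<in> {0..1}"
  shows "(apply_bcontfun z has_vector_derivative fst l *\<^sub>R f (z s)) (at s within {0..1})"
proof -
  note N = apply_nemytskii[OF K f z(1)]
  have eq: "apply_bcontfun z \<sigma> = snd l + fst l *\<^sub>R integral {0..\<sigma>} (\<lambda>s. f (z s))" if "\<sigma> \<in> {0..1}" for \<sigma>
    using that arg_cong[OF z(2), of "\<lambda>z. apply_bcontfun z \<sigma>"]
    by (simp add: picard_def apply_path_integral const_bcontfun.rep_eq N)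
  have "continuous_on {0..1} (\<lambda>s. f (z s))"
    using z(1) by (intro continuous_on_compose2[OF f]) (auto simp: paths_in_def)
  then have "((\<lambda>\<sigma>. snd l + fst l *\<^sub>R integral {0..\<sigma>} (\<lambda>s. f (z s))) has_vector_derivative
      fst l *\<^sub>R f (z s)) (at s within {0..1})"
    using integral_has_vector_derivative[of 0 1 "\<lambda>s. f (z s)" s] s
    by (auto intro!: derivative_eq_intros)
  then show ?thesis
    by (rule has_vector_derivative_transform[OF s, rotated]) (simp add: eq)
qed

text \<open>The solution with time parameter t is the flow line at time t s, so its derivative in t
  ought to be s f(z(s)). Differentiating this candidate in s and integrating back shows that it
  solves the linearised equation for the direction \<open>(1, 0)\<close>.\<close>

lemma picard_time_derivative:
  fixes f :: "'x::euclidean_space \<Rightarrow> 'x"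
  assumes K: "compact K" "K \<subseteq> U" and f: "Ck_on 1 U f" and z: "z \<in> paths_in K" "z = picard f l z"
  defines "\<zeta> \<equiv> Bcontfun (\<lambda>s. clamp01 s *\<^sub>R f (z s))"
  shows "apply_bcontfun \<zeta> = (\<lambda>s. clamp01 s *\<^sub>R f (z s))"
    and "\<zeta> = path_integral (nemytskii f z) + fst l *\<^sub>R path_integral (nemytskii_deriv f z \<zeta>)"
proof -
  note fK = C1_continuous(1)[OF f K(2)]
  note N = apply_nemytskii[OF K(1) fK z(1)]
  show ap: "apply_bcontfun \<zeta> = (\<lambda>s. clamp01 s *\<^sub>R f (z s))"
    unfolding \<zeta>_def
  proof (rule apply_Bcontfun)
    show "continuous_on UNIV (\<lambda>s. clamp01 s *\<^sub>R f (z s))"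
      using z(1) by (intro continuous_intros continuous_on_compose2[OF fK]) (auto simp: paths_in_def)
    show "norm (clamp01 s *\<^sub>R f (z s)) \<le> 1 * norm (nemytskii f z)" for s
      using norm_bounded[of "nemytskii f z" s] unfolding norm_scaleR N
      by (intro mult_mono) auto
  qed
  show "\<zeta> = path_integral (nemytskii f z) + fst l *\<^sub>R path_integral (nemytskii_deriv f z \<zeta>)"
  proof (rule bcontfun_eqI)
    fix s
    let ?g = "\<lambda>\<sigma>. apply_bcontfun (nemytskii f z + fst l *\<^sub>R nemytskii_deriv f z \<zeta>) \<sigma>"
    have D: "((\<lambda>\<sigma>. \<sigma> *\<^sub>R f (z \<sigma>)) has_vector_derivative ?g \<sigma>) (at \<sigma> within {0..1})"
      if \<sigma>: "\<sigma> \<in> {0..1}" for \<sigma>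
    proof -
      have zD: "(apply_bcontfun z has_derivative (\<lambda>h. h *\<^sub>R (fst l *\<^sub>R f (z \<sigma>)))) (at \<sigma> within {0..1})"
        using picard_fixed_point_solves[OF K(1) fK z \<sigma>] by (simp add: has_vector_derivative_def)
      have zK: "z \<sigma> \<in> U" using z(1) K(2) by (auto simp: paths_in_def)
      have fD: "(f has_derivative (\<lambda>v. dir_deriv v f (z \<sigma>))) (at (z \<sigma>))"
        using f zK by (auto intro: differentiable_has_derivative_dir_deriv)
      have "((\<lambda>\<sigma>. f (z \<sigma>)) has_derivative (\<lambda>h. dir_deriv (h *\<^sub>R (fst l *\<^sub>R f (z \<sigma>))) f (z \<sigma>)))
          (at \<sigma> within {0..1})"
        by (rule has_derivative_in_compose[OF zD has_derivative_at_withinI[OF fD]])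
      then have "((\<lambda>\<sigma>. f (z \<sigma>)) has_vector_derivative fst l *\<^sub>R dir_deriv (f (z \<sigma>)) f (z \<sigma>))
          (at \<sigma> within {0..1})"
        unfolding has_vector_derivative_def by (simp add: linear_scale[OF has_derivative_linear[OF fD]])
      then have "((\<lambda>\<sigma>. \<sigma> *\<^sub>R f (z \<sigma>)) has_vector_derivative
          (\<sigma> *\<^sub>R (fst l *\<^sub>R dir_deriv (f (z \<sigma>)) f (z \<sigma>)) + 1 *\<^sub>R f (z \<sigma>))) (at \<sigma> within {0..1})"
        by (intro has_vector_derivative_scaleR DERIV_ident)
      moreover have "dir_deriv (\<sigma> *\<^sub>R f (z \<sigma>)) f (z \<sigma>) = \<sigma> *\<^sub>R dir_deriv (f (z \<sigma>)) f (z \<sigma>)"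
        by (rule linear_scale[OF has_derivative_linear[OF fD]])
      ultimately show ?thesis
        using \<sigma> by (simp add: apply_nemytskii_deriv[OF K f z(1)] N ap add.commute mult.commute)
    qed
    let ?s = "clamp01 s"
    have "(?g has_integral ?s *\<^sub>R f (z ?s) - 0 *\<^sub>R f (z 0)) {0..?s}"
    proof (rule fundamental_theorem_of_calculus)
      show "((\<lambda>\<sigma>. \<sigma> *\<^sub>R f (z \<sigma>)) has_vector_derivative ?g \<sigma>) (at \<sigma> within {0..?s})"
        if "\<sigma> \<in> {0..?s}" for \<sigma>
        using that by (intro has_vector_derivative_within_subset[OF D]) auto
    qed simp
    then have "integral {0..?s} ?g = ?s *\<^sub>R f (z ?s)"
      by (simp add: integral_unique)
    moreover have "path_integral (nemytskii f z + fst l *\<^sub>R nemytskii_deriv f z \<zeta>)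
        = path_integral (nemytskii f z) + fst l *\<^sub>R path_integral (nemytskii_deriv f z \<zeta>)"
      by (simp only: linear_add[OF bounded_linear.linear[OF bounded_linear_path_integral]]
          linear_scale[OF bounded_linear.linear[OF bounded_linear_path_integral]])
    \<comment> \<open>A fixed point of \<open>picard\<close> depends on \<open>s\<close> only
      through \<open>clamp01 s\<close>, since its path integral does.\<close>
    moreover have "apply_bcontfun z ?s = apply_bcontfun z s"
      using arg_cong[OF z(2), of "\<lambda>z. apply_bcontfun z s"] arg_cong[OF z(2), of "\<lambda>z. apply_bcontfun z ?s"]
      by (simp add: picard_def apply_path_integral)
    ultimately show "apply_bcontfun \<zeta> s = apply_bcontfun (path_integral (nemytskii f z)
        + fst l *\<^sub>R path_integral (nemytskii_deriv f z \<zeta>)) s"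
      by (metis (no_types, lifting) ap apply_path_integral)
  qed
qed

text \<open>The flow is the value at 1 of the fixed point of the rescaled equation. Time is then a
  parameter like the initial value, and a single application of
  \<open>smooth_picard_fixed_point\<close> gives joint smoothness.\<close>

theorem smooth_flow:
  fixes f :: "'x::euclidean_space \<Rightarrow> 'x"
  assumes "open U" "p \<in> U" "smooth_on U f"
  obtains \<delta> and F :: "real \<times> 'x \<Rightarrow> 'x" where "\<delta> > 0" "smooth_on (ball (0, p) \<delta>) F"
    "\<And>l. l \<in> ball (0, p) \<delta> \<Longrightarrow> F l \<in> U \<and> dir_deriv (1, 0) F l = f (F l)"
    "\<And>y. F (0, y) = y"
proof -
  obtain r where r: "r > 0" "cball p r \<subseteq> U"
    using assms(1,2) open_contains_cball by blast
  define K where "K = cball p r"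
  have K: "compact K" "convex K" "K \<subseteq> U" using r by (auto simp: K_def)
  have f1: "Ck_on 1 U f" using assms(3) unfolding smooth_on_def by blast
  note fK = C1_continuous[OF f1 K(3)]
  have bnd: "\<exists>B. \<forall>x\<in>K. norm (h x) \<le> B" if "continuous_on K h" for h :: "'x \<Rightarrow> 'x"
    using compact_imp_bounded[OF compact_continuous_image[OF that K(1)]]
    by (auto simp: bounded_iff)
  obtain M0 where M0: "\<And>x. x \<in> K \<Longrightarrow> norm (f x) \<le> M0" using bnd[OF fK(1)] by blast
  define M where "M = max M0 0"
  have M: "M \<ge> 0" "\<And>x. x \<in> K \<Longrightarrow> norm (f x) \<le> M" using M0 by (force simp: M_def)+
  obtain L0 where L0: "\<And>i x. x \<in> K \<Longrightarrow> norm (dir_deriv i f x) \<le> L0 i"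
    using bnd[OF fK(2)] by metis
  define L where "L = (\<Sum>i\<in>(Basis::'x set). max (L0 i) 0)"
  have L: "L \<ge> 0" unfolding L_def by (intro sum_nonneg) auto
  have Ld: "norm (dir_deriv v f x) \<le> L * norm v" if "x \<in> K" for x v
  proof -
    have "norm (dir_deriv v f x) = norm (\<Sum>i\<in>Basis. (v \<bullet> i) *\<^sub>R dir_deriv i f x)"
      using f1 K(3) that by (subst dir_deriv_Basis) auto
    also have "\<dots> \<le> (\<Sum>i\<in>Basis. norm v * max (L0 i) 0)"
    proof (rule sum_norm_le)
      fix i :: 'x assume i: "i \<in> Basis"
      show "norm ((v \<bullet> i) *\<^sub>R dir_deriv i f x) \<le> norm v * max (L0 i) 0"
        using Basis_le_norm[OF i, of v] L0[OF that, of i] unfolding norm_scaleR real_norm_def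
        by (intro mult_mono) auto
    qed
    finally show ?thesis by (simp add: L_def sum_distrib_left[symmetric] mult.commute)
  qed
  have Lip: "norm (f x - f y) \<le> L * norm (x - y)" if "x \<in> K" "y \<in> K" for x y
  proof (rule differentiable_bound[OF K(2)])
    show "(f has_derivative (\<lambda>v. dir_deriv v f x)) (at x within K)" if "x \<in> K" for x
      using f1 K(3) that by (auto intro!: has_derivative_at_withinI[OF differentiable_has_derivative_dir_deriv])
    show "onorm (\<lambda>v. dir_deriv v f x) \<le> L" if "x \<in> K" for x
      using Ld[OF that] L by (intro onorm_bound)
  qed (fact that)+
  \<comment> \<open>An initial value within \<open>r / 2\<close> of \<open>p\<close> and a
    displacement of at most \<open>\<delta> * M \<le> r / 2\<close> keep Picard iterates in
    \<open>K\<close>; \<open>\<delta> * L \<le> 1 / 2\<close> makes them contract. The summands 1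
    keep the denominators positive.\<close>
  define \<delta> where "\<delta> = min (r / 2) (min (r / (2 * (M + 1))) (1 / (2 * (L + 1))))"
  have \<delta>: "\<delta> > 0" "\<delta> \<le> r / 2" "\<delta> * M \<le> r / 2" "\<delta> * L \<le> 1 / 2"
  proof -
    show "\<delta> > 0" using r(1) M(1) L by (simp add: \<delta>_def)
    show "\<delta> \<le> r / 2" unfolding \<delta>_def by (rule min.cobounded1)
    have "\<delta> * (M + 1) \<le> r / 2" "\<delta> * (L + 1) \<le> 1 / 2"
    proof -
      have "\<delta> \<le> r / (2 * (M + 1))" "\<delta> \<le> 1 / (2 * (L + 1))" by (simp_all add: \<delta>_def)
      then show "\<delta> * (M + 1) \<le> r / 2" "\<delta> * (L + 1) \<le> 1 / 2"
        using M(1) L by (simp_all add: field_simps)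
    qed
    then show "\<delta> * M \<le> r / 2" "\<delta> * L \<le> 1 / 2"
      using \<open>\<delta> > 0\<close> by (simp_all add: algebra_simps)
  qed
  define S where "S = ball (0::real, p) \<delta>"
  have S: "\<bar>fst l\<bar> < \<delta>" "norm (snd l - p) < \<delta>" if "l \<in> S" for l
  proof -
    have "norm (l - (0, p)) < \<delta>" using that by (simp add: S_def dist_norm norm_minus_commute)
    then show "\<bar>fst l\<bar> < \<delta>" "norm (snd l - p) < \<delta>"
      using norm_fst_le[of "fst l" "snd l - p"] norm_snd_le[of "snd l - p" "fst l"]
      by (cases l; simp)+
  qed
  have S0: "\<bar>fst l\<bar> * M \<le> r / 2" "\<bar>fst l\<bar> * L \<le> 1 / 2" if "l \<in> S" for l
    using S(1)[OF that] \<delta>(3,4) M(1) L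
    by (meson less_imp_le mult_right_mono order_trans)+
  have nemM: "norm (nemytskii f z) \<le> M" if "z \<in> paths_in K" for z
    using that M by (intro norm_bound) (simp add: apply_nemytskii[OF K(1) fK(1) that] paths_in_def)
  have nemL: "norm (nemytskii f z - nemytskii f w) \<le> L * norm (z - w)"
    if "z \<in> paths_in K" "w \<in> paths_in K" for z w
  proof (rule norm_bound)
    fix s
    have "norm (f (z s) - f (w s)) \<le> L * norm (z s - w s)"
      using that by (intro Lip) (auto simp: paths_in_def)
    also have "\<dots> \<le> L * norm (z - w)"
      using norm_bounded[of "z - w" s] L by (intro mult_left_mono) auto
    finally show "norm (apply_bcontfun (nemytskii f z - nemytskii f w) s) \<le> L * norm (z - w)"
      by (simp add: apply_nemytskii[OF K(1) fK(1) that(1)] apply_nemytskii[OF K(1) fK(1) that(2)])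
  qed
  have half: "norm (fst l *\<^sub>R path_integral (nemytskii_deriv f z \<zeta>)) \<le> norm \<zeta> / 2"
    if "l \<in> S" "z \<in> paths_in K" for l z \<zeta>
  proof -
    have "norm (nemytskii_deriv f z \<zeta>) \<le> L * norm \<zeta>"
    proof (rule norm_bound)
      fix s
      have "norm (dir_deriv (\<zeta> s) f (z s)) \<le> L * norm (\<zeta> s)"
        using that(2) by (intro Ld) (auto simp: paths_in_def)
      also have "\<dots> \<le> L * norm \<zeta>" using L norm_bounded[of \<zeta> s] by (intro mult_left_mono)
      finally show "norm (apply_bcontfun (nemytskii_deriv f z \<zeta>) s) \<le> L * norm \<zeta>"
        by (simp add: apply_nemytskii_deriv[OF K(1,3) f1 that(2)])
    qed
    then have "norm (fst l *\<^sub>R path_integral (nemytskii_deriv f z \<zeta>)) \<le> \<bar>fst l\<bar> * (L * norm \<zeta>)"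
      using norm_path_integral_le[of "nemytskii_deriv f z \<zeta>"] by (simp add: mult_left_mono)
    also have "\<dots> \<le> (1 / 2) * norm \<zeta>"
      using S0(2)[OF that(1)] by (metis mult.assoc mult_right_mono norm_ge_zero)
    finally show ?thesis by simp
  qed
  have contr: "norm (fst l *\<^sub>R (path_integral (nemytskii f z) - path_integral (nemytskii f w)))
      \<le> (1 / 2) * norm (z - w)"
    if "l \<in> S" "z \<in> paths_in K" "w \<in> paths_in K" for l z w
  proof -
    have "path_integral (nemytskii f z) - path_integral (nemytskii f w)
        = path_integral (nemytskii f z - nemytskii f w)"
      by (rule linear_diff[symmetric, OF bounded_linear.linear[OF bounded_linear_path_integral]])
    then have "norm (fst l *\<^sub>R (path_integral (nemytskii f z) - path_integral (nemytskii f w)))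
        \<le> \<bar>fst l\<bar> * (L * norm (z - w))"
      using nemL[OF that(2,3)] norm_path_integral_le[of "nemytskii f z - nemytskii f w"]
      by (simp add: mult_left_mono)
    also have "\<dots> \<le> (1 / 2) * norm (z - w)"
      using S0(2)[OF that(1)] by (metis mult.assoc mult_right_mono norm_ge_zero)
    finally show ?thesis .
  qed
  have ex: "\<exists>!z\<in>paths_in K. picard f l z = z" if l: "l \<in> S" for l
  proof (rule Banach_fix[where c = "1/2"])
    have "paths_in K = PiC UNIV (\<lambda>_. K)"
      by (auto simp: paths_in_def mem_PiC_iff Pi_iff)
    then have "closed (paths_in K)"
      using closed_PiC[of UNIV "\<lambda>_. K"] compact_imp_closed[OF K(1)] by simp
    then show "complete (paths_in K)" by (simp add: complete_eq_closed)
    have "const_bcontfun p \<in> paths_in K" using r(1) by (simp add: paths_in_def const_bcontfun.rep_eq K_def)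
    then show "paths_in K \<noteq> {}" by blast
    show "picard f l ` paths_in K \<subseteq> paths_in K"
    proof (clarify, unfold paths_in_def, clarify)
      fix z and s :: real assume "\<forall>s::real. apply_bcontfun z s \<in> K"
      then have z: "z \<in> paths_in K" by (simp add: paths_in_def)
      let ?I = "apply_bcontfun (path_integral (nemytskii f z)) s"
      have "norm ?I \<le> M"
        using norm_bounded[of "path_integral (nemytskii f z)" s] norm_path_integral_le[of "nemytskii f z"] nemM[OF z]
        by linarith
      then have "\<bar>fst l\<bar> * norm ?I \<le> r / 2"
        using S0(1)[OF l] by (meson abs_ge_zero mult_left_mono order_trans)
      moreover have "norm (snd l + fst l *\<^sub>R ?I - p) \<le> norm (snd l - p) + norm (fst l *\<^sub>R ?I)"
        using norm_triangle_ineq[of "snd l - p" "fst l *\<^sub>R ?I"] by (simp add: algebra_simps)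
      ultimately have "norm (snd l + fst l *\<^sub>R ?I - p) \<le> r"
        using S(2)[OF l] \<delta>(2) by simp
      then show "apply_bcontfun (picard f l z) s \<in> K"
        by (simp add: picard_def const_bcontfun.rep_eq K_def dist_norm norm_minus_commute)
    qed
    show "dist (picard f l z) (picard f l w) \<le> (1/2) * dist z w" if "z \<in> paths_in K" "w \<in> paths_in K" for z w
      using contr[OF l that] by (simp add: picard_def dist_norm scaleR_diff_right)
  qed auto
  define Z where "Z l = (THE z. z \<in> paths_in K \<and> picard f l z = z)" for l
  have Z: "Z l \<in> paths_in K \<and> picard f l (Z l) = Z l" if "l \<in> S" for l
    unfolding Z_def using ex[OF that] by (rule theI')
  have Z': "Z l \<in> paths_in K \<and> Z l = picard f l (Z l)" if "l \<in> S" for l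
    using Z[OF that] by auto
  \<comment> \<open>The direct effect of the parameters is at most 1 + M times their distance. The
    effect through the path is at most half of the left-hand side, and absorbing it doubles the
    constant.\<close>
  have "norm (Z l - Z m) \<le> 2 * (1 + M) * norm (l - m)" if "l \<in> S" "m \<in> S" for l m
  proof -
    let ?P = "\<lambda>l. path_integral (nemytskii f (Z l))"
    have "Z l - Z m = picard f l (Z l) - picard f m (Z m)"
      using Z that by metis
    also have "\<dots> = const_bcontfun (snd l - snd m) + ((fst l - fst m) *\<^sub>R ?P l + fst m *\<^sub>R (?P l - ?P m))"
      unfolding picard_def linear_diff[OF bounded_linear.linear[OF bounded_linear_const_bcontfun]]
      by (simp add: algebra_simps)
    finally have "norm (Z l - Z m) \<le> norm (const_bcontfun (snd l - snd m) :: real \<Rightarrow>\<^sub>C 'x)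
        + (norm ((fst l - fst m) *\<^sub>R ?P l) + norm (fst m *\<^sub>R (?P l - ?P m)))"
      by (metis norm_triangle_ineq norm_triangle_mono order_refl)
    moreover have "norm (const_bcontfun (snd l - snd m) :: real \<Rightarrow>\<^sub>C 'x) \<le> norm (l - m)"
      using norm_snd_le[of "snd l - snd m" "fst l - fst m"]
      by (intro norm_bound) (simp add: const_bcontfun.rep_eq minus_prod_def)
    moreover have "norm ((fst l - fst m) *\<^sub>R ?P l) \<le> norm (l - m) * M"
    proof -
      have "norm (?P l) \<le> M"
        using norm_path_integral_le[of "nemytskii f (Z l)"] nemM[of "Z l"] Z[OF that(1)] by linarith
      moreover have "\<bar>fst l - fst m\<bar> \<le> norm (l - m)"
        using norm_fst_le[of "fst l - fst m" "snd l - snd m"] by (simp add: minus_prod_def)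
      ultimately show ?thesis by (simp add: mult_mono)
    qed
    moreover have "norm (fst m *\<^sub>R (?P l - ?P m)) \<le> (1 / 2) * norm (Z l - Z m)"
      using Z that by (intro contr) auto
    ultimately have "norm (Z l - Z m) \<le> norm (l - m) + (norm (l - m) * M + (1/2) * norm (Z l - Z m))"
      by linarith
    then show ?thesis by (simp add: algebra_simps)
  qed
  then have "(2 * (1 + M))-lipschitz_on S Z"
    using M(1) by (intro lipschitz_onI) (auto simp: dist_norm)
  then have cont: "continuous_on S Z" by (rule lipschitz_on_continuous_on)
  have oS: "open S" by (simp add: S_def)
  have sm1: "smooth_on S Z"
    using smooth_picard_fixed_point(1)[OF oS K assms(3) Z' half cont] by blast
  have sm2: "dir_deriv v Z l =
      (const_bcontfun (snd v) + fst v *\<^sub>R path_integral (nemytskii f (Z l)))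
      + fst l *\<^sub>R path_integral (nemytskii_deriv f (Z l) (dir_deriv v Z l))" if "l \<in> S" for l v
    using smooth_picard_fixed_point(2)[OF oS K assms(3) Z' half cont] that by blast
  \<comment> \<open>The case distinction makes \<open>F (0, y) = y\<close> hold for all
    \<open>y\<close>, also outside the ball. On \<open>S\<close> both branches agree, because the
    fixed point at time 0 is a constant path.\<close>
  define F where "F l = (if fst l = 0 then snd l else apply_bcontfun (Z l) 1)" for l :: "real \<times> 'x"
  have F: "F l = apply_bcontfun (Z l) 1" if "l \<in> S" for l
  proof (cases "fst l = 0")
    case True
    then have "Z l = const_bcontfun (snd l)"
      using Z'[OF that] by (simp add: picard_def)
    then show ?thesis using True by (simp add: F_def const_bcontfun.rep_eq)
  qed (simp add: F_def)
  have "Ck_on k S (\<lambda>l. apply_bcontfun (Z l) 1)" for k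
    using sm1 by (intro Ck_on_bounded_linear[OF bounded_linear_apply_bcontfun oS]) (simp add: smooth_on_def)
  then have "smooth_on S F"
    unfolding smooth_on_def using Ck_on_cong[OF oS, of F "\<lambda>l. apply_bcontfun (Z l) 1"] F by blast
  moreover have "F l \<in> U \<and> dir_deriv (1, 0) F l = f (F l)" if l: "l \<in> S" for l
  proof
    show "F l \<in> U" using Z[OF l] K(3) by (auto simp: F[OF l] paths_in_def)
    define \<zeta> where "\<zeta> = Bcontfun (\<lambda>s. clamp01 s *\<^sub>R f (apply_bcontfun (Z l) s))"
    note td = picard_time_derivative[OF K(1,3) f1 conjunct1[OF Z'[OF l]] conjunct2[OF Z'[OF l]], folded \<zeta>_def]
    \<comment> \<open>Both sides solve the same linearised equation, which has only one
      solution.\<close>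
    have "dir_deriv (1, 0) Z l = \<zeta>"
    proof (rule half_contraction_unique[OF _ half[OF l conjunct1[OF Z[OF l]]]])
      show "bounded_linear (\<lambda>\<zeta>. fst l *\<^sub>R path_integral (nemytskii_deriv f (Z l) \<zeta>))"
        by (intro bounded_linear_const_scaleR bounded_linear_compose[OF bounded_linear_path_integral]
            bounded_linear_nemytskii_deriv)
      show "dir_deriv (1, 0) Z l = path_integral (nemytskii f (Z l)) +
          fst l *\<^sub>R path_integral (nemytskii_deriv f (Z l) (dir_deriv (1, 0) Z l))"
        using sm2[OF l, of "(1, 0)"] by simp
    qed (rule td(2))
    moreover have "((\<lambda>l. apply_bcontfun (Z l) 1) has_derivative (\<lambda>v. apply_bcontfun (dir_deriv v Z l) 1)) (at l)"
      by (rule bounded_linear.has_derivative[OF bounded_linear_apply_bcontfun smooth_on_derivative[OF sm1 l]])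
    then have "dir_deriv (1, 0) (\<lambda>l. apply_bcontfun (Z l) 1) l = apply_bcontfun (dir_deriv (1, 0) Z l) 1"
      by (rule dir_deriv_eq)
    moreover have "dir_deriv (1, 0) F l = dir_deriv (1, 0) (\<lambda>l. apply_bcontfun (Z l) 1) l"
      by (rule dir_deriv_cong[OF oS l F])
    ultimately show "dir_deriv (1, 0) F l = f (F l)"
      by (simp add: td(1) F[OF l])
  qed
  moreover have "F (0, y) = y" for y by (simp add: F_def)
  ultimately show ?thesis
    using that[OF \<delta>(1), of F] unfolding S_def by blast
qed

section \<open>Curvature in local coordinates\<close>

lemma matrix_diff_ldistrib: "A ** (B - C) = A ** B - A ** (C :: real^'n^'m)"
  by (simp add: matrix_matrix_mult_def vec_eq_iff right_diff_distrib sum_subtractf)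

lemma matrix_diff_rdistrib: "(B - C) ** A = B ** A - (C :: real^'n^'m) ** A"
  by (simp add: matrix_matrix_mult_def vec_eq_iff left_diff_distrib sum_subtractf)

lemma matrix_add_distribs:
  fixes A :: "real^'n^'m"
  shows "A ** (B + C) = A ** B + A ** C" "(D + E) ** A = D ** A + E ** A"
  by (simp_all add: matrix_matrix_mult_def vec_eq_iff algebra_simps sum.distrib)

text \<open>The differential Bianchi identity is the Jacobi identity for \<open>\<partial>\<^sub>i + \<Gamma>\<^sub>i\<close>.\<close>

lemma matrix_bianchi:
  fixes M :: "'i \<Rightarrow> real^'n^'n" and dM :: "'i \<Rightarrow> 'i \<Rightarrow> real^'n^'n"
    and ddM :: "'i \<Rightarrow> 'i \<Rightarrow> 'i \<Rightarrow> real^'n^'n"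
  assumes comm: "\<And>i l m. ddM i l m = ddM l i m"
  defines "R \<equiv> \<lambda>l m. dM l m - dM m l + M l ** M m - M m ** M l"
    and "D \<equiv> \<lambda>i l m. ddM i l m - ddM i m l + dM i l ** M m + M l ** dM i m - dM i m ** M l - M m ** dM i l"
  shows "(D i l m + M i ** R l m - R l m ** M i) + (D l m i + M l ** R m i - R m i ** M l)
    + (D m i l + M m ** R i l - R i l ** M m) = 0"
  unfolding R_def D_def
  using comm[of i l m] comm[of i m l] comm[of l m i]
  by (simp add: matrix_diff_ldistrib matrix_diff_rdistrib matrix_add_distribs matrix_mul_assoc)

section \<open>Levi-Civita connection of a metric on an open set\<close>

locale metric_chart =
  fixes G :: "real^'n::finite \<Rightarrow> real^'n^'n" and U :: "(real^'n) set"
  assumes oU: "open U" and smG: "smooth_on U G"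
    and sym: "x \<in> U \<Longrightarrow> transpose (G x) = G x"
    and inv: "x \<in> U \<Longrightarrow> invertible (G x)"
begin

abbreviation "\<Gamma> \<equiv> christoffel G"

lemma symG: "x \<in> U \<Longrightarrow> G x $ i $ j = G x $ j $ i"
proof -
  assume "x \<in> U"
  have "G x $ i $ j = transpose (G x) $ j $ i" by (simp add: transpose_def)
  then show ?thesis using sym[OF \<open>x \<in> U\<close>] by simp
qed

lemma Ck_G: "Ck_on k U (\<lambda>y. G y $ i $ j)"
  using smG by (intro Ck_on_component2 oU) (simp add: smooth_on_def)

lemma Ck_dG: "Ck_on k U (partial i (\<lambda>y. G y $ j $ k'))"
  using Ck_G[of "Suc k"] by simp

lemma partial_G_sym: "x \<in> U \<Longrightarrow> partial i (\<lambda>y. G y $ j $ k) x = partial i (\<lambda>y. G y $ k $ j) x"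
  by (rule dir_deriv_cong[OF oU]) (simp_all add: symG)

lemma christoffel_sym: "x \<in> U \<Longrightarrow> \<Gamma> p j k x = \<Gamma> p k j x"
  by (simp add: christoffel_def partial_G_sym[of x _ j k] add_ac)

lemma Ck_christoffel: "Ck_on k U (\<Gamma> p i j)"
  unfolding christoffel_def[abs_def] using smG inv
  by (intro Ck_on_divide Ck_on_sum Ck_on_mult Ck_on_add Ck_on_diff Ck_dG Ck_on_const oU
      Ck_on_component2 Ck_on_matrix_inv) (auto simp: smooth_on_def)

lemma Ck_riemann_up: "Ck_on k U (riemann_up G p j l m)"
proof -
  have "Ck_on k U (partial i (\<Gamma> p l m))" for i p l m
    using Ck_christoffel[of "Suc k"] by simp
  then show ?thesis
    unfolding riemann_up_def[abs_def]
    by (intro Ck_on_sum Ck_on_mult Ck_on_add Ck_on_diff Ck_christoffel oU)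
qed

lemma Ck_1D:
  fixes f :: "real^'n \<Rightarrow> real"
  assumes "Ck_on (Suc 0) U f" "x \<in> U"
  shows "(f has_derivative (\<lambda>v. dir_deriv v f x)) (at x)"
  using Ck_on_Suc_derivative[OF assms] .

lemma lower_christoffel:
  assumes "x \<in> U"
  shows "(\<Sum>p\<in>UNIV. G x $ s $ p * \<Gamma> p j k x) =
    (partial j (\<lambda>y. G y $ k $ s) x + partial k (\<lambda>y. G y $ j $ s) x - partial s (\<lambda>y. G y $ j $ k) x) / 2"
proof -
  define c where "c q = (partial j (\<lambda>y. G y $ k $ q) x + partial k (\<lambda>y. G y $ j $ q) x
    - partial q (\<lambda>y. G y $ j $ k) x) / 2" for q
  have \<Gamma>: "\<Gamma> p j k x = (\<Sum>q\<in>UNIV. matrix_inv (G x) $ p $ q * c q)" for p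
    by (simp add: christoffel_def c_def sum_divide_distrib)
  have "(\<Sum>p\<in>UNIV. G x $ s $ p * \<Gamma> p j k x)
      = (\<Sum>q\<in>UNIV. \<Sum>p\<in>UNIV. (G x $ s $ p * matrix_inv (G x) $ p $ q) * c q)"
    unfolding \<Gamma> by (subst sum.swap) (simp add: sum_distrib_left mult_ac)
  also have "\<dots> = (\<Sum>q\<in>UNIV. (G x ** matrix_inv (G x)) $ s $ q * c q)"
    by (simp add: matrix_matrix_mult_def sum_distrib_right)
  also have "\<dots> = c s"
    by (simp add: matrix_inv_works[OF inv[OF assms]] mat_def if_distrib[of "\<lambda>a. a * _"] cong: if_cong)
  finally show ?thesis by (simp add: c_def)
qed

text \<open>This is \<nabla>g = 0: of the six derivatives produced by lowering the two Christoffel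
  symbols, four cancel.\<close>

lemma metric_compatible:
  assumes "x \<in> U"
  shows "partial i (\<lambda>y. G y $ j $ k) x = (\<Sum>q\<in>UNIV. G x $ k $ q * \<Gamma> q i j x) + (\<Sum>q\<in>UNIV. G x $ j $ q * \<Gamma> q i k x)"
  unfolding lower_christoffel[OF assms]
  using partial_G_sym[OF assms, of j i k] partial_G_sym[OF assms, of k i j] partial_G_sym[OF assms, of i j k]
  by (simp add: field_simps)

lemma partial_riemann_up:
  assumes x: "x \<in> U"
  shows "partial i (riemann_up G p k l m) x =
    partial i (partial l (\<Gamma> p m k)) x - partial i (partial m (\<Gamma> p l k)) x
    + (\<Sum>q\<in>UNIV. (\<Gamma> p l q x * partial i (\<Gamma> q m k) x + partial i (\<Gamma> p l q) x * \<Gamma> q m k x)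
      - (\<Gamma> p m q x * partial i (\<Gamma> q l k) x + partial i (\<Gamma> p m q) x * \<Gamma> q l k x))"
proof -
  have d1: "(\<Gamma> p m k has_derivative (\<lambda>v. dir_deriv v (\<Gamma> p m k) x)) (at x)" for p m k
    by (rule Ck_1D[OF Ck_christoffel x])
  have d2: "(partial l (\<Gamma> p m k) has_derivative (\<lambda>v. dir_deriv v (partial l (\<Gamma> p m k)) x)) (at x)" for l p m k
    using Ck_christoffel[of "Suc (Suc 0)"] by (intro Ck_1D[OF _ x]) simp
  show ?thesis
    unfolding riemann_up_def[abs_def]
    by (rule dir_deriv_eq) (rule has_derivative_add has_derivative_diff has_derivative_sum has_derivative_mult d1 d2)+
qed

lemma partial_riemann:
  assumes x: "x \<in> U"
  shows "partial i (riemann G j k l m) x =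
    (\<Sum>p\<in>UNIV. G x $ j $ p * partial i (riemann_up G p k l m) x
      + partial i (\<lambda>y. G y $ j $ p) x * riemann_up G p k l m x)"
  unfolding riemann_def[abs_def]
  by (rule dir_deriv_eq)
    (rule has_derivative_sum has_derivative_mult Ck_1D[OF Ck_riemann_up x] Ck_1D[OF Ck_G x])+

lemma riemann_antisym: "riemann G j k m l x = - riemann G j k l m x"
  by (simp add: riemann_def riemann_up_def sum_subtractf sum_negf[symmetric] algebra_simps)

text \<open>Since the metric is parallel, the lowered index j can be taken out of the covariant
  derivative. What then acts on the indices p and k is the commutator with the connection matrix,
  the form in which \<open>matrix_bianchi\<close> applies; only l and m keep separate Christoffel
  terms.\<close>

lemma cov_deriv4_riemann:
  assumes x: "x \<in> U"
  shows "cov_deriv4 G (riemann G) i j k l m x =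
    (\<Sum>p\<in>UNIV. G x $ j $ p * (partial i (riemann_up G p k l m) x
      + (\<Sum>q\<in>UNIV. \<Gamma> p i q x * riemann_up G q k l m x) - (\<Sum>q\<in>UNIV. riemann_up G p q l m x * \<Gamma> q i k x)))
    - (\<Sum>p\<in>UNIV. \<Gamma> p i l x * riemann G j k p m x + \<Gamma> p i m x * riemann G j k l p x)"
proof -
  define R where "R p k = riemann_up G p k l m x" for p k
  have 1: "(\<Sum>p\<in>UNIV. partial i (\<lambda>y. G y $ j $ p) x * R p k)
      = (\<Sum>p\<in>UNIV. \<Gamma> p i j x * riemann G p k l m x) + (\<Sum>p\<in>UNIV. G x $ j $ p * (\<Sum>q\<in>UNIV. \<Gamma> p i q x * R q k))"
  proof -
    have "(\<Sum>p\<in>UNIV. partial i (\<lambda>y. G y $ j $ p) x * R p k)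
      = (\<Sum>p\<in>UNIV. \<Sum>q\<in>UNIV. G x $ p $ q * \<Gamma> q i j x * R p k) + (\<Sum>p\<in>UNIV. \<Sum>q\<in>UNIV. G x $ j $ q * \<Gamma> q i p x * R p k)"
      by (simp add: metric_compatible[OF x] distrib_right sum.distrib sum_distrib_right)
    also have "(\<Sum>p\<in>UNIV. \<Sum>q\<in>UNIV. G x $ p $ q * \<Gamma> q i j x * R p k) = (\<Sum>p\<in>UNIV. \<Gamma> p i j x * riemann G p k l m x)"
      by (subst sum.swap) (simp add: riemann_def R_def sum_distrib_left symG[OF x] mult_ac)
    also have "(\<Sum>p\<in>UNIV. \<Sum>q\<in>UNIV. G x $ j $ q * \<Gamma> q i p x * R p k)
        = (\<Sum>p\<in>UNIV. G x $ j $ p * (\<Sum>q\<in>UNIV. \<Gamma> p i q x * R q k))"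
      by (subst sum.swap) (simp add: sum_distrib_left mult_ac)
    finally show ?thesis .
  qed
  have 2: "(\<Sum>p\<in>UNIV. \<Gamma> p i k x * riemann G j p l m x) = (\<Sum>p\<in>UNIV. G x $ j $ p * (\<Sum>q\<in>UNIV. R p q * \<Gamma> q i k x))"
    unfolding riemann_def R_def sum_distrib_left by (subst sum.swap) (simp add: mult_ac)
  show ?thesis
    unfolding cov_deriv4_def partial_riemann[OF x] sum.distrib
    using 1 2 by (simp add: R_def sum.distrib sum_subtractf distrib_left right_diff_distrib)
qed

text \<open>With p and k read as matrix indices, the commutator parts add up to zero by
  \<open>matrix_bianchi\<close>. The Christoffel terms of the form indices cancel in the cyclic sum
  by the symmetry of \<Gamma> in its lower indices and the antisymmetry of the curvature.\<close>

lemma bianchi2: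
  assumes x: "x \<in> U"
  shows "cov_deriv4 G (riemann G) i j k l m x + cov_deriv4 G (riemann G) l j k m i x
    + cov_deriv4 G (riemann G) m j k i l x = 0"
proof -
  define M where "M m = (\<chi> p k. \<Gamma> p m k x)" for m
  define dM where "dM l m = (\<chi> p k. partial l (\<Gamma> p m k) x)" for l m
  define ddM where "ddM i l m = (\<chi> p k. partial i (partial l (\<Gamma> p m k)) x)" for i l m
  define R where "R l m = dM l m - dM m l + M l ** M m - M m ** M l" for l m
  define D where "D i l m = ddM i l m - ddM i m l + dM i l ** M m + M l ** dM i m - dM i m ** M l - M m ** dM i l" for i l m
  have comm: "ddM i l m = ddM l i m" for i l m
    unfolding ddM_def
    by (simp only: dir_deriv_commute[OF oU Ck_christoffel x, of "axis i 1" "axis l 1"])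
  have R: "riemann_up G p k l m x = R l m $ p $ k" for p k l m
    by (simp add: R_def dM_def M_def matrix_matrix_mult_def riemann_up_def sum_subtractf)
  have D: "partial i (riemann_up G p k l m) x = D i l m $ p $ k" for i p k l m
    by (simp add: D_def dM_def ddM_def M_def matrix_matrix_mult_def partial_riemann_up[OF x]
        sum_subtractf sum.distrib)
  define B where "B i l m = D i l m + M i ** R l m - R l m ** M i" for i l m
  have cov: "cov_deriv4 G (riemann G) i j k l m x = (\<Sum>p\<in>UNIV. G x $ j $ p * B i l m $ p $ k)
      - (\<Sum>p\<in>UNIV. \<Gamma> p i l x * riemann G j k p m x - \<Gamma> p i m x * riemann G j k p l x)" for i l m
  proof -
    have "riemann G j k l p x = - riemann G j k p l x" for p by (rule riemann_antisym)
    then show ?thesis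
      by (simp add: cov_deriv4_riemann[OF x] R D B_def matrix_matrix_mult_def M_def)
  qed
  have B0: "B i l m + B l m i + B m i l = 0"
    unfolding B_def R_def D_def by (rule matrix_bianchi[OF comm])
  have "(\<Sum>p\<in>UNIV. G x $ j $ p * B i l m $ p $ k) + (\<Sum>p\<in>UNIV. G x $ j $ p * B l m i $ p $ k)
      + (\<Sum>p\<in>UNIV. G x $ j $ p * B m i l $ p $ k)
      = (\<Sum>p\<in>UNIV. G x $ j $ p * (B i l m + B l m i + B m i l) $ p $ k)"
    by (simp add: sum.distrib distrib_left)
  also have "\<dots> = 0" unfolding B0 by simp
  finally show ?thesis
    unfolding cov
    by (simp add: sum_subtractf christoffel_sym[OF x, of _ l i] christoffel_sym[OF x, of _ m l]
        christoffel_sym[OF x, of _ m i])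
qed

lemma partial_metric_G:
  assumes x: "x \<in> U"
  shows "((\<lambda>y. metric_G G j k l m y) has_derivative (\<lambda>v.
    (G x $ m $ j * dir_deriv v (\<lambda>y. G y $ k $ l) x + dir_deriv v (\<lambda>y. G y $ m $ j) x * G x $ k $ l)
    - (G x $ m $ k * dir_deriv v (\<lambda>y. G y $ j $ l) x + dir_deriv v (\<lambda>y. G y $ m $ k) x * G x $ j $ l))) (at x)"
  unfolding metric_G_def by (rule has_derivative_diff has_derivative_mult Ck_1D[OF Ck_G x])+

lemma cov_deriv4_metric_G:
  assumes x: "x \<in> U"
  shows "cov_deriv4 G (metric_G G) i j k l m x = 0"
proof -
  \<comment> \<open>The Christoffel symbol with its upper index lowered. In these terms \<nabla>g =
    0 reads as \<open>dG\<close>, and the claim becomes a cancellation of products.\<close>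
  define L where "L s j = (\<Sum>q\<in>UNIV. G x $ s $ q * \<Gamma> q i j x)" for s j
  have dG: "partial i (\<lambda>y. G y $ j $ k) x = L k j + L j k" for j k
    unfolding L_def by (rule metric_compatible[OF x])
  have L1: "(\<Sum>q\<in>UNIV. \<Gamma> q i j x * (G x $ s $ q * c)) = L s j * c"
    and L2: "(\<Sum>q\<in>UNIV. \<Gamma> q i j x * (c * G x $ s $ q)) = c * L s j" for s j c
    by (simp_all add: L_def sum_distrib_left sum_distrib_right mult_ac)
  have L3: "(\<Sum>q\<in>UNIV. \<Gamma> q i j x * (G x $ q $ s * c)) = L s j * c"
    and L4: "(\<Sum>q\<in>UNIV. \<Gamma> q i j x * (c * G x $ q $ s)) = c * L s j" for s j c
    unfolding L1[symmetric] L2[symmetric] by (simp_all add: symG[OF x, of _ s])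
  have "(\<Sum>p\<in>UNIV. \<Gamma> p i j x * metric_G G p k l m x) = L m j * G x $ k $ l - G x $ m $ k * L l j"
    by (simp add: metric_G_def right_diff_distrib sum_subtractf L1 L4)
  moreover have "(\<Sum>p\<in>UNIV. \<Gamma> p i k x * metric_G G j p l m x) = G x $ m $ j * L l k - L m k * G x $ j $ l"
    by (simp add: metric_G_def right_diff_distrib sum_subtractf L1 L4)
  moreover have "(\<Sum>p\<in>UNIV. \<Gamma> p i l x * metric_G G j k p m x) = G x $ m $ j * L k l - G x $ m $ k * L j l"
    by (simp add: metric_G_def right_diff_distrib sum_subtractf L2)
  moreover have "(\<Sum>p\<in>UNIV. \<Gamma> p i m x * metric_G G j k l p x) = L j m * G x $ k $ l - L k m * G x $ j $ l"
    by (simp add: metric_G_def right_diff_distrib sum_subtractf L3)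
  moreover have "partial i (metric_G G j k l m) x =
      (G x $ m $ j * (L l k + L k l) + (L j m + L m j) * G x $ k $ l)
      - (G x $ m $ k * (L l j + L j l) + (L k m + L m k) * G x $ j $ l)"
    using dir_deriv_eq[OF partial_metric_G[OF x], of "axis i 1"] by (simp add: dG)
  ultimately show ?thesis
    by (simp add: cov_deriv4_def sum.distrib algebra_simps)
qed

end

section \<open>Changing charts of a maximal atlas\<close>

lemma chart_facts:
  assumes "is_chart X c"
  shows "inj_on (snd c) (fst c)"
    and "p \<in> fst c \<Longrightarrow> snd c p \<in> chart_image c"
    and "x \<in> chart_image c \<Longrightarrow> chart_inv c x \<in> fst c"
    and "x \<in> chart_image c \<Longrightarrow> snd c (chart_inv c x) = x"
    and "p \<in> fst c \<Longrightarrow> chart_inv c (snd c p) = p"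
    and "T \<subseteq> fst c \<Longrightarrow> open (snd c ` T) \<longleftrightarrow> openin X T"
proof -
  have h: "homeomorphic_map (subtopology X (fst c)) (top_of_set (chart_image c)) (snd c)"
    and o: "openin X (fst c)" "open (chart_image c)"
    using assms by (auto simp: is_chart_def)
  have top: "topspace (subtopology X (fst c)) = fst c"
    using openin_subset[OF o(1)] by auto
  show inj: "inj_on (snd c) (fst c)"
    using homeomorphic_imp_injective_map[OF h] unfolding top .
  show "p \<in> fst c \<Longrightarrow> snd c p \<in> chart_image c" by (simp add: chart_image_def)
  show "x \<in> chart_image c \<Longrightarrow> chart_inv c x \<in> fst c"
    unfolding chart_image_def chart_inv_def by (rule inv_into_into)
  show "x \<in> chart_image c \<Longrightarrow> snd c (chart_inv c x) = x"
    unfolding chart_image_def chart_inv_def by (rule f_inv_into_f)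
  show "p \<in> fst c \<Longrightarrow> chart_inv c (snd c p) = p"
    unfolding chart_inv_def by (rule inv_into_f_f[OF inj])
  assume T: "T \<subseteq> fst c"
  have "openin X T \<longleftrightarrow> openin (subtopology X (fst c)) T"
    using openin_open_subtopology[OF o(1)] T by blast
  also have "\<dots> \<longleftrightarrow> openin (top_of_set (chart_image c)) (snd c ` T)"
    using homeomorphic_map_openness_eq[OF h, of T] T unfolding top by blast
  also have "\<dots> \<longleftrightarrow> open (snd c ` T)"
    using openin_open_subtopology[of euclidean "chart_image c" "snd c ` T"] o(2) T
    by (auto simp: chart_image_def)
  finally show "open (snd c ` T) \<longleftrightarrow> openin X T" ..
qed

lemma chart_inv_eqI:
  assumes "is_chart X c" "p \<in> fst c" "snd c p = x"
  shows "chart_inv c x = p"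
  using chart_facts(5)[OF assms(1,2)] assms(3) by simp

lemma homeomorphism_imp_homeomorphic_map:
  fixes f :: "'a::topological_space \<Rightarrow> 'b::topological_space"
  assumes "homeomorphism S T f h"
  shows "homeomorphic_map (top_of_set S) (top_of_set T) f"
  using assms unfolding homeomorphic_map_maps homeomorphism_def homeomorphic_maps_def
  by (intro exI[of _ h]) (auto simp: continuous_map_in_subtopology)

lemma smooth_on_compose:
  fixes f :: "'a::euclidean_space \<Rightarrow> 'b::euclidean_space"
  assumes "open S" "open T" "f ` S \<subseteq> T" "smooth_on S f" "smooth_on T h"
  shows "smooth_on S (\<lambda>x. h (f x))"
  unfolding smooth_on_def
proof
  show "Ck_on k S (\<lambda>x. h (f x))" for k
    using assms(4,5) by (rule_tac Ck_on_compose[OF assms(1-3)]) (simp_all add: smooth_on_def)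
qed

lemma smooth_on_cong:
  assumes "open S" "\<And>x. x \<in> S \<Longrightarrow> f x = h x"
  shows "smooth_on S f \<longleftrightarrow> smooth_on S h"
  using Ck_on_cong[OF assms] by (simp add: smooth_on_def)

lemma smooth_on_subset: "smooth_on S f \<Longrightarrow> T \<subseteq> S \<Longrightarrow> smooth_on T f"
  by (auto simp: smooth_on_def intro: Ck_on_subset)

section \<open>Reparametrised charts\<close>

definition reparam_chart :: "('a, 'n::finite) chart \<Rightarrow> (real^'n) set \<Rightarrow> (real^'n \<Rightarrow> real^'n) \<Rightarrow> ('a, 'n) chart" where
  "reparam_chart c W \<theta> = ({p \<in> fst c. snd c p \<in> W}, \<theta> \<circ> snd c)"

text \<open>\<open>\<theta>\<close> sends old coordinates to new ones and \<open>\<eta>\<close> is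
  its inverse. Both are smooth, since \<open>compatible\<close> asks for both transition
  maps.\<close>

locale chart_change =
  fixes X :: "'a topology" and \<A> :: "('a, 'n::finite) chart set" and c :: "('a, 'n) chart"
    and W W' :: "(real^'n) set" and \<theta> \<eta> :: "real^'n \<Rightarrow> real^'n"
  assumes M: "smooth_manifold X \<A>" and c: "c \<in> \<A>"
    and W: "open W" "W \<subseteq> chart_image c" "open W'" and hom: "homeomorphism W W' \<theta> \<eta>"
    and smooth: "smooth_on W \<theta>" "smooth_on W' \<eta>"
begin

abbreviation "c' \<equiv> reparam_chart c W \<theta>"

lemma chart: "d \<in> \<A> \<Longrightarrow> is_chart X d"
  using M by (auto simp: smooth_manifold_def)

lemmas cf = chart_facts[OF chart[OF c]]

lemma hom_facts: "x \<in> W \<Longrightarrow> \<theta> x \<in> W'" "y \<in> W' \<Longrightarrow> \<eta> y \<in> W" "x \<in> W \<Longrightarrow> \<eta> (\<theta> x) = x" "y \<in> W' \<Longrightarrow> \<theta> (\<eta> y) = y"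
  using hom by (auto simp: homeomorphism_def)

lemma image_fst: "snd c ` fst c' = W"
proof
  show "W \<subseteq> snd c ` fst c'"
  proof
    fix x assume "x \<in> W"
    then have "x \<in> chart_image c" using W(2) by blast
    then show "x \<in> snd c ` fst c'"
      using cf(3,4)[of x] \<open>x \<in> W\<close> by (intro image_eqI[of _ _ "chart_inv c x"]) (auto simp: reparam_chart_def)
  qed
qed (auto simp: reparam_chart_def)

lemma chart_image: "chart_image c' = W'"
proof -
  have "chart_image c' = \<theta> ` (snd c ` fst c')"
    by (simp add: chart_image_def reparam_chart_def image_comp)
  then show ?thesis using hom by (simp only: image_fst homeomorphism_def)
qed

lemma is_chart_reparam: "is_chart X c'"
  unfolding is_chart_def chart_image
proof (intro conjI W(3))
  have sub: "fst c' \<subseteq> fst c" by (auto simp: reparam_chart_def)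
  show o: "openin X (fst c')"
    using cf(6)[OF sub] image_fst W(1) by simp
  have ch: "homeomorphic_map (subtopology X (fst c)) (top_of_set (chart_image c)) (snd c)" "openin X (fst c)"
    using chart[OF c] by (auto simp: is_chart_def)
  have "homeomorphic_map (subtopology (subtopology X (fst c)) (fst c')) (subtopology (top_of_set (chart_image c)) W) (snd c)"
  proof (rule homeomorphic_map_subtopologies[OF ch(1)])
    have "topspace (subtopology X (fst c)) \<inter> fst c' = fst c'"
      using openin_subset[OF ch(2)] sub by auto
    then show "snd c ` (topspace (subtopology X (fst c)) \<inter> fst c') = topspace (top_of_set (chart_image c)) \<inter> W"
      using image_fst W(2) by auto
  qed
  then have "homeomorphic_map (subtopology X (fst c')) (top_of_set W) (snd c)"
    using sub W(2) by (simp add: subtopology_subtopology Int_absorb1)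
  then show "homeomorphic_map (subtopology X (fst c')) (top_of_set W') (snd c')"
    using homeomorphic_map_compose[OF _ homeomorphism_imp_homeomorphic_map[OF hom]]
    by (simp add: reparam_chart_def)
qed

lemma chart_inv: "y \<in> W' \<Longrightarrow> chart_inv c' y = chart_inv c (\<eta> y)"
proof (rule chart_inv_eqI[OF is_chart_reparam])
  assume y: "y \<in> W'"
  then have "\<eta> y \<in> chart_image c" using hom_facts(2) W(2) by blast
  then show "chart_inv c (\<eta> y) \<in> fst c'" "snd c' (chart_inv c (\<eta> y)) = y"
    using cf(3,4) hom_facts(2,4)[OF y] by (auto simp: reparam_chart_def)
qed

lemma overlap_left: "overlap c' d = {y \<in> W'. \<eta> y \<in> overlap c d}"
proof (intro set_eqI iffI)
  fix y assume "y \<in> overlap c' d"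
  then obtain p where "p \<in> fst c" "snd c p \<in> W" "p \<in> fst d" "y = \<theta> (snd c p)"
    by (auto simp: overlap_def reparam_chart_def)
  then show "y \<in> {y \<in> W'. \<eta> y \<in> overlap c d}"
    using hom_facts by (auto simp: overlap_def)
next
  fix y assume "y \<in> {y \<in> W'. \<eta> y \<in> overlap c d}"
  then obtain p where p: "p \<in> fst c" "p \<in> fst d" "\<eta> y = snd c p" "y \<in> W'"
    by (auto simp: overlap_def)
  then have "p \<in> fst c' \<inter> fst d" "y = snd c' p"
    using hom_facts(2,4)[of y] by (auto simp: reparam_chart_def)
  then show "y \<in> overlap c' d"
    unfolding overlap_def by (rule rev_image_eqI)
qed

lemma open_overlap: "d \<in> \<A> \<Longrightarrow> e \<in> insert c' \<A> \<Longrightarrow> open (overlap d e)"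
proof -
  assume "d \<in> \<A>" "e \<in> insert c' \<A>"
  then have "is_chart X d" "is_chart X e"
    using chart[of d] chart[of e] is_chart_reparam by auto
  then have "is_chart X d" "openin X (fst e)"
    by (auto simp: is_chart_def)
  then show ?thesis
    using chart_facts(6)[of X d "fst d \<inter> fst e"]
    by (auto simp: overlap_def is_chart_def)
qed

text \<open>By maximality only compatibility with each \<open>d\<close> of the atlas has to be
  shown. Both transition maps factor through those between \<open>c\<close> and \<open>d\<close>,
  composed with \<open>\<eta>\<close> on one side or \<open>\<theta>\<close> on the other.\<close>

lemma reparam_in_atlas: "c' \<in> \<A>"
proof -
  have "compatible c' d" if d: "d \<in> \<A>" for d
    unfolding compatible_def
  proof
    have cd: "compatible c d" using M c d by (auto simp: smooth_manifold_def)
    have o: "open (overlap c d)" by (rule open_overlap[OF c]) (simp add: d)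
    have "continuous_on W' \<eta>" using hom by (simp add: homeomorphism_def)
    then have "open (W' \<inter> \<eta> -` overlap c d)"
      by (rule continuous_open_preimage[OF _ W(3) o])
    moreover have "overlap c' d = W' \<inter> \<eta> -` overlap c d"
      unfolding overlap_left by blast
    ultimately have o': "open (overlap c' d)" by metis
    have "smooth_on (overlap c' d) (\<lambda>y. transition c d (\<eta> y))"
      using cd smooth_on_subset[OF smooth(2), of "overlap c' d"]
      by (rule_tac smooth_on_compose[OF o' o]) (auto simp: overlap_left compatible_def)
    then show "smooth_on (overlap c' d) (transition c' d)"
      by (rule iffD1[OF smooth_on_cong[OF o'], rotated]) (auto simp: transition_def chart_inv overlap_left)
    have o2: "open (overlap d c')" by (rule open_overlap[OF d]) simp
    have im: "transition d c ` overlap d c' \<subseteq> W" and sub: "overlap d c' \<subseteq> overlap d c"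
      using chart_facts(5)[OF chart[OF d]]
      by (auto simp: overlap_def transition_def reparam_chart_def)
    have "smooth_on (overlap d c') (\<lambda>x. \<theta> (transition d c x))"
      using cd smooth_on_subset[OF _ sub] smooth(1)
      by (rule_tac smooth_on_compose[OF o2 W(1) im]) (auto simp: compatible_def)
    then show "smooth_on (overlap d c') (transition d c')"
      by (rule iffD1[OF smooth_on_cong[OF o2], rotated]) (auto simp: transition_def reparam_chart_def)
  qed
  moreover have "is_chart X e \<and> (\<forall>d\<in>\<A>. compatible e d) \<longrightarrow> e \<in> \<A>" for e
    using M unfolding smooth_manifold_def by meson
  ultimately show ?thesis
    using is_chart_reparam by meson
qed

text \<open>The transition from the new chart to the old one is \<open>\<eta>\<close>, so the
  transformation law is the pullback by \<open>\<eta>\<close>; the columns of its Jacobian are the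
  partial derivatives of \<open>\<eta>\<close>.\<close>

lemma bilinear_reparam:
  assumes "bilinear_tensor \<A> g" "y \<in> W'"
  shows "g c' y $ i $ j = dir_deriv (axis i 1) \<eta> y \<bullet> (g c (\<eta> y) *v dir_deriv (axis j 1) \<eta> y)"
proof -
  have ov: "W' = overlap c' c"
  proof -
    have "\<eta> y \<in> overlap c c" if "y \<in> W'" for y
      using hom_facts(2)[OF that] W(2) by (auto simp: overlap_def chart_image_def)
    then show ?thesis by (auto simp: overlap_left)
  qed
  have tr: "transition c' c z = \<eta> z" if "z \<in> W'" for z
    using chart_inv[OF that] cf(4)[of "\<eta> z"] hom_facts(2)[OF that] W(2) by (auto simp: transition_def)
  define J where "J = jacobian (transition c' c) (at y)"
  have col: "column i J = dir_deriv (axis i 1) \<eta> y" for i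
  proof -
    have "column i J = dir_deriv (axis i 1) (transition c' c) y"
      by (simp add: J_def jacobian_def matrix_def column_def dir_deriv_def vec_eq_iff)
    also have "\<dots> = dir_deriv (axis i 1) \<eta> y" by (rule dir_deriv_cong[OF W(3) assms(2) tr])
    finally show ?thesis .
  qed
  have "g c' y = transpose J ** g c (transition c' c y) ** J"
    using assms ov reparam_in_atlas c unfolding bilinear_tensor_def J_def by blast
  then have "g c' y $ i $ j = (transpose J ** (g c (\<eta> y) ** J)) $ i $ j"
    by (simp add: tr[OF assms(2)] matrix_mul_assoc)
  also have "\<dots> = column i J \<bullet> (g c (\<eta> y) *v column j J)"
    by (simp add: matrix_matrix_mult_def transpose_def inner_vec_def column_def matrix_vector_mult_def)
  finally show ?thesis unfolding col .
qed

end

section \<open>The extended recurrence equation in adapted coordinates\<close>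

lemma sum_UNIV_option:
  fixes f :: "'m::finite option \<Rightarrow> 'b::comm_monoid_add"
  shows "(\<Sum>i\<in>UNIV. f i) = f None + (\<Sum>\<alpha>\<in>UNIV. f (Some \<alpha>))"
  by (simp add: UNIV_option_conv sum.reindex)

section \<open>Algebra of the wedge identity\<close>

lemma ex_third:
  fixes a b :: "'m::finite"
  assumes "CARD('m) \<ge> 3"
  obtains c where "c \<noteq> a" "c \<noteq> b"
proof -
  have "card {a, b} < CARD('m)" using assms card_insert_le_m1[of 2 "{b}" a] by (simp add: card_insert_if)
  then have "{a, b} \<noteq> UNIV" by auto
  then show ?thesis using that by auto
qed

text \<open>A third index, distinct from two given ones, is available at every step. It first kills
  the off-diagonal entries, which leaves \<open>E p p * S \<gamma> \<gamma> = c\<close> for distinct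
  \<open>p\<close> and \<open>\<gamma>\<close>; comparing two such products with a common third
  factor then makes the diagonals constant.\<close>

lemma wedge_identity_diagonal:
  fixes E S :: "'m::finite \<Rightarrow> 'm \<Rightarrow> real"
  assumes card: "CARD('m) \<ge> 3" and "c \<noteq> 0"
    and eq: "\<And>p \<gamma> \<alpha> \<beta>. E p \<beta> * S \<gamma> \<alpha> - E p \<alpha> * S \<gamma> \<beta> =
      c * ((if p = \<beta> then 1 else 0) * (if \<gamma> = \<alpha> then 1 else 0) - (if p = \<alpha> then 1 else 0) * (if \<gamma> = \<beta> then 1 else 0))"
  obtains e s where "s \<noteq> 0" "\<And>p \<beta>. E p \<beta> = (if p = \<beta> then e else 0)" "\<And>p \<beta>. S p \<beta> = (if p = \<beta> then s else 0)"
proof -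
  have E0: "E p \<beta> = 0" if "p \<noteq> \<beta>" for p \<beta>
  proof (rule ccontr)
    assume nz: "E p \<beta> \<noteq> 0"
    obtain \<gamma> where \<gamma>: "\<gamma> \<noteq> p" "\<gamma> \<noteq> \<beta>" using ex_third[OF card, of p \<beta>] by blast
    have "E p \<beta> * S \<gamma> \<gamma> = E p \<gamma> * S \<gamma> \<beta>" using eq[of p \<beta> \<gamma> \<gamma>] that \<gamma> by simp
    moreover have "E p \<beta> * S \<gamma> p = E p p * S \<gamma> \<beta>" using eq[of p \<beta> \<gamma> p] that \<gamma> by simp
    moreover have "E p p * S \<gamma> \<gamma> - E p \<gamma> * S \<gamma> p = c" using eq[of p p \<gamma> \<gamma>] \<gamma> by simp
    \<comment> \<open>Multiply the third relation by \<open>E p \<beta>\<close> and insert the first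
      two: both products become \<open>E p p * E p \<gamma> * S \<gamma> \<beta>\<close>, with
      opposite signs.\<close>
    ultimately have "E p \<beta> * c = 0" by algebra
    then show False using nz \<open>c \<noteq> 0\<close> by simp
  qed
  have S0: "S \<gamma> \<alpha> = 0" if "\<gamma> \<noteq> \<alpha>" for \<gamma> \<alpha>
  proof (rule ccontr)
    assume nz: "S \<gamma> \<alpha> \<noteq> 0"
    obtain p where p: "p \<noteq> \<gamma>" "p \<noteq> \<alpha>" using ex_third[OF card, of \<gamma> \<alpha>] by blast
    have "E p p * S \<gamma> \<alpha> = 0" using eq[of p p \<gamma> \<alpha>] that p E0[of p \<alpha>] by simp
    moreover have "E p p * S \<gamma> \<gamma> = c" using eq[of p p \<gamma> \<gamma>] p E0[of p \<gamma>] by simp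
    ultimately show False using nz \<open>c \<noteq> 0\<close> by auto
  qed
  have ES: "E p p * S \<gamma> \<gamma> = c" if "p \<noteq> \<gamma>" for p \<gamma>
    using eq[of p p \<gamma> \<gamma>] that E0[of p \<gamma>] by simp
  obtain a :: 'm where True by blast
  have nz: "S \<gamma> \<gamma> \<noteq> 0" "E \<gamma> \<gamma> \<noteq> 0" for \<gamma>
  proof -
    obtain p where "p \<noteq> \<gamma>" using ex_third[OF card, of \<gamma> \<gamma>] by blast
    then show "S \<gamma> \<gamma> \<noteq> 0" "E \<gamma> \<gamma> \<noteq> 0" using ES[of p \<gamma>] ES[of \<gamma> p] \<open>c \<noteq> 0\<close> by auto
  qed
  have diag: "E p p = E a a \<and> S p p = S a a" for p
  proof -
    obtain \<gamma> where \<gamma>: "\<gamma> \<noteq> p" "\<gamma> \<noteq> a" using ex_third[OF card, of p a] by blast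
    have "E p p * S \<gamma> \<gamma> = E a a * S \<gamma> \<gamma>" "E \<gamma> \<gamma> * S p p = E \<gamma> \<gamma> * S a a"
      using ES[OF \<gamma>(1)] ES[OF \<gamma>(2)] ES[OF \<gamma>(1)[symmetric]] ES[OF \<gamma>(2)[symmetric]] by simp_all
    then show ?thesis using nz by simp
  qed
  show ?thesis
  proof (rule that)
    show "S a a \<noteq> 0" by (rule nz)
    show "E p \<beta> = (if p = \<beta> then E a a else 0)" "S p \<beta> = (if p = \<beta> then S a a else 0)" for p \<beta>
      using diag[of p] E0[of p \<beta>] S0[of p \<beta>] by (cases "p = \<beta>"; simp)+
  qed
qed

text \<open>Raising the first index of \<open>E\<close>, \<open>S\<close> and \<open>h\<close> with
  the inverse of \<open>h\<close> turns \<open>h\<close> into the identity matrix and leads back to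
  the diagonal case.\<close>

lemma wedge_identity:
  fixes E S h :: "real^'m::finite^'m"
  assumes card: "CARD('m) \<ge> 3" and "c \<noteq> 0" and h: "invertible h"
    and eq: "\<And>p \<gamma> \<alpha> \<beta>. E $ p $ \<beta> * S $ \<gamma> $ \<alpha> - E $ p $ \<alpha> * S $ \<gamma> $ \<beta> =
      c * (h $ p $ \<beta> * h $ \<gamma> $ \<alpha> - h $ p $ \<alpha> * h $ \<gamma> $ \<beta>)"
  obtains e s where "s \<noteq> 0" "E = e *\<^sub>R h" "S = s *\<^sub>R h"
proof -
  define H where "H = matrix_inv h"
  have prod: "(H ** A) $ p $ \<beta> * (H ** B) $ \<gamma> $ \<alpha> = (\<Sum>i\<in>UNIV. \<Sum>j\<in>UNIV. (H $ p $ i * H $ \<gamma> $ j) * (A $ i $ \<beta> * B $ j $ \<alpha>))"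
    for A B :: "real^'m^'m" and p \<beta> \<gamma> \<alpha>
    by (simp add: matrix_matrix_mult_def sum_product mult_ac)
  have Hh: "(H ** h) $ i $ j = (if i = j then 1 else 0)" for i j
    by (simp add: H_def matrix_inv_works[OF h] mat_def)
  have "(H ** E) $ p $ \<beta> * (H ** S) $ \<gamma> $ \<alpha> - (H ** E) $ p $ \<alpha> * (H ** S) $ \<gamma> $ \<beta> =
      c * ((if p = \<beta> then 1 else 0) * (if \<gamma> = \<alpha> then 1 else 0) - (if p = \<alpha> then 1 else 0) * (if \<gamma> = \<beta> then 1 else 0))"
    for p \<gamma> \<alpha> \<beta>
  proof -
    have "(H ** E) $ p $ \<beta> * (H ** S) $ \<gamma> $ \<alpha> - (H ** E) $ p $ \<alpha> * (H ** S) $ \<gamma> $ \<beta>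
      = (\<Sum>i\<in>UNIV. \<Sum>j\<in>UNIV. (H $ p $ i * H $ \<gamma> $ j) * (E $ i $ \<beta> * S $ j $ \<alpha> - E $ i $ \<alpha> * S $ j $ \<beta>))"
      by (simp only: prod right_diff_distrib sum_subtractf)
    also have "\<dots> = c * ((H ** h) $ p $ \<beta> * (H ** h) $ \<gamma> $ \<alpha> - (H ** h) $ p $ \<alpha> * (H ** h) $ \<gamma> $ \<beta>)"
      unfolding eq prod by (simp add: right_diff_distrib sum_subtractf sum_distrib_left mult_ac)
    finally show ?thesis by (simp only: Hh)
  qed
  then obtain e s where es: "s \<noteq> 0" "\<And>p \<beta>. (H ** E) $ p $ \<beta> = (if p = \<beta> then e else 0)"
    "\<And>p \<beta>. (H ** S) $ p $ \<beta> = (if p = \<beta> then s else 0)"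
    by (rule wedge_identity_diagonal[OF card \<open>c \<noteq> 0\<close>]) (rule that, assumption+)
  have HE: "H ** E = e *\<^sub>R mat 1" "H ** S = s *\<^sub>R mat 1"
    by (simp_all add: vec_eq_iff es(2,3) mat_def)
  have hr: "h ** (r *\<^sub>R mat 1) = r *\<^sub>R h" for r
    by (simp add: matrix_matrix_mult_def vec_eq_iff mat_def if_distrib[of "\<lambda>a. _ * a"] mult_ac cong: if_cong)
  have hH: "h ** (H ** A) = A" for A
    by (simp add: matrix_mul_assoc H_def matrix_inv_works[OF h])
  show ?thesis
  proof (rule that[OF es(1)])
    show "E = e *\<^sub>R h" using hH[of E] unfolding HE hr by (rule sym)
    show "S = s *\<^sub>R h" using hH[of S] unfolding HE hr by (rule sym)
  qed
qed

section \<open>Block-diagonal charts with time as first coordinate\<close>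

lemma dir_deriv_eq_0:
  assumes "open S" "x \<in> S" "\<And>y. y \<in> S \<Longrightarrow> f y = 0"
  shows "dir_deriv v f x = 0"
  using dir_deriv_cong[OF assms(1,2), of f "\<lambda>_. 0" v] dir_deriv_eq[OF has_derivative_const, of v 0 x] assms(3)
  by simp

text \<open>Here \<open>a\<close>, \<open>b\<close> and \<open>s\<close> stand for A, \<beta> and
  \<psi>. The time component of the metric is only asked to be negative, so that the locale applies
  both before and after the passage to proper time.\<close>

locale recurrent_chart = metric_chart G U
  for G :: "real^('m::finite option) \<Rightarrow> real^('m option)^('m option)" and U +
  fixes a :: "real^('m option) \<Rightarrow> real^('m option)" and b s :: "real^('m option) \<Rightarrow> real"
  assumes card: "CARD('m) \<ge> 3"
    and block: "x \<in> U \<Longrightarrow> G x $ None $ Some \<alpha> = 0"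
    and time: "x \<in> U \<Longrightarrow> G x $ None $ None < 0"
    and spaceinv: "x \<in> U \<Longrightarrow> invertible (\<chi> \<alpha> \<beta>. G x $ Some \<alpha> $ Some \<beta>)"
    and b0: "x \<in> U \<Longrightarrow> b x \<noteq> 0"
    and a0: "x \<in> U \<Longrightarrow> a x $ None \<noteq> 0" and a1: "x \<in> U \<Longrightarrow> a x $ Some \<alpha> = 0"
    and s: "x \<in> U \<Longrightarrow> s differentiable (at x)"
    and rec: "x \<in> U \<Longrightarrow> cov_deriv4 G (riemann G) i j k l m x =
        a x $ i * riemann G j k l m x + (b x - s x) * a x $ i * metric_G G j k l m x
        + b x / 2 * (a x $ j * metric_G G i k l m x + a x $ k * metric_G G j i l m x
                   + a x $ l * metric_G G j k i m x + a x $ m * metric_G G j k l i x)"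
begin

lemma block': "x \<in> U \<Longrightarrow> G x $ Some \<alpha> $ None = 0"
  using block symG by metis

lemma partial_block: "x \<in> U \<Longrightarrow> partial i (\<lambda>y. G y $ None $ Some \<alpha>) x = 0"
    "x \<in> U \<Longrightarrow> partial i (\<lambda>y. G y $ Some \<alpha> $ None) x = 0"
  by (rule dir_deriv_eq_0[OF oU]; simp add: block block')+

lemma inverse_time: 
  assumes "x \<in> U"
  shows "matrix_inv (G x) $ None $ None = 1 / G x $ None $ None" "matrix_inv (G x) $ None $ Some \<alpha> = 0"
proof -
  have "(G x ** matrix_inv (G x)) $ None $ k = G x $ None $ None * matrix_inv (G x) $ None $ k" for k
    by (simp add: matrix_matrix_mult_def sum_UNIV_option block[OF assms])
  then have "G x $ None $ None * matrix_inv (G x) $ None $ k = (if None = k then 1 else 0)" for k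
    unfolding matrix_inv_works[OF inv[OF assms]] by (simp add: mat_def)
  from this[of None] this[of "Some \<alpha>"] show "matrix_inv (G x) $ None $ None = 1 / G x $ None $ None"
    "matrix_inv (G x) $ None $ Some \<alpha> = 0"
    using time[OF assms] by (simp_all add: field_simps)
qed

text \<open>Geometrically, the first symbol is the second fundamental form of the slices up to a
  factor, and the second is the spatial derivative of the logarithm of the lapse.\<close>

lemma christoffel_time:
  "x \<in> U \<Longrightarrow> \<Gamma> None (Some \<pi>) (Some \<alpha>) x = - partial None (\<lambda>y. G y $ Some \<pi> $ Some \<alpha>) x / (2 * G x $ None $ None)"
  "x \<in> U \<Longrightarrow> \<Gamma> None None (Some \<alpha>) x = partial (Some \<alpha>) (\<lambda>y. G y $ None $ None) x / (2 * G x $ None $ None)"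
  by (simp_all add: christoffel_def sum_UNIV_option inverse_time partial_block)

text \<open>The second Bianchi identity is taken with \<open>None\<close> and two spatial form
  indices. The \<open>b\<close> terms cancel in it, and \<open>a\<close> has only a time component,
  so the claim appears multiplied by \<open>a x $ None\<close>.\<close>

lemma curvature_spatial:
  assumes x: "x \<in> U"
  shows "riemann G j k (Some \<alpha>) (Some \<beta>) x = s x * metric_G G j k (Some \<alpha>) (Some \<beta>) x"
proof -
  have "a x $ None * (riemann G j k (Some \<alpha>) (Some \<beta>) x - s x * metric_G G j k (Some \<alpha>) (Some \<beta>) x) = 0"
    using bianchi2[OF x, of None j k "Some \<alpha>" "Some \<beta>"] symG[OF x, of "Some \<alpha>" "Some \<beta>"]
      symG[OF x, of j "Some \<alpha>"] symG[OF x, of j "Some \<beta>"] symG[OF x, of k "Some \<alpha>"] symG[OF x, of k "Some \<beta>"]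
    by (cases j; cases k) (simp_all add: rec[OF x] metric_G_def a1[OF x] block[OF x] block'[OF x] algebra_simps)
  then show ?thesis using a0[OF x] by simp
qed

abbreviation (input) "K j k l m x \<equiv> riemann G j k l m x - s x * metric_G G j k l m x"

text \<open>By \<open>curvature_spatial\<close> this component of the curvature is identically zero
  near \<open>x\<close>, so its covariant derivative consists of Christoffel terms alone.
  Subtracting \<open>s x\<close> times the same terms of the parallel tensor \<open>metric_G\<close>
  replaces the curvature by \<open>K\<close>, without differentiating \<open>s\<close>. As
  \<open>K\<close> vanishes when both form indices are spatial, only the terms that turn \<alpha> or
  \<beta> into \<open>None\<close> survive.\<close>

lemma second_fundamental_wedge:
  assumes x: "x \<in> U"
  shows "\<Gamma> None p (Some \<beta>) x * K None (Some \<gamma>) None (Some \<alpha>) x - \<Gamma> None p (Some \<alpha>) x * K None (Some \<gamma>) None (Some \<beta>) x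
    = (b x * a x $ None / 2) * metric_G G p (Some \<gamma>) (Some \<alpha>) (Some \<beta>) x"
proof -
  let ?N = "None :: 'm option"
  have G0: "metric_G G ?N (Some \<gamma>) (Some \<alpha>) (Some \<beta>) y = 0" if "y \<in> U" for y
    by (simp add: metric_G_def block[OF that] block'[OF that])
  have R0: "riemann G ?N (Some \<gamma>) (Some \<alpha>) (Some \<beta>) y = 0" if "y \<in> U" for y
    using curvature_spatial[OF that] G0[OF that] by simp
  have d: "partial p (riemann G ?N (Some \<gamma>) (Some \<alpha>) (Some \<beta>)) x = 0"
    by (rule dir_deriv_eq_0[OF oU x R0])
  have dG: "partial p (metric_G G ?N (Some \<gamma>) (Some \<alpha>) (Some \<beta>)) x = 0"
    by (rule dir_deriv_eq_0[OF oU x G0])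
  \<comment> \<open>The Christoffel part of the covariant derivative of \<open>T\<close> in
    direction \<open>p\<close>, taken as a functional so that it can be compared for the curvature,
    \<open>metric_G\<close> and \<open>K\<close>.\<close>
  define Q where "Q T = (\<Sum>q\<in>UNIV. \<Gamma> q p ?N x * T q (Some \<gamma>) (Some \<alpha>) (Some \<beta>) x
      + \<Gamma> q p (Some \<gamma>) x * T ?N q (Some \<alpha>) (Some \<beta>) x
      + \<Gamma> q p (Some \<alpha>) x * T ?N (Some \<gamma>) q (Some \<beta>) x + \<Gamma> q p (Some \<beta>) x * T ?N (Some \<gamma>) (Some \<alpha>) q x)" for T
  have 1: "- Q (riemann G) = b x / 2 * (a x $ ?N * metric_G G p (Some \<gamma>) (Some \<alpha>) (Some \<beta>) x)"
    using rec[OF x, of p ?N "Some \<gamma>" "Some \<alpha>" "Some \<beta>"] R0[OF x] G0[OF x] a1[OF x]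
    by (simp add: cov_deriv4_def d Q_def)
  have 2: "Q (metric_G G) = 0"
    using cov_deriv4_metric_G[OF x, of p ?N "Some \<gamma>" "Some \<alpha>" "Some \<beta>"] by (simp add: cov_deriv4_def dG Q_def)
  have "Q (riemann G) - s x * Q (metric_G G) = Q (\<lambda>j k l m x. K j k l m x)"
    by (simp add: Q_def sum_distrib_left sum_subtractf[symmetric] algebra_simps)
  also have "\<dots> = \<Gamma> None p (Some \<alpha>) x * K ?N (Some \<gamma>) ?N (Some \<beta>) x + \<Gamma> None p (Some \<beta>) x * K ?N (Some \<gamma>) (Some \<alpha>) ?N x"
    by (simp add: Q_def curvature_spatial[OF x] sum_UNIV_option)
  also have "K ?N (Some \<gamma>) (Some \<alpha>) ?N x = - K ?N (Some \<gamma>) ?N (Some \<alpha>) x"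
    using riemann_antisym[of ?N "Some \<gamma>" "Some \<alpha>" ?N x] symG[OF x, of "Some \<alpha>" "Some \<gamma>"]
    by (simp add: metric_G_def block[OF x] block'[OF x])
  finally show ?thesis using 1 2 by (simp add: algebra_simps)
qed

text \<open>For a spatial direction \<open>p\<close> the preceding lemma is an instance of
  \<open>wedge_identity\<close>, which makes the slices umbilic. For \<open>p = None\<close> its
  right-hand side vanishes, and since \<open>S\<close> is a nonzero multiple of the invertible
  \<open>h\<close>, the symbol that measures the spatial change of the lapse must be zero.\<close>

lemma spatial_umbilic:
  assumes x: "x \<in> U"
  obtains \<phi> where "\<And>\<alpha> \<beta>. partial None (\<lambda>y. G y $ Some \<alpha> $ Some \<beta>) x = \<phi> * G x $ Some \<alpha> $ Some \<beta>"
    and "\<And>\<alpha>. partial (Some \<alpha>) (\<lambda>y. G y $ None $ None) x = 0"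
proof -
  define h where "h = (\<chi> \<alpha> \<beta>. G x $ Some \<alpha> $ Some \<beta>)"
  define E where "E = (\<chi> p \<beta>. \<Gamma> None (Some p) (Some \<beta>) x)"
  define S where "S = (\<chi> \<gamma> \<alpha>. K None (Some \<gamma>) None (Some \<alpha>) x)"
  define c where "c = b x * a x $ None / 2"
  have c0: "c \<noteq> 0" using a0[OF x] b0[OF x] by (simp add: c_def)
  have hinv: "invertible h" unfolding h_def by (rule spaceinv[OF x])
  have "E $ p $ \<beta> * S $ \<gamma> $ \<alpha> - E $ p $ \<alpha> * S $ \<gamma> $ \<beta> = c * (h $ p $ \<beta> * h $ \<gamma> $ \<alpha> - h $ p $ \<alpha> * h $ \<gamma> $ \<beta>)" for p \<gamma> \<alpha> \<beta>
    using second_fundamental_wedge[OF x, of "Some p" \<beta> \<gamma> \<alpha>] symG[OF x, of "Some \<beta>" "Some p"]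
      symG[OF x, of "Some \<beta>" "Some \<gamma>"]
    unfolding E_def S_def c_def h_def by (simp add: metric_G_def mult.commute)
  then obtain e t where et: "t \<noteq> 0" "E = e *\<^sub>R h" "S = t *\<^sub>R h"
    by (rule wedge_identity[OF card c0 hinv]) (rule that, assumption+)
  have N0: "\<Gamma> None None (Some \<beta>) x = 0" for \<beta>
  proof -
    have eq: "\<Gamma> None None (Some \<beta>) x * h $ \<gamma> $ \<alpha> = \<Gamma> None None (Some \<alpha>) x * h $ \<gamma> $ \<beta>" for \<gamma> \<alpha>
    proof -
      have "\<Gamma> None None (Some \<beta>) x * S $ \<gamma> $ \<alpha> - \<Gamma> None None (Some \<alpha>) x * S $ \<gamma> $ \<beta> = 0"
        using second_fundamental_wedge[OF x, of None \<beta> \<gamma> \<alpha>]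
        unfolding S_def by (simp add: metric_G_def block[OF x] block'[OF x])
      then have "t * (\<Gamma> None None (Some \<beta>) x * h $ \<gamma> $ \<alpha> - \<Gamma> None None (Some \<alpha>) x * h $ \<gamma> $ \<beta>) = 0"
        unfolding et(3) by (simp add: algebra_simps)
      then show ?thesis using et(1) by simp
    qed
    \<comment> \<open>Contracting \<open>eq\<close> with the inverse of \<open>h\<close> leaves a
      diagonal entry of the identity matrix on the left and an off-diagonal one on the
      right.\<close>
    obtain \<alpha> where \<alpha>: "\<alpha> \<noteq> \<beta>" using ex_third[OF card, of \<beta> \<beta>] by blast
    have "(\<Sum>\<gamma>\<in>UNIV. matrix_inv h $ \<alpha> $ \<gamma> * (\<Gamma> None None (Some \<beta>) x * h $ \<gamma> $ \<alpha>))
        = (\<Sum>\<gamma>\<in>UNIV. matrix_inv h $ \<alpha> $ \<gamma> * (\<Gamma> None None (Some \<alpha>) x * h $ \<gamma> $ \<beta>))"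
      unfolding eq ..
    then have "\<Gamma> None None (Some \<beta>) x * (matrix_inv h ** h) $ \<alpha> $ \<alpha> = \<Gamma> None None (Some \<alpha>) x * (matrix_inv h ** h) $ \<alpha> $ \<beta>"
      by (simp add: matrix_matrix_mult_def sum_distrib_left mult_ac)
    then show ?thesis using \<alpha> by (simp add: matrix_inv_works[OF hinv] mat_def)
  qed
  note t0 = time[OF x]
  show ?thesis
  proof (rule that)
    fix \<alpha> \<beta>
    have "\<Gamma> None (Some \<alpha>) (Some \<beta>) x = e * G x $ Some \<alpha> $ Some \<beta>"
      using arg_cong[OF et(2), of "\<lambda>M. M $ \<alpha> $ \<beta>"] by (simp add: E_def h_def)
    then show "partial None (\<lambda>y. G y $ Some \<alpha> $ Some \<beta>) x = (- 2 * e * G x $ None $ None) * G x $ Some \<alpha> $ Some \<beta>"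
      using t0 unfolding christoffel_time(1)[OF x] by (simp add: field_simps)
    show "partial (Some \<alpha>) (\<lambda>y. G y $ None $ None) x = 0"
      using N0[of \<alpha>] t0 unfolding christoffel_time(2)[OF x] by simp
  qed
qed

end

section \<open>The warped product structure\<close>

definition join :: "real \<Rightarrow> real^'m::finite \<Rightarrow> real^('m option)" where
  "join t y = (\<chi> i. case i of None \<Rightarrow> t | Some \<alpha> \<Rightarrow> y $ \<alpha>)"

lemma join_simps [simp]: "join t y $ None = t" "join t y $ Some \<alpha> = y $ \<alpha>" "spatial (join t y) = y"
    "join (x $ None) (spatial x) = x"
  by (auto simp: join_def spatial_def vec_eq_iff split: option.splits)

lemma join_add: "join (t + t') (y + y') = join t y + join t' y'"
  by (auto simp: join_def vec_eq_iff split: option.splits)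

lemma join_scale: "join (r * t) (r *\<^sub>R y) = r *\<^sub>R join t y"
  by (auto simp: join_def vec_eq_iff split: option.splits)

lemma join_axis: "join 0 (axis \<alpha> 1) = axis (Some \<alpha>) 1" "join 1 0 = axis None 1"
  by (auto simp: join_def vec_eq_iff axis_def split: option.splits)

lemma bounded_linear_join: "bounded_linear (\<lambda>y. join 0 y)"
proof (rule linear_conv_bounded_linear[THEN iffD1], rule linearI)
  show "join 0 (x + y) = join 0 x + join 0 y" for x y :: "real^'m"
    using join_add[of 0 0 x y] by simp
  show "join 0 (r *\<^sub>R x) = r *\<^sub>R join 0 x" for r and x :: "real^'m"
    using join_scale[of r 0 x] by simp
qed

lemma bounded_linear_spatial: "bounded_linear (spatial :: real^('m::finite option) \<Rightarrow> real^'m)"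
  by (auto simp: spatial_def vec_eq_iff intro!: linear_conv_bounded_linear[THEN iffD1] linearI)

lemma open_cylinder:
  assumes "open I" "open V"
  shows "open {x :: real^('m::finite option). x $ None \<in> I \<and> spatial x \<in> V}"
proof -
  have "open ((\<lambda>x :: real^('m option). x $ None) -` I)" "open ((spatial :: real^('m option) \<Rightarrow> real^'m) -` V)"
    by (intro open_vimage assms bounded_linear.continuous_on[OF bounded_linear_vec_nth]
        bounded_linear.continuous_on[OF bounded_linear_spatial] continuous_on_id)+
  moreover have "{x. x $ None \<in> I \<and> spatial x \<in> V} = (\<lambda>x. x $ None) -` I \<inter> spatial -` V" by auto
  ultimately show ?thesis by (simp add: open_Int)
qed

lemma dir_deriv_component: "dir_deriv w (\<lambda>x :: real^'n. x $ i) y = w $ i"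
  by (rule dir_deriv_eq[OF bounded_linear_imp_has_derivative[OF bounded_linear_vec_nth]])

lemma join_split: "join t y = t *\<^sub>R axis None 1 + join 0 y"
  using join_add[of t 0 0 y] join_scale[of t 1 0] by (simp add: join_axis)

lemma has_derivative_join_space: "((\<lambda>y. join t y) has_derivative (\<lambda>v. join 0 v)) (at y within S)"
  unfolding join_split[of t]
  using has_derivative_add[OF has_derivative_const bounded_linear_imp_has_derivative[OF bounded_linear_join]]
  by simp

lemma has_derivative_join_time: "((\<lambda>t. join t y) has_derivative (\<lambda>h. h *\<^sub>R axis None 1)) (at t within S)"
  unfolding ext[OF join_split[of _ y]] by (auto intro!: derivative_eq_intros)

lemma Ck_on_join_space: "open S \<Longrightarrow> Ck_on k S (\<lambda>y. join t y)"
  unfolding join_split[of t] by (intro Ck_on_add Ck_on_const Ck_on_linear[OF bounded_linear_join])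

lemma Ck_on_join_time: "open S \<Longrightarrow> Ck_on k S (\<lambda>t. join t y)"
  unfolding ext[OF join_split[of _ y]]
  by (intro Ck_on_add Ck_on_const Ck_on_linear[OF bounded_linear_scaleR_left])

lemma partial_join:
  assumes "(f has_derivative (\<lambda>v. dir_deriv v f (join t y))) (at (join t y))"
  shows "partial \<alpha> (\<lambda>y. f (join t y)) y = partial (Some \<alpha>) f (join t y)"
  using dir_deriv_eq[OF has_derivative_compose[OF has_derivative_join_space assms]]
  by (simp add: join_axis)

lemma spatially_constant:
  fixes f :: "real^('m::finite option) \<Rightarrow> real"
  assumes "convex V" "\<And>y. y \<in> V \<Longrightarrow> (f has_derivative (\<lambda>v. dir_deriv v f (join t y))) (at (join t y))"
    and "\<And>y \<alpha>. y \<in> V \<Longrightarrow> partial (Some \<alpha>) f (join t y) = 0"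
    and "y \<in> V" "z \<in> V"
  shows "f (join t y) = f (join t z)"
proof -
  have "((\<lambda>y. f (join t y)) has_derivative (\<lambda>v. 0)) (at y within V)" if "y \<in> V" for y
  proof -
    have lin: "linear (\<lambda>v. dir_deriv v f (join t y))"
      by (rule has_derivative_linear[OF assms(2)[OF that]])
    have "dir_deriv (join 0 v) f (join t y) = 0" for v
    proof -
      have "join 0 v = (\<Sum>\<alpha>\<in>UNIV. v $ \<alpha> *\<^sub>R axis (Some \<alpha>) 1)"
        by (auto simp: vec_eq_iff join_def axis_def if_distrib[of "\<lambda>a. _ * a"] split: option.splits cong: if_cong)
      then have "dir_deriv (join 0 v) f (join t y) = (\<Sum>\<alpha>\<in>UNIV. v $ \<alpha> *\<^sub>R partial (Some \<alpha>) f (join t y))"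
        by (simp only: linear_sum[OF lin] linear_scale[OF lin])
      then show ?thesis using assms(3)[OF that] by simp
    qed
    then show ?thesis
      using has_derivative_compose[OF has_derivative_join_space assms(2)[OF that]] by simp
  qed
  from has_derivative_zero_constant[OF assms(1) this] show ?thesis using assms(4,5) by metis
qed

text \<open>Inserting u, v, u, v into \<open>metric_G\<close> gives minus the Gram determinant of
  \<open>u\<close> and \<open>v\<close>, hence the sign in front of \<open>\<kappa>\<close>.\<close>

lemma constant_curvature_sectional:
  fixes h :: "real^'m::finite \<Rightarrow> real^'m^'m"
  assumes "\<And>j k l m. riemann h j k l m y = \<kappa> * metric_G h j k l m y"
    and pos: "\<And>v. v \<noteq> 0 \<Longrightarrow> v \<bullet> (h y *v v) > 0" and sym: "transpose (h y) = h y"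
    and uv: "u \<noteq> v" "independent {u, v}"
  shows "sectional_curvature h y u v = - \<kappa>"
proof -
  define B where "B u v = u \<bullet> (h y *v v)" for u v
  have B: "B u v = (\<Sum>i\<in>UNIV. \<Sum>j\<in>UNIV. h y $ i $ j * u $ i * v $ j)" for u v
    by (simp add: B_def inner_vec_def matrix_vector_mult_def sum_distrib_left mult_ac)
  have Bsym: "B u v = B v u" for u v
    unfolding B_def using sym by (metis dot_lmul_matrix inner_commute vector_transpose_matrix)
  have Badd: "B (u + r *\<^sub>R v) w = B u w + r * B v w" "B w (u + r *\<^sub>R v) = B w u + r * B w v" for u v w r
    by (simp_all add: B_def inner_add_left matrix_vector_right_distrib inner_add_right scaleR_matrix_vector_assoc[symmetric] matrix_vector_mult_scaleR)
  have v0: "v \<noteq> 0" using uv(2) dependent_zero by auto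
  have Bv: "B v v > 0" using pos[OF v0] by (simp add: B_def)
  \<comment> \<open>The part of \<open>u\<close> orthogonal to \<open>v\<close>: its square times
    that of \<open>v\<close> is the Gram determinant, which is therefore positive.\<close>
  define w where "w = u + (- B u v / B v v) *\<^sub>R v"
  have "w \<noteq> 0"
  proof
    assume "w = 0"
    then have "u = (B u v / B v v) *\<^sub>R v" by (simp add: w_def)
    then have "u \<in> span {v}" by (metis span_base span_scale singletonI)
    then show False using uv independent_insert[of u "{v}"] by auto
  qed
  then have "B w w > 0" using pos by (simp add: B_def)
  moreover have "B v v * B w w = B u u * B v v - (B u v)\<^sup>2"
    using Bv unfolding w_def Badd Bsym[of v u] by (simp add: field_simps power2_eq_square)
  ultimately have den: "B u u * B v v - (B u v)\<^sup>2 \<noteq> 0"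
    using Bv by (metis mult_pos_pos less_irrefl)
  have "(\<Sum>j\<in>UNIV. \<Sum>k\<in>UNIV. \<Sum>l\<in>UNIV. \<Sum>m\<in>UNIV. riemann h j k l m y * u $ j * v $ k * u $ l * v $ m)
      = \<kappa> * (\<Sum>j\<in>UNIV. \<Sum>k\<in>UNIV. \<Sum>l\<in>UNIV. \<Sum>m\<in>UNIV.
          (h y $ m $ j * v $ m * u $ j) * (h y $ k $ l * v $ k * u $ l) - (h y $ m $ k * v $ m * v $ k) * (h y $ j $ l * u $ j * u $ l))"
    by (simp add: assms(1) metric_G_def sum_distrib_left algebra_simps)
  also have "(\<Sum>j\<in>UNIV. \<Sum>k\<in>UNIV. \<Sum>l\<in>UNIV. \<Sum>m\<in>UNIV.
          (h y $ m $ j * v $ m * u $ j) * (h y $ k $ l * v $ k * u $ l) - (h y $ m $ k * v $ m * v $ k) * (h y $ j $ l * u $ j * u $ l))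
      = B v u * B v u - B v v * B u u"
  proof -
    have 1: "(\<Sum>j\<in>UNIV. \<Sum>k\<in>UNIV. \<Sum>l\<in>UNIV. \<Sum>m\<in>UNIV. f m j * f' k l)
        = (\<Sum>m\<in>UNIV. \<Sum>j\<in>UNIV. f m j) * (\<Sum>k\<in>UNIV. \<Sum>l\<in>UNIV. f' k l)" for f f' :: "'m \<Rightarrow> 'm \<Rightarrow> real"
    proof -
      have "(\<Sum>j\<in>UNIV. \<Sum>k\<in>UNIV. \<Sum>l\<in>UNIV. \<Sum>m\<in>UNIV. f m j * f' k l)
          = (\<Sum>j\<in>UNIV. (\<Sum>m\<in>UNIV. f m j) * (\<Sum>k\<in>UNIV. \<Sum>l\<in>UNIV. f' k l))"
        by (simp only: sum_distrib_left sum_distrib_right)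
      also have "\<dots> = (\<Sum>j\<in>UNIV. \<Sum>m\<in>UNIV. f m j) * (\<Sum>k\<in>UNIV. \<Sum>l\<in>UNIV. f' k l)"
        by (simp only: sum_distrib_right)
      finally show ?thesis by (subst (asm) (4) sum.swap)
    qed
    have 2: "(\<Sum>j\<in>UNIV. \<Sum>k\<in>UNIV. \<Sum>l\<in>UNIV. \<Sum>m\<in>UNIV. f m k * f' j l)
        = (\<Sum>m\<in>UNIV. \<Sum>k\<in>UNIV. f m k) * (\<Sum>j\<in>UNIV. \<Sum>l\<in>UNIV. f' j l)" for f f' :: "'m \<Rightarrow> 'm \<Rightarrow> real"
      using 1[of f f'] by (subst sum.swap) simp
    show ?thesis
      unfolding sum_subtractf 1[of "\<lambda>m j. h y $ m $ j * v $ m * u $ j" "\<lambda>k l. h y $ k $ l * v $ k * u $ l"]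
        2[of "\<lambda>m k. h y $ m $ k * v $ m * v $ k" "\<lambda>j l. h y $ j $ l * u $ j * u $ l"] B[symmetric] ..
  qed
  finally have num: "(\<Sum>j\<in>UNIV. \<Sum>k\<in>UNIV. \<Sum>l\<in>UNIV. \<Sum>m\<in>UNIV. riemann h j k l m y * u $ j * v $ k * u $ l * v $ m)
      = - \<kappa> * (B u u * B v v - (B u v)\<^sup>2)"
    by (simp add: Bsym[of v u] power2_eq_square algebra_simps)
  show ?thesis
    unfolding sectional_curvature_def num B_def[symmetric] using den by simp
qed

text \<open>Coordinates with unit lapse on a product of convex sets; convexity lets functions with
  vanishing spatial or time derivative be treated as constant in that variable. In proper time
  \<psi> need not be the coordinate itself, so only its independence of the spatial coordinates is
  recorded.\<close>

locale cosmic_chart = recurrent_chart G U a b s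
  for G :: "real^('m::finite option) \<Rightarrow> real^('m option)^('m option)" and U a b s +
  fixes I :: "real set" and V :: "(real^'m) set"
  assumes U: "U = {x. x $ None \<in> I \<and> spatial x \<in> V}"
    and I: "open I" "convex I" "I \<noteq> {}" and V: "open V" "convex V" "V \<noteq> {}"
    and unit: "x \<in> U \<Longrightarrow> G x $ None $ None = - 1"
    and ds: "x \<in> U \<Longrightarrow> partial (Some \<alpha>) s x = 0"
    and pos: "x \<in> U \<Longrightarrow> v \<noteq> 0 \<Longrightarrow> v \<bullet> ((\<chi> \<alpha> \<beta>. G x $ Some \<alpha> $ Some \<beta>) *v v) > 0"
begin

lemma join_in: "t \<in> I \<Longrightarrow> y \<in> V \<Longrightarrow> join t y \<in> U"
  by (simp add: U)

lemma diag_pos: "x \<in> U \<Longrightarrow> G x $ Some \<alpha> $ Some \<alpha> > 0"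
  using pos[of x "axis \<alpha> 1"] by (simp add: matrix_vector_mult_basis inner_axis' column_def)

text \<open>The logarithmic time derivative of the spatial metric. The factor in
  \<open>spatial_umbilic\<close> exists only pointwise; reading it off from one diagonal entry, at
  an arbitrary fixed index, shows that it is smooth.\<close>

definition "\<phi> x = partial None (\<lambda>y. G y $ Some undefined $ Some undefined) x / G x $ Some undefined $ Some undefined"

lemma umbilic: "x \<in> U \<Longrightarrow> partial None (\<lambda>y. G y $ Some \<alpha> $ Some \<beta>) x = \<phi> x * G x $ Some \<alpha> $ Some \<beta>"
proof -
  assume x: "x \<in> U"
  obtain r where r: "\<And>\<alpha> \<beta>. partial None (\<lambda>y. G y $ Some \<alpha> $ Some \<beta>) x = r * G x $ Some \<alpha> $ Some \<beta>"
    using spatial_umbilic[OF x] by metis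
  then have "\<phi> x = r" using diag_pos[OF x, of undefined] unfolding \<phi>_def r by simp
  then show ?thesis using r by simp
qed

lemma Ck_\<phi>: "Ck_on k U \<phi>"
  unfolding \<phi>_def[abs_def] using diag_pos by (intro Ck_on_divide Ck_dG Ck_G oU) (auto simp: less_imp_neq[symmetric])

lemma christoffel_time': "x \<in> U \<Longrightarrow> \<Gamma> None (Some \<alpha>) (Some \<beta>) x = \<phi> x * G x $ Some \<alpha> $ Some \<beta> / 2"
    "x \<in> U \<Longrightarrow> \<Gamma> None (Some \<alpha>) None x = 0"
proof -
  show "x \<in> U \<Longrightarrow> \<Gamma> None (Some \<alpha>) (Some \<beta>) x = \<phi> x * G x $ Some \<alpha> $ Some \<beta> / 2"
    by (simp add: christoffel_time umbilic unit)
  assume x: "x \<in> U"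
  have "partial (Some \<alpha>) (\<lambda>y. G y $ None $ None) x = 0"
    using spatial_umbilic[OF x] by metis
  then show "\<Gamma> None (Some \<alpha>) None x = 0"
    by (simp add: christoffel_sym[OF x, of _ "Some \<alpha>"] christoffel_time(2)[OF x])
qed

lemma \<phi>_spatial: assumes x: "x \<in> U" shows "partial (Some \<alpha>) \<phi> x = 0"
proof -
  let ?g = "\<lambda>\<alpha> \<beta>. G x $ Some \<alpha> $ Some \<beta>"
  have up: "riemann_up G None (Some \<gamma>) (Some \<alpha>) (Some \<beta>) x = 0" for \<alpha> \<beta> \<gamma>
    using curvature_spatial[OF x, of None "Some \<gamma>" \<alpha> \<beta>]
    by (simp add: riemann_def sum_UNIV_option block[OF x] unit[OF x] metric_G_def block'[OF x])
  have dT: "partial (Some \<alpha>) (\<Gamma> None (Some \<beta>) (Some \<gamma>)) x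
      = (\<phi> x * partial (Some \<alpha>) (\<lambda>y. G y $ Some \<beta> $ Some \<gamma>) x + partial (Some \<alpha>) \<phi> x * ?g \<beta> \<gamma>) / 2" for \<alpha> \<beta> \<gamma>
  proof -
    have "partial (Some \<alpha>) (\<Gamma> None (Some \<beta>) (Some \<gamma>)) x = partial (Some \<alpha>) (\<lambda>y. (1/2) * (\<phi> y * G y $ Some \<beta> $ Some \<gamma>)) x"
      by (rule dir_deriv_cong[OF oU x]) (simp add: christoffel_time')
    also have "\<dots> = (1/2) * (\<phi> x * partial (Some \<alpha>) (\<lambda>y. G y $ Some \<beta> $ Some \<gamma>) x + partial (Some \<alpha>) \<phi> x * ?g \<beta> \<gamma>)"
      by (rule dir_deriv_eq)
        (rule has_derivative_mult_right has_derivative_mult Ck_1D[OF Ck_\<phi> x] Ck_1D[OF Ck_G x])+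
    finally show ?thesis by simp
  qed
  have low: "(\<Sum>\<delta>\<in>UNIV. ?g \<alpha> \<delta> * \<Gamma> (Some \<delta>) (Some \<beta>) (Some \<gamma>) x)
      = (partial (Some \<beta>) (\<lambda>y. G y $ Some \<gamma> $ Some \<alpha>) x + partial (Some \<gamma>) (\<lambda>y. G y $ Some \<beta> $ Some \<alpha>) x
          - partial (Some \<alpha>) (\<lambda>y. G y $ Some \<beta> $ Some \<gamma>) x) / 2" for \<alpha> \<beta> \<gamma>
    using lower_christoffel[OF x, of "Some \<alpha>" "Some \<beta>" "Some \<gamma>"] by (simp add: sum_UNIV_option block'[OF x])
  \<comment> \<open>The Codazzi equation: the curvature component with upper index
    \<open>None\<close> and three spatial ones vanishes, and in an umbilic slice all that remains of
    it is the antisymmetrised product of the gradient of \<open>\<phi>\<close> with the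
    metric.\<close>
  have codazzi: "partial (Some \<alpha>) \<phi> x * ?g \<beta> \<gamma> = partial (Some \<beta>) \<phi> x * ?g \<alpha> \<gamma>" for \<alpha> \<beta> \<gamma>
  proof -
    let ?d = "\<lambda>i \<alpha> \<beta>. partial (Some i) (\<lambda>y. G y $ Some \<alpha> $ Some \<beta>) x"
    have Q: "(\<Sum>\<delta>\<in>UNIV. \<Gamma> None (Some \<alpha>) (Some \<delta>) x * \<Gamma> (Some \<delta>) (Some \<beta>) (Some \<gamma>) x)
        = (\<phi> x / 2) * ((?d \<beta> \<alpha> \<gamma> + ?d \<gamma> \<alpha> \<beta> - ?d \<alpha> \<beta> \<gamma>) / 2)" for \<alpha> \<beta>
    proof -
      have "(\<Sum>\<delta>\<in>UNIV. \<Gamma> None (Some \<alpha>) (Some \<delta>) x * \<Gamma> (Some \<delta>) (Some \<beta>) (Some \<gamma>) x)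
        = (\<phi> x / 2) * (\<Sum>\<delta>\<in>UNIV. ?g \<alpha> \<delta> * \<Gamma> (Some \<delta>) (Some \<beta>) (Some \<gamma>) x)"
        by (simp add: christoffel_time'[OF x] sum_distrib_left mult_ac)
      then show ?thesis
        unfolding low by (simp only: partial_G_sym[OF x, of "Some \<beta>" "Some \<gamma>" "Some \<alpha>"]
            partial_G_sym[OF x, of "Some \<gamma>" "Some \<beta>" "Some \<alpha>"])
    qed
    show ?thesis
      using up[of \<gamma> \<alpha> \<beta>] partial_G_sym[OF x, of "Some \<gamma>" "Some \<beta>" "Some \<alpha>"]
      unfolding riemann_up_def dT sum_UNIV_option sum_subtractf Q christoffel_time'(2)[OF x]
      by (simp add: field_simps)
  qed
  obtain \<beta> where \<beta>: "\<beta> \<noteq> \<alpha>" using ex_third[OF card, of \<alpha> \<alpha>] by blast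
  \<comment> \<open>By \<open>codazzi\<close> this vector is annihilated by the positive definite
    spatial metric, hence zero; its \<beta> component is the derivative in question.\<close>
  define w :: "real^'m" where "w = partial (Some \<alpha>) \<phi> x *\<^sub>R axis \<beta> 1 - partial (Some \<beta>) \<phi> x *\<^sub>R axis \<alpha> 1"
  have "((\<chi> \<alpha> \<beta>. ?g \<alpha> \<beta>) *v w) = 0"
    unfolding w_def
    by (simp add: vec_eq_iff matrix_vector_mult_diff_distrib matrix_vector_mult_scaleR matrix_vector_mult_basis
        column_def codazzi[of \<alpha> \<beta>] symG[OF x, of _ "Some \<alpha>"] symG[OF x, of _ "Some \<beta>"])
  then have "w = 0" using pos[OF x, of w] by auto
  from arg_cong[OF this, of "\<lambda>w. w $ \<beta>"] show ?thesis using \<beta> by (simp add: w_def axis_def)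
qed

lemma \<phi>_time: "t \<in> I \<Longrightarrow> y \<in> V \<Longrightarrow> z \<in> V \<Longrightarrow> \<phi> (join t y) = \<phi> (join t z)"
  by (rule spatially_constant[OF V(2)]) (auto intro!: Ck_1D[OF Ck_\<phi>] \<phi>_spatial join_in)

lemma s_time: "t \<in> I \<Longrightarrow> y \<in> V \<Longrightarrow> z \<in> V \<Longrightarrow> s (join t y) = s (join t z)"
  by (rule spatially_constant[OF V(2)]) (auto intro!: differentiable_has_derivative_dir_deriv s ds join_in)

text \<open>Since \<open>\<phi>\<close> depends on time only, all spatial components at all points
  solve the same linear equation u' = \<phi> u in time. Quotients of solutions are constant, so the
  warping factor is obtained without integrating \<open>\<phi>\<close>.\<close>

lemma warp_ratio:
  assumes "t \<in> I" "t' \<in> I" "y \<in> V" "z \<in> V"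
  shows "G (join t y) $ Some \<alpha> $ Some \<beta> / G (join t z) $ Some \<gamma> $ Some \<gamma> = G (join t' y) $ Some \<alpha> $ Some \<beta> / G (join t' z) $ Some \<gamma> $ Some \<gamma>"
proof -
  have d: "((\<lambda>t. G (join t y) $ i $ j) has_derivative (\<lambda>h. h * partial None (\<lambda>y. G y $ i $ j) (join t y))) (at t within I)"
    if "t \<in> I" "y \<in> V" for t y i j
  proof -
    note D = Ck_1D[OF Ck_G join_in[OF that]]
    show ?thesis
      using has_derivative_compose[OF has_derivative_join_time D]
      by (simp add: linear_scale[OF has_derivative_linear[OF D]])
  qed
  have "((\<lambda>t. G (join t y) $ Some \<alpha> $ Some \<beta> / G (join t z) $ Some \<gamma> $ Some \<gamma>) has_derivative (\<lambda>h. 0)) (at t within I)"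
    if t: "t \<in> I" for t
  proof -
    have nz: "G (join t z) $ Some \<gamma> $ Some \<gamma> \<noteq> 0"
      using diag_pos[OF join_in[OF t assms(4)]] by (simp add: less_imp_neq[symmetric])
    show ?thesis
      using has_derivative_divide'[OF d[OF t assms(3)] d[OF t assms(4)] nz]
      by (rule has_derivative_eq_rhs)
        (simp add: fun_eq_iff umbilic[OF join_in[OF t assms(3)]] umbilic[OF join_in[OF t assms(4)]] \<phi>_time[OF t assms(3,4)])
  qed
  from has_derivative_zero_constant[OF I(2) this] show ?thesis using assms(1,2) by metis
qed

end

section \<open>Intrinsic geometry of the slices of constant time\<close>

context cosmic_chart
begin

definition slice :: "real \<Rightarrow> real^'m \<Rightarrow> real^'m^'m" where
  "slice t y = (\<chi> \<alpha> \<beta>. G (join t y) $ Some \<alpha> $ Some \<beta>)"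

lemma slice_nth: "slice t y $ \<alpha> $ \<beta> = G (join t y) $ Some \<alpha> $ Some \<beta>"
  by (simp add: slice_def)

lemma smooth_slice:
  assumes t: "t \<in> I"
  shows "smooth_on V (slice t)"
  unfolding smooth_on_def
proof (intro allI Ck_on_vec V(1))
  fix k \<alpha> \<beta>
  have "join t ` V \<subseteq> U" using join_in[OF t] by auto
  from Ck_on_compose[OF V(1) oU this Ck_on_join_space[OF V(1)] Ck_G]
  show "Ck_on k V (\<lambda>y. slice t y $ \<alpha> $ \<beta>)" unfolding slice_nth .
qed

lemma riemannian_slice:
  assumes t: "t \<in> I"
  shows "riemannian_metric_on V (slice t)"
  unfolding riemannian_metric_on_def
proof (intro conjI ballI allI impI smooth_slice[OF t])
  fix y assume y: "y \<in> V"
  show "transpose (slice t y) = slice t y"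
    by (simp add: vec_eq_iff transpose_def slice_nth symG[OF join_in[OF t y], of "Some _" "Some _"])
  show "v \<bullet> (slice t y *v v) > 0" if "v \<noteq> 0" for v
    unfolding slice_def by (rule pos[OF join_in[OF t y] that])
qed

lemma partial_slice:
  "t \<in> I \<Longrightarrow> y \<in> V \<Longrightarrow> partial \<gamma> (\<lambda>y. slice t y $ \<alpha> $ \<beta>) y = partial (Some \<gamma>) (\<lambda>x. G x $ Some \<alpha> $ Some \<beta>) (join t y)"
  unfolding slice_nth by (rule partial_join[OF Ck_1D[OF Ck_G join_in]])

lemma inverse_space_time: "x \<in> U \<Longrightarrow> matrix_inv (G x) $ Some \<alpha> $ None = 0"
proof -
  assume x: "x \<in> U"
  have "(matrix_inv (G x) ** G x) $ Some \<alpha> $ None = - matrix_inv (G x) $ Some \<alpha> $ None"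
    by (simp add: matrix_matrix_mult_def sum_UNIV_option block'[OF x] unit[OF x])
  then show ?thesis by (simp add: matrix_inv_works[OF inv[OF x]] mat_def)
qed

lemma inverse_slice:
  assumes "t \<in> I" "y \<in> V"
  shows "matrix_inv (slice t y) $ \<alpha> $ \<beta> = matrix_inv (G (join t y)) $ Some \<alpha> $ Some \<beta>"
proof -
  let ?x = "join t y"
  have x: "?x \<in> U" by (rule join_in[OF assms])
  define B where "B = (\<chi> \<alpha> \<beta>. matrix_inv (G ?x) $ Some \<alpha> $ Some \<beta>)"
  have "(slice t y ** B) $ i $ j = (G ?x ** matrix_inv (G ?x)) $ Some i $ Some j" for i j
    by (simp add: matrix_matrix_mult_def sum_UNIV_option block'[OF x] slice_nth B_def)
  then have B: "slice t y ** B = mat 1"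
    by (simp add: vec_eq_iff matrix_inv_works[OF inv[OF x]] mat_def)
  have i: "invertible (slice t y)"
    unfolding slice_def by (rule spaceinv[OF x])
  have "B = matrix_inv (slice t y) ** (slice t y ** B)"
    by (simp add: matrix_mul_assoc matrix_inv_works[OF i])
  then have "B = matrix_inv (slice t y)" unfolding B by simp
  then show ?thesis by (simp add: B_def vec_eq_iff)
qed

lemma christoffel_slice:
  assumes "t \<in> I" "y \<in> V"
  shows "christoffel (slice t) \<epsilon> \<delta> \<beta> y = \<Gamma> (Some \<epsilon>) (Some \<delta>) (Some \<beta>) (join t y)"
  by (simp add: christoffel_def sum_UNIV_option inverse_space_time[OF join_in[OF assms]]
      partial_slice[OF assms] inverse_slice[OF assms])

text \<open>The shape operator of an umbilic slice, a multiple of the identity.\<close>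

lemma christoffel_mixed:
  assumes x: "x \<in> U"
  shows "\<Gamma> (Some \<epsilon>) (Some \<gamma>) None x = (if \<epsilon> = \<gamma> then \<phi> x / 2 else 0)"
proof -
  have "(matrix_inv (G x) ** G x) $ Some \<epsilon> $ Some \<gamma> = (\<Sum>\<zeta>\<in>UNIV. matrix_inv (G x) $ Some \<epsilon> $ Some \<zeta> * G x $ Some \<gamma> $ Some \<zeta>)"
    by (simp add: matrix_matrix_mult_def sum_UNIV_option block[OF x] symG[OF x, of "Some _" "Some \<gamma>"])
  then have "(\<Sum>\<zeta>\<in>UNIV. matrix_inv (G x) $ Some \<epsilon> $ Some \<zeta> * G x $ Some \<gamma> $ Some \<zeta>) = (if \<epsilon> = \<gamma> then 1 else 0)"
    unfolding matrix_inv_works[OF inv[OF x]] by (simp add: mat_def)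
  moreover have "\<Gamma> (Some \<epsilon>) (Some \<gamma>) None x
      = \<phi> x * (\<Sum>\<zeta>\<in>UNIV. matrix_inv (G x) $ Some \<epsilon> $ Some \<zeta> * G x $ Some \<gamma> $ Some \<zeta>) / 2"
    by (simp add: christoffel_def sum_UNIV_option inverse_space_time[OF x] partial_block[OF x]
        umbilic[OF x] sum_distrib_left mult_ac)
  ultimately show ?thesis by (cases "\<epsilon> = \<gamma>") simp_all
qed

text \<open>The Gauss equation with second fundamental form \<phi> g / 2. The normal is time-like,
  which is why the quadratic term increases the factor \<open>s\<close> instead of lowering
  it.\<close>

lemma riemann_slice:
  assumes "t \<in> I" "y \<in> V"
  shows "riemann (slice t) \<alpha> \<beta> \<gamma> \<delta> y = (s (join t y) + (\<phi> (join t y))\<^sup>2 / 4) * metric_G (slice t) \<alpha> \<beta> \<gamma> \<delta> y"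
proof -
  let ?x = "join t y"
  have x: "?x \<in> U" by (rule join_in[OF assms])
  have d: "partial \<gamma> (christoffel (slice t) \<epsilon> \<delta> \<beta>) y = partial (Some \<gamma>) (\<Gamma> (Some \<epsilon>) (Some \<delta>) (Some \<beta>)) ?x" for \<gamma> \<epsilon> \<delta> \<beta>
  proof -
    have "partial \<gamma> (christoffel (slice t) \<epsilon> \<delta> \<beta>) y = partial \<gamma> (\<lambda>y. \<Gamma> (Some \<epsilon>) (Some \<delta>) (Some \<beta>) (join t y)) y"
      by (rule dir_deriv_cong[OF V(1) assms(2)]) (rule christoffel_slice[OF assms(1)])
    also have "\<dots> = partial (Some \<gamma>) (\<Gamma> (Some \<epsilon>) (Some \<delta>) (Some \<beta>)) ?x"
      by (rule partial_join[OF Ck_1D[OF Ck_christoffel x]])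
    finally show ?thesis .
  qed
  \<comment> \<open>The summand \<open>q = None\<close> in the curvature formula is the only
    difference between the ambient and the slice curvature.\<close>
  have up: "riemann_up G (Some \<epsilon>) (Some \<beta>) (Some \<gamma>) (Some \<delta>) ?x = riemann_up (slice t) \<epsilon> \<beta> \<gamma> \<delta> y
      + (\<phi> ?x)\<^sup>2 / 4 * ((if \<epsilon> = \<gamma> then slice t y $ \<delta> $ \<beta> else 0) - (if \<epsilon> = \<delta> then slice t y $ \<gamma> $ \<beta> else 0))" for \<epsilon>
    unfolding riemann_up_def d sum_UNIV_option christoffel_slice[OF assms] christoffel_mixed[OF x]
      christoffel_time'(1)[OF x] slice_nth
    by (simp add: power2_eq_square algebra_simps)
  have "riemann G (Some \<alpha>) (Some \<beta>) (Some \<gamma>) (Some \<delta>) ?x = (\<Sum>\<epsilon>\<in>UNIV. slice t y $ \<alpha> $ \<epsilon> * riemann_up G (Some \<epsilon>) (Some \<beta>) (Some \<gamma>) (Some \<delta>) ?x)"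
    by (simp add: riemann_def sum_UNIV_option block'[OF x] slice_nth)
  also have "\<dots> = riemann (slice t) \<alpha> \<beta> \<gamma> \<delta> y + (\<phi> ?x)\<^sup>2 / 4 *
      (slice t y $ \<alpha> $ \<gamma> * slice t y $ \<delta> $ \<beta> - slice t y $ \<alpha> $ \<delta> * slice t y $ \<gamma> $ \<beta>)"
  proof -
    have *: "(\<Sum>\<epsilon>\<in>UNIV. slice t y $ \<alpha> $ \<epsilon> * (R \<epsilon> + r * ((if \<epsilon> = \<gamma> then p else 0) - (if \<epsilon> = \<delta> then q else 0))))
        = (\<Sum>\<epsilon>\<in>UNIV. slice t y $ \<alpha> $ \<epsilon> * R \<epsilon>) + r * (slice t y $ \<alpha> $ \<gamma> * p - slice t y $ \<alpha> $ \<delta> * q)" for R and r p q :: real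
      by (simp add: distrib_left right_diff_distrib sum.distrib sum_subtractf if_distrib[of "\<lambda>a. _ * a"] mult_ac cong: if_cong)
    show ?thesis unfolding up * riemann_def ..
  qed
  finally show ?thesis
    using curvature_spatial[OF x, of "Some \<alpha>" "Some \<beta>" \<gamma> \<delta>] symG[OF x, of "Some \<alpha>" "Some \<gamma>"]
      symG[OF x, of "Some \<alpha>" "Some \<delta>"] symG[OF x, of "Some \<beta>" "Some \<gamma>"] symG[OF x, of "Some \<beta>" "Some \<delta>"]
    by (simp add: metric_G_def slice_nth algebra_simps)
qed

lemma constant_curvature_slice:
  assumes t: "t \<in> I"
  shows "constant_sectional_curvature_on V (slice t)"
proof -
  obtain z where z: "z \<in> V" using V(3) by blast
  let ?\<kappa> = "s (join t z) + (\<phi> (join t z))\<^sup>2 / 4"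
  have "sectional_curvature (slice t) y u v = - ?\<kappa>" if "y \<in> V" "u \<noteq> v" "independent {u, v}" for y u v
  proof (rule constant_curvature_sectional[OF _ _ _ that(2,3)])
    show "riemann (slice t) j k l m y = ?\<kappa> * metric_G (slice t) j k l m y" for j k l m
      using riemann_slice[OF t that(1)] s_time[OF t that(1) z] \<phi>_time[OF t that(1) z] by simp
  qed (use riemannian_slice[OF t] that(1) in \<open>auto simp: riemannian_metric_on_def\<close>)
  then show ?thesis
    unfolding constant_sectional_curvature_on_def by blast
qed

theorem robertson_walker_form:
  obtains q h where "smooth_on I q" "\<And>t. t \<in> I \<Longrightarrow> q t > 0" "riemannian_metric_on V h"
    "\<And>x \<alpha> \<beta>. x \<in> U \<Longrightarrow> G x $ Some \<alpha> $ Some \<beta> = (q (x $ None))\<^sup>2 * h (spatial x) $ \<alpha> $ \<beta>"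
    "constant_sectional_curvature_on V h"
proof -
  obtain t0 z where t0: "t0 \<in> I" and z: "z \<in> V" using I(3) V(3) by blast
  let ?\<gamma> = "Some (undefined :: 'm)"
  \<comment> \<open>The squared warping factor relative to the slice at \<open>t0\<close>, which
    serves as the fibre metric. By \<open>warp_ratio\<close> the quotient measured at the one point
    \<open>z\<close> is valid at all points of \<open>V\<close>.\<close>
  define r where "r t = G (join t z) $ ?\<gamma> $ ?\<gamma> / G (join t0 z) $ ?\<gamma> $ ?\<gamma>" for t
  have nz: "G (join t z) $ ?\<gamma> $ ?\<gamma> > 0" if "t \<in> I" for t
    using diag_pos[OF join_in[OF that z]] .
  have rpos: "r t > 0" if "t \<in> I" for t
    using nz[OF that] nz[OF t0] by (simp add: r_def)
  have "Ck_on k I r" for k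
  proof -
    have "(\<lambda>t. join t z) ` I \<subseteq> U" using join_in[OF _ z] by auto
    from Ck_on_compose[OF I(1) oU this Ck_on_join_time[OF I(1)] Ck_G]
    have "Ck_on k I (\<lambda>t. G (join t z) $ ?\<gamma> $ ?\<gamma>)" .
    then show ?thesis
      unfolding r_def[abs_def] using nz[OF t0] by (intro Ck_on_divide I(1) Ck_on_const) auto
  qed
  then have sm: "smooth_on I (\<lambda>t. sqrt (r t))"
    unfolding smooth_on_def using rpos by (intro allI Ck_on_sqrt I(1))
  show ?thesis
  proof (rule that[OF sm _ riemannian_slice[OF t0] _ constant_curvature_slice[OF t0]])
    show "sqrt (r t) > 0" if "t \<in> I" for t using rpos[OF that] by simp
    fix x \<alpha> \<beta> assume "x \<in> U"
    then have t: "x $ None \<in> I" and y: "spatial x \<in> V" by (auto simp: U)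
    have "G (join (x $ None) (spatial x)) $ Some \<alpha> $ Some \<beta> = r (x $ None) * G (join t0 (spatial x)) $ Some \<alpha> $ Some \<beta>"
      using warp_ratio[OF t t0 y z, of \<alpha> \<beta> undefined] nz[OF t] nz[OF t0] by (simp add: r_def field_simps)
    then show "G x $ Some \<alpha> $ Some \<beta> = (sqrt (r (x $ None)))\<^sup>2 * slice t0 (spatial x) $ \<alpha> $ \<beta>"
      using rpos[OF t] by (simp add: slice_nth)
  qed
qed

end

section \<open>Coordinates adapted to the associated covector\<close>

text \<open>The reversed Cauchy-Schwarz argument. In a frame that diagonalises the form,
  orthogonality equates the spatial inner product of the two vectors with the product of their time
  components; if \<open>w\<close> were not space-like, Cauchy-Schwarz and the time-like
  \<open>v\<close> would contradict this.\<close>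

lemma lorentz_orthogonal_positive:
  fixes M :: "real^'n::finite^'n"
  assumes "lorentz_signature M" "v \<bullet> (M *v v) < 0" "v \<bullet> (M *v w) = 0" "w \<noteq> 0"
  shows "w \<bullet> (M *v w) > 0"
proof -
  obtain P :: "real^'n^'n" and t where P: "invertible P"
    "transpose P ** M ** P = (\<chi> i j. if i = j then (if i = t then - 1 else 1) else 0)"
    using assms(1) unfolding lorentz_signature_def by blast
  define a b where "a = matrix_inv P *v v" and "b = matrix_inv P *v w"
  have ab: "v = P *v a" "w = P *v b"
    by (simp_all add: a_def b_def matrix_vector_mul_assoc matrix_inv_works[OF P(1)])
  define r where "r c = (\<chi> i. if i = t then 0 else c $ i)" for c :: "real^'n"
  have form: "(P *v c) \<bullet> (M *v (P *v d)) = r c \<bullet> r d - c $ t * d $ t" for c d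
  proof -
    have "(P *v c) \<bullet> (M *v (P *v d)) = (c v* transpose P) \<bullet> (M *v (P *v d))"
      by (simp only: vector_transpose_matrix)
    also have "\<dots> = c \<bullet> (transpose P *v (M *v (P *v d)))" by (rule dot_lmul_matrix)
    also have "\<dots> = c \<bullet> ((transpose P ** M ** P) *v d)" by (simp only: matrix_vector_mul_assoc matrix_mul_assoc)
    also have "\<dots> = (\<Sum>i\<in>UNIV. c $ i * ((if i = t then - 1 else 1) * d $ i))"
      unfolding P(2) by (simp add: inner_vec_def matrix_vector_mult_def if_distrib[of "\<lambda>a. a * _"] cong: if_cong)
    also have "\<dots> = (\<Sum>i\<in>UNIV. r c $ i * r d $ i - (if i = t then c $ i * d $ i else 0))"
      by (intro sum.cong) (auto simp: r_def)
    also have "\<dots> = r c \<bullet> r d - c $ t * d $ t"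
      by (simp add: sum_subtractf inner_vec_def)
    finally show ?thesis .
  qed
  have 1: "r a \<bullet> r a < (a $ t)\<^sup>2" and 2: "r a \<bullet> r b = a $ t * b $ t"
    using assms(2,3) unfolding ab form by (simp_all add: power2_eq_square)
  have "b \<noteq> 0" using assms(4) ab(2) by auto
  have "(b $ t)\<^sup>2 < r b \<bullet> r b"
  proof (rule ccontr)
    assume n: "\<not> (b $ t)\<^sup>2 < r b \<bullet> r b"
    have bt: "b $ t \<noteq> 0"
    proof
      assume "b $ t = 0"
      then have "r b \<bullet> r b \<le> 0" using n by simp
      then have rb0: "r b = 0" using inner_gt_zero_iff[of "r b"] not_less by blast
      have "b $ i = 0" for i
      proof -
        have "r b $ i = 0" using rb0 by simp
        then show ?thesis using \<open>b $ t = 0\<close> by (cases "i = t") (simp_all add: r_def)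
      qed
      then show False using \<open>b \<noteq> 0\<close> by (simp add: vec_eq_iff)
    qed
    have "(a $ t * b $ t)\<^sup>2 \<le> (r a \<bullet> r a) * (r b \<bullet> r b)"
      using Cauchy_Schwarz_ineq[of "r a" "r b"] unfolding 2 by simp
    also have "\<dots> \<le> (r a \<bullet> r a) * (b $ t)\<^sup>2"
      using n by (intro mult_left_mono) (auto simp: inner_ge_zero)
    also have "\<dots> < (a $ t)\<^sup>2 * (b $ t)\<^sup>2"
      using 1 bt by (intro mult_strict_right_mono) auto
    finally show False by (simp add: power_mult_distrib)
  qed
  then show ?thesis unfolding ab(2) form by (simp add: power2_eq_square)
qed

lemma spatial_0: "spatial 0 = 0"
  by (simp add: spatial_def vec_eq_iff)

lemma join_0_inner: "join 0 u \<bullet> (M *v join 0 w) = u \<bullet> ((\<chi> \<alpha> \<beta>. M $ Some \<alpha> $ Some \<beta>) *v w)"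
  by (simp add: inner_vec_def matrix_vector_mult_def sum_UNIV_option)

locale extended_recurrent_spacetime =
  fixes X :: "'a topology" and \<A> :: "('a, 'm::finite option) chart set"
    and g :: "('a, 'm option) bilinear_field" and A :: "('a, 'm option) covector_field"
    and \<beta> \<psi> :: "'a \<Rightarrow> real"
  assumes card: "CARD('m) \<ge> 3" and L: "lorentzian X \<A> g" and T: "timelike \<A> g A"
    and sm\<psi>: "smooth_function \<A> \<psi>" and \<beta>0: "p \<in> topspace X \<Longrightarrow> \<beta> p \<noteq> 0"
    and d\<psi>: "c \<in> \<A> \<Longrightarrow> x \<in> chart_image c \<Longrightarrow> partial j (\<psi> \<circ> chart_inv c) x = \<beta> (chart_inv c x) * A c x $ j"
    and rec: "c \<in> \<A> \<Longrightarrow> x \<in> chart_image c \<Longrightarrow> cov_deriv4 (g c) (riemann (g c)) i j k l m x =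
                A c x $ i * riemann (g c) j k l m x
                + (\<beta> (chart_inv c x) - \<psi> (chart_inv c x)) * A c x $ i * metric_G (g c) j k l m x
                + \<beta> (chart_inv c x) / 2 * (A c x $ j * metric_G (g c) i k l m x + A c x $ k * metric_G (g c) j i l m x
                           + A c x $ l * metric_G (g c) j k i m x + A c x $ m * metric_G (g c) j k l i x)"
begin

lemma M: "smooth_manifold X \<A>" and bil: "bilinear_tensor \<A> g"
  using L unfolding lorentzian_def pseudo_riemannian_def by blast+

lemma chart: "c \<in> \<A> \<Longrightarrow> is_chart X c"
  using M unfolding smooth_manifold_def by blast

lemma chart_open: "c \<in> \<A> \<Longrightarrow> open (chart_image c)"
  using chart unfolding is_chart_def by blast

lemma metric_chart: "c \<in> \<A> \<Longrightarrow> metric_chart (g c) (chart_image c)"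
proof
  assume c: "c \<in> \<A>"
  show "open (chart_image c)" by (rule chart_open[OF c])
  show "smooth_on (chart_image c) (g c)" using bil c unfolding bilinear_tensor_def by blast
  show "transpose (g c x) = g c x" "invertible (g c x)" if "x \<in> chart_image c" for x
    using L c that unfolding lorentzian_def pseudo_riemannian_def by blast+
qed

lemma \<beta>_nonzero: "c \<in> \<A> \<Longrightarrow> x \<in> chart_image c \<Longrightarrow> \<beta> (chart_inv c x) \<noteq> 0"
proof -
  assume c: "c \<in> \<A>" and x: "x \<in> chart_image c"
  have "openin X (fst c)" using chart[OF c] by (simp add: is_chart_def)
  then show ?thesis
    using \<beta>0 chart_facts(3)[OF chart[OF c] x] openin_subset by blast
qed

text \<open>As d\<psi> = \<beta> A with \<beta> nonzero, A has only a time component when \<psi> is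
  independent of the spatial coordinates. Then A^2 is the square of that component times the inverse
  metric entry, and its negativity yields both remaining claims.\<close>

lemma covector_time:
  assumes "c \<in> \<A>" "x \<in> chart_image c" "\<And>\<alpha>. partial (Some \<alpha>) (\<psi> \<circ> chart_inv c) x = 0"
  shows "A c x $ Some \<alpha> = 0" "A c x $ None \<noteq> 0" "matrix_inv (g c x) $ None $ None < 0"
proof -
  have a: "A c x $ Some \<alpha> = 0" for \<alpha>
    using assms(3) d\<psi>[OF assms(1,2), of "Some \<alpha>"] \<beta>_nonzero[OF assms(1,2)] by simp
  then show "A c x $ Some \<alpha> = 0" .
  have "A c x \<bullet> (matrix_inv (g c x) *v A c x) < 0"
    using T assms(1,2) by (simp add: timelike_def)
  then have "A c x $ None * (matrix_inv (g c x) $ None $ None * A c x $ None) < 0"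
    by (simp add: inner_vec_def matrix_vector_mult_def sum_UNIV_option a)
  then show "A c x $ None \<noteq> 0" "matrix_inv (g c x) $ None $ None < 0"
    by (auto simp: mult_less_0_iff zero_less_mult_iff)
qed

lemma space_positive:
  assumes "c \<in> \<A>" "x \<in> chart_image c" "\<And>\<alpha>. g c x $ None $ Some \<alpha> = 0" "g c x $ None $ None < 0" "w \<noteq> 0"
  shows "w \<bullet> ((\<chi> \<alpha> \<beta>. g c x $ Some \<alpha> $ Some \<beta>) *v w) > 0"
proof -
  have "join 0 w \<bullet> (g c x *v join 0 w) > 0"
  proof (rule lorentz_orthogonal_positive)
    show "lorentz_signature (g c x)" using L assms(1,2) by (simp add: lorentzian_def)
    show "axis None 1 \<bullet> (g c x *v axis None 1) < 0"
      using assms(4) by (simp add: matrix_vector_mult_basis inner_axis' column_def)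
    show "axis None 1 \<bullet> (g c x *v join 0 w) = 0"
      using assms(3) by (simp add: inner_axis' matrix_vector_mult_def sum_UNIV_option)
    show "join 0 w \<noteq> 0"
    proof
      assume "join 0 w = 0"
      from arg_cong[OF this, of spatial] show False using assms(5) by (simp add: spatial_0)
    qed
  qed
  then show ?thesis by (simp add: join_0_inner)
qed

text \<open>\<psi> is only required not to depend on the spatial coordinates. This covers both the
  chart in which \<psi> is the time coordinate and the later one in proper time.\<close>

lemma recurrent_chart:
  assumes c: "c \<in> \<A>" and d: "\<And>x \<alpha>. x \<in> chart_image c \<Longrightarrow> partial (Some \<alpha>) (\<psi> \<circ> chart_inv c) x = 0"
    and blk: "\<And>x \<alpha>. x \<in> chart_image c \<Longrightarrow> g c x $ None $ Some \<alpha> = 0"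
    and neg: "\<And>x. x \<in> chart_image c \<Longrightarrow> g c x $ None $ None < 0"
  shows "recurrent_chart (g c) (chart_image c) (A c) (\<lambda>x. \<beta> (chart_inv c x)) (\<lambda>x. \<psi> (chart_inv c x))"
proof (rule recurrent_chart.intro[OF metric_chart[OF c]], unfold_locales)
  show "invertible (\<chi> \<alpha> \<beta>. g c x $ Some \<alpha> $ Some \<beta>)" if x: "x \<in> chart_image c" for x
  proof -
    have "(\<chi> \<alpha> \<beta>. g c x $ Some \<alpha> $ Some \<beta>) *v w = 0 \<Longrightarrow> w = 0" for w
      using space_positive[OF c x blk[OF x] neg[OF x], of w] by fastforce
    then show ?thesis by (simp add: invertible_left_inverse matrix_left_invertible_ker)
  qed
  show "(\<lambda>x. \<psi> (chart_inv c x)) differentiable (at x)" if x: "x \<in> chart_image c" for x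
  proof -
    have "smooth_on (chart_image c) (\<psi> \<circ> chart_inv c)" using sm\<psi> c by (simp add: smooth_function_def)
    from smooth_on_derivative[OF this x] show ?thesis
      unfolding differentiable_def comp_def by blast
  qed
qed (use card blk neg \<beta>_nonzero[OF c] covector_time[OF c _ d] rec[OF c] in auto)

section \<open>Straightening the time function and its gradient\<close>

lemma time_coordinate:
  assumes c: "c \<in> \<A>" and \<psi>: "\<And>y. y \<in> chart_image c \<Longrightarrow> \<psi> (chart_inv c y) = y $ None"
    and x: "x \<in> chart_image c"
  shows "partial (Some \<alpha>) (\<psi> \<circ> chart_inv c) x = 0"
proof -
  have "partial (Some \<alpha>) (\<psi> \<circ> chart_inv c) x = partial (Some \<alpha>) (\<lambda>x. x $ None) x"
    by (rule dir_deriv_cong[OF chart_open[OF c] x]) (simp add: \<psi>)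
  then show ?thesis by (simp add: dir_deriv_component axis_def)
qed

text \<open>A time-like covector is nonzero, so some partial derivative of \<psi> is nonzero and
  \<psi> can replace the corresponding coordinate.\<close>

lemma straighten_time:
  assumes c: "c \<in> \<A>" and p: "p \<in> fst c"
  obtains c1 where "c1 \<in> \<A>" "p \<in> fst c1" "\<And>y. y \<in> chart_image c1 \<Longrightarrow> \<psi> (chart_inv c1 y) = y $ None"
proof -
  define f where "f = \<psi> \<circ> chart_inv c"
  let ?U = "chart_image c" and ?x0 = "snd c p"
  have x0: "?x0 \<in> ?U" using chart_facts(2)[OF chart[OF c] p] .
  have smf: "smooth_on ?U f" using sm\<psi> c by (simp add: smooth_function_def f_def)
  have "A c ?x0 \<noteq> 0" using T c x0 by (force simp: timelike_def)
  then obtain k where k: "A c ?x0 $ k \<noteq> 0" by (auto simp: vec_eq_iff)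
  then have fk: "partial k f ?x0 \<noteq> 0"
    using d\<psi>[OF c x0, of k] \<beta>_nonzero[OF c x0] by (simp add: f_def)
  \<comment> \<open>The coordinate \<open>k\<close> is moved to the position \<open>None\<close>,
    where \<open>f\<close> overwrites it; for \<open>k = None\<close> nothing is moved.\<close>
  define \<pi> where "\<pi> = Transposition.transpose None k"
  define \<theta> where "\<theta> x = (\<chi> i. if i = None then f x else x $ \<pi> i)" for x :: "real^('m option)"
  have \<theta>i: "\<theta> x $ i = (if i = None then f x else x $ \<pi> i)" for x i by (simp add: \<theta>_def)
  have sm\<theta>: "smooth_on ?U \<theta>"
    unfolding smooth_on_def
  proof (intro allI Ck_on_vec chart_open[OF c])
    show "Ck_on n ?U (\<lambda>x. \<theta> x $ i)" for n i
      using smf unfolding \<theta>i smooth_on_def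
      by (cases "i = None") (auto intro: Ck_on_linear[OF bounded_linear_vec_nth chart_open[OF c]])
  qed
  have D: "(\<theta> has_derivative (\<lambda>v. \<chi> i. if i = None then dir_deriv v f ?x0 else v $ \<pi> i)) (at ?x0)"
  proof (rule has_derivative_vec)
    fix i
    show "((\<lambda>x. \<theta> x $ i) has_derivative (\<lambda>v. (\<chi> i. if i = None then dir_deriv v f ?x0 else v $ \<pi> i) $ i)) (at ?x0)"
      using smooth_on_derivative[OF smf x0] bounded_linear_imp_has_derivative[OF bounded_linear_vec_nth]
      unfolding \<theta>i by (cases "i = None") auto
  qed
  have inj: "v = 0" if "dir_deriv v \<theta> ?x0 = 0" for v
  proof -
    have 0: "(if i = None then dir_deriv v f ?x0 else v $ \<pi> i) = 0" for i
      using arg_cong[OF that, of "\<lambda>w. w $ i"] unfolding dir_deriv_eq[OF D] by simp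
    have j: "v $ j = 0" if "j \<noteq> k" for j
    proof -
      have "\<pi> j \<noteq> None" "\<pi> (\<pi> j) = j"
        using that by (cases j; cases k; auto simp: \<pi>_def Transposition.transpose_def split: if_splits)+
      then show ?thesis using 0[of "\<pi> j"] by metis
    qed
    have "v = v $ k *\<^sub>R axis k 1" using j by (auto simp: vec_eq_iff axis_def)
    moreover have "dir_deriv v f ?x0 = 0" using 0[of None] by simp
    ultimately have "v $ k * partial k f ?x0 = 0"
      using linear_scale[OF has_derivative_linear[OF smooth_on_derivative[OF smf x0]], of "v $ k" "axis k 1"]
      by simp
    then have "v $ k = 0" using fk by simp
    then show "v = 0" using j by (metis vec_eq_iff zero_index)
  qed
  obtain W W' \<eta> where W: "open W" "W \<subseteq> ?U" "?x0 \<in> W" "open W'" "homeomorphism W W' \<theta> \<eta>" "smooth_on W' \<eta>"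
  proof (rule smooth_local_inverse[OF chart_open[OF c] sm\<theta> x0])
    show "v = 0" if "dir_deriv v \<theta> ?x0 = 0" for v by (rule inj[OF that])
  qed (rule that)
  interpret cc: chart_change X \<A> c W W' \<theta> \<eta>
    by (rule chart_change.intro[OF M c W(1,2,4,5) smooth_on_subset[OF sm\<theta> W(2)] W(6)])
  show ?thesis
  proof (rule that[OF cc.reparam_in_atlas])
    show "p \<in> fst (reparam_chart c W \<theta>)" using p W(3) by (simp add: reparam_chart_def)
    fix y assume "y \<in> chart_image (reparam_chart c W \<theta>)"
    then have y: "y \<in> W'" by (simp add: cc.chart_image)
    have "\<psi> (chart_inv (reparam_chart c W \<theta>) y) = \<theta> (\<eta> y) $ None"
      by (simp add: cc.chart_inv[OF y] \<theta>i f_def)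
    then show "\<psi> (chart_inv (reparam_chart c W \<theta>) y) = y $ None"
      using cc.hom_facts(4)[OF y] by simp
  qed
qed

text \<open>The flow of the gradient of \<psi>, normalised so that \<psi> grows at unit rate, maps
  level sets of \<psi> to level sets and keeps \<psi> as first coordinate. Lowering the index of the
  gradient gives a multiple of d\<psi>, so the time direction becomes orthogonal to the level
  sets.\<close>

lemma straighten_gradient:
  assumes c: "c \<in> \<A>" and p: "p \<in> fst c" and \<psi>: "\<And>y. y \<in> chart_image c \<Longrightarrow> \<psi> (chart_inv c y) = y $ None"
  obtains c2 where "c2 \<in> \<A>" "p \<in> fst c2" "\<And>y. y \<in> chart_image c2 \<Longrightarrow> \<psi> (chart_inv c2 y) = y $ None"
    "\<And>y \<alpha>. y \<in> chart_image c2 \<Longrightarrow> g c2 y $ None $ Some \<alpha> = 0"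
    "\<And>y. y \<in> chart_image c2 \<Longrightarrow> g c2 y $ None $ None < 0"
proof -
  let ?U = "chart_image c" and ?x0 = "snd c p"
  interpret G: metric_chart "g c" ?U by (rule metric_chart[OF c])
  have x0: "?x0 \<in> ?U" using chart_facts(2)[OF chart[OF c] p] .
  define H where "H x = matrix_inv (g c x)" for x
  have neg: "H x $ None $ None < 0" if x: "x \<in> ?U" for x
  proof -
    have "partial (Some \<alpha>) (\<psi> \<circ> chart_inv c) x = 0" for \<alpha>
      by (rule time_coordinate[OF c _ x]) (rule \<psi>)
    then show ?thesis unfolding H_def by (rule covector_time(3)[OF c x])
  qed
  \<comment> \<open>The gradient of \<psi>, whose components are the column \<open>None\<close> of
    the inverse metric, divided by its own time component.\<close>
  define v where "v x = (\<chi> i. H x $ i $ None / H x $ None $ None)" for x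
  have vN: "v x $ None = 1" if "x \<in> ?U" for x using neg[OF that] by (simp add: v_def)
  have Gv: "(g c x *v v x) = (1 / H x $ None $ None) *\<^sub>R axis None 1" if "x \<in> ?U" for x
  proof -
    have "(g c x *v v x) $ i = (g c x ** H x) $ i $ None / H x $ None $ None" for i
      by (simp add: matrix_vector_mult_def matrix_matrix_mult_def v_def sum_divide_distrib)
    then show ?thesis
      by (simp add: vec_eq_iff H_def matrix_inv_works[OF G.inv[OF that]] mat_def axis_def)
  qed
  have HC: "Ck_on k ?U H" for k
    unfolding H_def[abs_def] using G.smG by (intro Ck_on_matrix_inv G.oU G.inv) (simp_all add: smooth_on_def)
  have smv: "smooth_on ?U v"
    unfolding smooth_on_def
  proof (intro allI Ck_on_vec G.oU)
    show "Ck_on k ?U (\<lambda>x. v x $ i)" for k i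
      using neg by (simp add: v_def) (intro Ck_on_divide Ck_on_component2 HC G.oU, force)
  qed
  obtain \<delta> and F :: "real \<times> (real^('m option)) \<Rightarrow> real^('m option)" where \<delta>: "\<delta> > 0" and smF: "smooth_on (ball (0, ?x0) \<delta>) F"
    and F: "\<And>l. l \<in> ball (0, ?x0) \<delta> \<Longrightarrow> F l \<in> ?U \<and> dir_deriv (1, 0) F l = v (F l)" and F0: "\<And>y. F (0, y) = y"
  proof (rule smooth_flow[OF G.oU x0 smv])
    fix \<delta> and F :: "real \<times> (real^('m option)) \<Rightarrow> real^('m option)"
    assume "\<delta> > 0" "smooth_on (ball (0, ?x0) \<delta>) F"
      "\<And>l. l \<in> ball (0, ?x0) \<delta> \<Longrightarrow> F l \<in> ?U \<and> dir_deriv (1, 0) F l = v (F l)" "\<And>y. F (0, y) = y"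
    then show thesis by (rule that)
  qed
  let ?B = "ball (0::real, ?x0) \<delta>"
  have DF: "(F has_derivative (\<lambda>w. dir_deriv w F l)) (at l)" if "l \<in> ?B" for l
    by (rule smooth_on_derivative[OF smF that])
  have B_iff: "(t, y) \<in> ?B \<longleftrightarrow> norm (t, y - ?x0) < \<delta>" for t y
    by (subst mem_ball, subst dist_commute) (simp add: dist_norm minus_prod_def)
  have FN: "F (t, y) $ None = y $ None + t" if ty: "(t, y) \<in> ?B" for t y
  proof -
    have in_B: "(r * t, y) \<in> ?B" if r: "r \<in> {0..1}" for r
    proof -
      have "norm (r * t, y - ?x0) \<le> norm (t, y - ?x0)"
      proof -
        have "(norm (r * t))\<^sup>2 \<le> (norm t)\<^sup>2"
          using r by (intro power_mono) (auto simp: abs_mult mult_left_le_one_le)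
        then show ?thesis unfolding norm_Pair by simp
      qed
      then show ?thesis using ty unfolding B_iff by linarith
    qed
    have "((\<lambda>r. F (r * t, y) $ None - r * t) has_derivative (\<lambda>h. 0)) (at r within {0..1})" if r: "r \<in> {0..1}" for r
    proof -
      have d: "((\<lambda>r. (r * t, y)) has_derivative (\<lambda>h. (h * t, 0))) (at r within {0..1})"
        by (auto intro!: derivative_eq_intros)
      have "((\<lambda>r. F (r * t, y)) has_derivative (\<lambda>h. dir_deriv (h * t, 0) F (r * t, y))) (at r within {0..1})"
        by (rule has_derivative_compose[OF d DF[OF in_B[OF r]]])
      moreover have "dir_deriv (h * t, 0) F (r * t, y) = (h * t) *\<^sub>R v (F (r * t, y))" for h
        using linear_scale[OF has_derivative_linear[OF DF[OF in_B[OF r]]], of "h * t" "(1, 0)"]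
          F[OF in_B[OF r]] by simp
      ultimately have "((\<lambda>r. F (r * t, y)) has_derivative (\<lambda>h. (h * t) *\<^sub>R v (F (r * t, y)))) (at r within {0..1})"
        by simp
      from bounded_linear.has_derivative[OF bounded_linear_vec_nth this, of None]
      have "((\<lambda>r. F (r * t, y) $ None) has_derivative (\<lambda>h. h * t)) (at r within {0..1})"
        using vN F[OF in_B[OF r]] by simp
      then show ?thesis by (auto intro!: derivative_eq_intros)
    qed
    from has_derivative_zero_constant[OF _ this] obtain C where
      "\<And>r. r \<in> {0..1} \<Longrightarrow> F (r * t, y) $ None - r * t = C" by auto
    from this[of 0] this[of 1] show ?thesis using F0 by simp
  qed
  define \<tau> where "\<tau> = ?x0 $ None"
  \<comment> \<open>From new coordinates \<open>x\<close>, the flow time and the starting point on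
    the level set of \<psi> through the base point. \<open>\<Theta>\<close> thus expresses old
    coordinates by new ones; the change of chart is its local inverse.\<close>
  define l where "l x = (x $ None - \<tau>, join \<tau> (spatial x))" for x :: "real^('m option)"
  define \<Theta> where "\<Theta> x = F (l x)" for x
  define D where "D = l -` ?B"
  have l_eq: "l x = ((0, join \<tau> 0) - (\<tau>, 0)) + (x $ None, join 0 (spatial x))" for x
    using join_add[of \<tau> 0 0 "spatial x"] by (simp add: l_def)
  have linl: "bounded_linear (\<lambda>x :: real^('m option). (x $ None, join 0 (spatial x)))"
    by (intro bounded_linear_Pair bounded_linear_vec_nth bounded_linear_compose[OF bounded_linear_join]
        bounded_linear_spatial)
  have dl: "(l has_derivative (\<lambda>w. (w $ None, join 0 (spatial w)))) (at x)" for x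
    unfolding l_eq[abs_def]
    by (rule has_derivative_eq_rhs[OF
          has_derivative_add[OF has_derivative_const bounded_linear_imp_has_derivative[OF linl]]]) simp
  have Ckl: "Ck_on k S l" if "open S" for k S
    unfolding l_eq[abs_def] using that by (intro Ck_on_add Ck_on_const Ck_on_linear[OF linl])
  have oD: "open D"
    unfolding D_def using Ckl[of UNIV 0] by (intro open_vimage) auto
  have lx0: "l ?x0 = (0, ?x0)" by (simp add: l_def \<tau>_def)
  have x0D: "?x0 \<in> D" using \<delta> by (simp add: D_def lx0)
  have lB: "l ` D \<subseteq> ?B" by (auto simp: D_def)
  have sm\<Theta>: "smooth_on D \<Theta>"
    unfolding \<Theta>_def[abs_def] using Ckl[OF oD] smF by (rule_tac smooth_on_compose[OF oD open_ball lB]) (simp_all add: smooth_on_def)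
  have D\<Theta>: "(\<Theta> has_derivative (\<lambda>w. dir_deriv (w $ None, join 0 (spatial w)) F (l x))) (at x)" if "x \<in> D" for x
    unfolding \<Theta>_def[abs_def] using lB that by (intro has_derivative_compose[OF dl DF]) auto
  have \<Theta>N: "\<Theta> x $ None = x $ None" if "x \<in> D" for x
    using FN[of "x $ None - \<tau>" "join \<tau> (spatial x)"] that by (simp add: \<Theta>_def D_def l_def)
  have spat0: "spatial (axis None 1 :: real^('m option)) = 0" by (simp add: spatial_def axis_def vec_eq_iff)
  have j00: "join 0 0 = (0 :: real^('m option))" using join_scale[of 0 0 0] by simp
  have \<Theta>t: "dir_deriv (axis None 1) \<Theta> x = v (\<Theta> x)" if "x \<in> D" for x
    using F[of "l x"] lB that dir_deriv_eq[OF D\<Theta>[OF that], of "axis None 1"] by (auto simp: spat0 j00 \<Theta>_def)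
  have inj: "w = 0" if "dir_deriv w \<Theta> ?x0 = 0" for w
  proof -
    have x0B: "(0, ?x0) \<in> ?B" using \<delta> by simp
    have lin: "linear (\<lambda>w. dir_deriv w F (0, ?x0))" by (rule has_derivative_linear[OF DF[OF x0B]])
    have "((\<lambda>y. (0::real, y)) has_derivative (\<lambda>u. (0, u))) (at ?x0)"
      by (auto intro!: derivative_eq_intros)
    from has_derivative_compose[OF this DF[OF x0B]]
    have "((\<lambda>y. y) has_derivative (\<lambda>u. dir_deriv (0, u) F (0, ?x0))) (at ?x0)" by (simp add: F0)
    \<comment> \<open>At time 0 the flow is the identity, so the derivative of
      \<open>\<Theta>\<close> at the base point is \<open>v\<close> in the time direction and the
      inclusion in the spatial ones; it is injective because \<open>v\<close> has time component
      1.\<close>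
    then have Fu: "dir_deriv (0, u) F (0, ?x0) = u" for u
      using has_derivative_unique[OF has_derivative_ident] by metis
    have "dir_deriv (w $ None, join 0 (spatial w)) F (0, ?x0)
        = w $ None *\<^sub>R dir_deriv (1, 0) F (0, ?x0) + dir_deriv (0, join 0 (spatial w)) F (0, ?x0)"
      using linear_add[OF lin, of "w $ None *\<^sub>R (1, 0)" "(0, join 0 (spatial w))"] linear_scale[OF lin, of "w $ None" "(1, 0)"]
      by simp
    also have "\<dots> = w $ None *\<^sub>R v ?x0 + join 0 (spatial w)"
      using F[OF x0B] by (simp add: Fu F0)
    finally have e: "w $ None *\<^sub>R v ?x0 + join 0 (spatial w) = 0"
      using that dir_deriv_eq[OF D\<Theta>[OF x0D], of w] by (simp add: lx0)
    from arg_cong[OF e, of "\<lambda>w. w $ None"] have "w $ None = 0" by (simp add: vN[OF x0])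
    moreover from this e have "join 0 (spatial w) = 0" by simp
    from arg_cong[OF this, of spatial] have "spatial w = 0" by (simp add: spatial_0)
    ultimately show "w = 0"
      using join_simps(4)[of w] j00 by simp
  qed
  obtain W' W \<theta> where W: "open W'" "W' \<subseteq> D" "?x0 \<in> W'" "open W" "homeomorphism W' W \<Theta> \<theta>" "smooth_on W \<theta>"
  proof (rule smooth_local_inverse[OF oD sm\<Theta> x0D])
    show "w = 0" if "dir_deriv w \<Theta> ?x0 = 0" for w by (rule inj[OF that])
  qed (rule that)
  have WU: "W \<subseteq> ?U"
  proof
    fix y assume "y \<in> W"
    then have "\<theta> y \<in> W'" "\<Theta> (\<theta> y) = y" using W(5) unfolding homeomorphism_def by blast+
    then show "y \<in> ?U" using F[of "l (\<theta> y)"] lB W(2) unfolding \<Theta>_def by (metis imageI subsetD)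
  qed
  interpret cc: chart_change X \<A> c W W' \<theta> \<Theta>
    by (rule chart_change.intro[OF M c W(4) WU W(1) homeomorphism_symD[OF W(5)] W(6) smooth_on_subset[OF sm\<Theta> W(2)]])
  let ?c = "reparam_chart c W \<theta>"
  show ?thesis
  proof (rule that[OF cc.reparam_in_atlas])
    have "\<Theta> ?x0 = ?x0" by (simp add: \<Theta>_def lx0 F0)
    then have "?x0 \<in> W" using cc.hom_facts(2)[OF W(3)] by simp
    then show "p \<in> fst ?c" using p by (simp add: reparam_chart_def)
    fix y assume "y \<in> chart_image ?c"
    then have y: "y \<in> W'" by (simp add: cc.chart_image)
    then have yD: "y \<in> D" and \<Theta>U: "\<Theta> y \<in> ?U" using W(2) WU cc.hom_facts(2) by auto
    show "\<psi> (chart_inv ?c y) = y $ None"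
      by (simp add: cc.chart_inv[OF y] \<psi>[OF \<Theta>U] \<Theta>N[OF yD])
    have wN: "dir_deriv w \<Theta> y $ None = w $ None" for w
    proof -
      have "((\<lambda>x. \<Theta> x $ None) has_derivative (\<lambda>w. dir_deriv w \<Theta> y $ None)) (at y)"
        by (rule bounded_linear.has_derivative[OF bounded_linear_vec_nth smooth_on_derivative[OF sm\<Theta> yD]])
      from dir_deriv_eq[OF this] have "dir_deriv w \<Theta> y $ None = dir_deriv w (\<lambda>x. \<Theta> x $ None) y" ..
      also have "\<dots> = dir_deriv w (\<lambda>x. x $ None) y" by (rule dir_deriv_cong[OF oD yD \<Theta>N])
      also have "\<dots> = w $ None" by (rule dir_deriv_component)
      finally show ?thesis .
    qed
    have gN: "g ?c y $ None $ j = (1 / H (\<Theta> y) $ None $ None) * axis j (1::real) $ None" for j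
    proof -
      have "g ?c y $ None $ j = v (\<Theta> y) \<bullet> (g c (\<Theta> y) *v dir_deriv (axis j 1) \<Theta> y)"
        unfolding cc.bilinear_reparam[OF bil y] \<Theta>t[OF yD] ..
      also have "\<dots> = (g c (\<Theta> y) *v v (\<Theta> y)) \<bullet> dir_deriv (axis j 1) \<Theta> y"
        using G.sym[OF \<Theta>U] by (metis dot_lmul_matrix vector_transpose_matrix)
      also have "\<dots> = (1 / H (\<Theta> y) $ None $ None) * dir_deriv (axis j 1) \<Theta> y $ None"
        unfolding Gv[OF \<Theta>U] by (simp add: inner_axis')
      finally show ?thesis unfolding wN .
    qed
    show "g ?c y $ None $ Some \<alpha> = 0" for \<alpha> unfolding gN by (simp add: axis_def)
    show "g ?c y $ None $ None < 0" unfolding gN using neg[OF \<Theta>U] by (simp add: axis_def)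
  qed
qed

end

section \<open>Passage to proper time\<close>

lemma join_time: "join r 0 = r *\<^sub>R axis None 1"
  using join_scale[of r 1 0] by (simp add: join_axis)

lemma open_boxE:
  fixes x :: "real^('m::finite option)"
  assumes "open S" "x \<in> S"
  obtains e where "e > 0" "\<And>t y. \<bar>t - x $ None\<bar> < e \<Longrightarrow> dist y (spatial x) < e \<Longrightarrow> join t y \<in> S"
proof -
  have "continuous_on UNIV (\<lambda>p :: real \<times> (real^'m). join (fst p) (snd p))"
    by (subst ext[OF join_split]) (intro continuous_intros bounded_linear.continuous_on[OF bounded_linear_join])
  then have "open ((\<lambda>p. join (fst p) (snd p)) -` S)"
    using assms(1) open_vimage by blast
  moreover have "(x $ None, spatial x) \<in> (\<lambda>p. join (fst p) (snd p)) -` S" using assms(2) by simp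
  ultimately obtain A B where AB: "open A" "open B" "x $ None \<in> A" "spatial x \<in> B"
      "A \<times> B \<subseteq> (\<lambda>p. join (fst p) (snd p)) -` S"
    by (elim open_prod_elim) auto
  obtain e1 where e1: "e1 > 0" "\<And>t. dist t (x $ None) < e1 \<Longrightarrow> t \<in> A"
    using AB(1,3) unfolding open_dist by blast
  obtain e2 where e2: "e2 > 0" "\<And>y. dist y (spatial x) < e2 \<Longrightarrow> y \<in> B"
    using AB(2,4) unfolding open_dist by blast
  show ?thesis
  proof (rule that[of "min e1 e2"])
    show "min e1 e2 > 0" using e1 e2 by simp
    fix t y assume "\<bar>t - x $ None\<bar> < min e1 e2" "dist y (spatial x) < min e1 e2"
    then have "(t, y) \<in> A \<times> B" using e1(2)[of t] e2(2)[of y] by (simp add: dist_real_def)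
    then show "join t y \<in> S" using AB(5) by auto
  qed
qed

text \<open>The radius is halved so that the closed interval of integration lies inside the domain
  of \<open>N\<close>.\<close>

lemma smooth_antiderivative:
  fixes N :: "real \<Rightarrow> real"
  assumes "e > 0" "smooth_on (ball t0 e) N"
  obtains T where "smooth_on (ball t0 (e/2)) T" "\<And>t. t \<in> ball t0 (e/2) \<Longrightarrow> (T has_derivative (\<lambda>h. h * N t)) (at t)"
proof -
  let ?a = "t0 - e/2" and ?b = "t0 + e/2"
  have sub: "{?a..?b} \<subseteq> ball t0 e" "ball t0 (e/2) \<subseteq> ball t0 e"
    using assms(1) by (auto simp: dist_real_def)
  have NC: "Ck_on k (ball t0 e) N" for k using assms(2) by (simp add: smooth_on_def)
  have cont: "continuous_on {?a..?b} N"
    by (rule continuous_on_subset[OF Ck_on_continuous[OF NC] sub(1)])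
  define T where "T t = integral {?a..t} N" for t
  have D: "(T has_derivative (\<lambda>h. h * N t)) (at t)" if t: "t \<in> ball t0 (e/2)" for t
  proof -
    have "t \<in> {?a..?b}" and int: "t \<in> interior {?a..?b}"
    proof -
      have "\<bar>t0 - t\<bar> < e / 2" using t by (simp add: dist_real_def)
      then have "?a < t" "t < ?b" by linarith+
      then show "t \<in> {?a..?b}" "t \<in> interior {?a..?b}" by (simp_all add: interior_atLeastAtMost_real)
    qed
    then have "(T has_vector_derivative N t) (at t within {?a..?b})"
      unfolding T_def using integral_has_vector_derivative[OF cont] by blast
    then show ?thesis
      using at_within_interior[OF int] by (simp add: has_vector_derivative_def)
  qed
  have "Ck_on k (ball t0 (e/2)) T" for k
  proof (cases k)
    case 0
    have "continuous_on (ball t0 (e/2)) T"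
      by (rule has_derivative_continuous_on[OF has_derivative_at_withinI[OF D]])
    then show ?thesis using 0 by simp
  next
    case (Suc j)
    have "Ck_on (Suc j) (ball t0 (e/2)) T"
    proof (rule Ck_on_SucI[OF open_ball D])
      show "Ck_on j (ball t0 (e/2)) (\<lambda>t. v * N t)" for v
        by (intro Ck_on_mult Ck_on_const open_ball Ck_on_subset[OF NC sub(2)])
    qed
    then show ?thesis using Suc by simp
  qed
  then show ?thesis using that[of T] D by (simp add: smooth_on_def)
qed

context extended_recurrent_spacetime
begin

text \<open>By \<open>spatial_umbilic\<close> the lapse is a function of time alone, so its
  primitive is a time coordinate that leaves the metric block diagonal. The curvature equation is
  therefore used once already in the chart that is not yet normalised.\<close>

lemma straighten_proper_time:
  assumes c: "c \<in> \<A>" and p: "p \<in> fst c"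
    and \<psi>: "\<And>y. y \<in> chart_image c \<Longrightarrow> \<psi> (chart_inv c y) = y $ None"
    and blk: "\<And>x \<alpha>. x \<in> chart_image c \<Longrightarrow> g c x $ None $ Some \<alpha> = 0"
    and neg: "\<And>x. x \<in> chart_image c \<Longrightarrow> g c x $ None $ None < 0"
  obtains c' I V where "c' \<in> \<A>" "p \<in> fst c'"
    "chart_image c' = {x. x $ None \<in> I \<and> spatial x \<in> V}" "open I" "convex I" "I \<noteq> {}" "open V" "convex V" "V \<noteq> {}"
    "\<And>x \<alpha>. x \<in> chart_image c' \<Longrightarrow> partial (Some \<alpha>) (\<psi> \<circ> chart_inv c') x = 0"
    "\<And>x \<alpha>. x \<in> chart_image c' \<Longrightarrow> g c' x $ None $ Some \<alpha> = 0"
    "\<And>x. x \<in> chart_image c' \<Longrightarrow> g c' x $ None $ None = - 1"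
proof -
  let ?U = "chart_image c" and ?x0 = "snd c p"
  have oU: "open ?U" by (rule chart_open[OF c])
  have x0: "?x0 \<in> ?U" using chart_facts(2)[OF chart[OF c] p] .
  have d0: "partial (Some \<alpha>) (\<psi> \<circ> chart_inv c) x = 0" if "x \<in> ?U" for x \<alpha>
    by (rule time_coordinate[OF c _ that]) (rule \<psi>)
  interpret G: recurrent_chart "g c" ?U "A c" "\<lambda>x. \<beta> (chart_inv c x)" "\<lambda>x. \<psi> (chart_inv c x)"
    by (rule recurrent_chart[OF c]) (fact d0 blk neg)+
  have dNN: "partial (Some \<alpha>) (\<lambda>y. g c y $ None $ None) x = 0" if "x \<in> ?U" for x \<alpha>
    using G.spatial_umbilic[OF that] by metis
  obtain e where e: "e > 0" "\<And>t y. \<bar>t - ?x0 $ None\<bar> < e \<Longrightarrow> dist y (spatial ?x0) < e \<Longrightarrow> join t y \<in> ?U"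
    using open_boxE[OF oU x0] by blast
  define t0 z where "t0 = ?x0 $ None" and "z = spatial ?x0"
  have box: "join t y \<in> ?U" if "t \<in> ball t0 e" "y \<in> ball z e" for t y
    using e(2)[of t y] that by (simp add: t0_def z_def dist_commute dist_real_def abs_minus_commute)
  have zb: "z \<in> ball z e" using e(1) by simp
  \<comment> \<open>The lapse, measured along the time line through \<open>z\<close>; it has the
    same value on the rest of each slice of the box.\<close>
  define N where "N t = sqrt (- g c (join t z) $ None $ None)" for t
  have NN: "g c (join t y) $ None $ None = - (N t)\<^sup>2" "N t > 0" if ty: "t \<in> ball t0 e" "y \<in> ball z e" for t y
  proof -
    have "g c (join t y) $ None $ None = g c (join t z) $ None $ None"
      using box[OF ty(1)] dNN by (intro spatially_constant[OF convex_ball _ _ ty(2) zb] G.Ck_1D[OF G.Ck_G]) auto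
    then show "g c (join t y) $ None $ None = - (N t)\<^sup>2" "N t > 0"
      using neg[OF box[OF ty(1) zb]] by (simp_all add: N_def)
  qed
  have smN: "smooth_on (ball t0 e) N"
    unfolding smooth_on_def
  proof
    fix k
    have "(\<lambda>t. join t z) ` ball t0 e \<subseteq> ?U" using box zb by auto
    from Ck_on_compose[OF open_ball oU this Ck_on_join_time[OF open_ball] G.Ck_G]
    have "Ck_on k (ball t0 e) (\<lambda>t. g c (join t z) $ None $ None)" .
    then show "Ck_on k (ball t0 e) N"
      unfolding N_def[abs_def] using neg[OF box[OF _ zb]] by (intro Ck_on_sqrt Ck_on_minus open_ball) auto
  qed
  obtain T where T: "smooth_on (ball t0 (e/2)) T" "\<And>t. t \<in> ball t0 (e/2) \<Longrightarrow> (T has_derivative (\<lambda>h. h * N t)) (at t)"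
    using smooth_antiderivative[OF e(1) smN] by metis
  define D where "D = {x :: real^('m option). x $ None \<in> ball t0 (e/2) \<and> spatial x \<in> ball z e}"
  define \<theta> where "\<theta> x = join (T (x $ None)) (spatial x)" for x :: "real^('m option)"
  have oD: "open D"
    unfolding D_def by (intro open_cylinder open_ball)
  have DU: "x \<in> ?U" and DN: "g c x $ None $ None = - (N (x $ None))\<^sup>2" "N (x $ None) > 0" if "x \<in> D" for x
  proof -
    have x: "x $ None \<in> ball t0 e" "spatial x \<in> ball z e" using that e(1) by (auto simp: D_def)
    show "x \<in> ?U" using box[OF x] by simp
    show "g c x $ None $ None = - (N (x $ None))\<^sup>2" "N (x $ None) > 0" using NN[OF x] by simp_all
  qed
  have x0D: "?x0 \<in> D" using e(1) by (simp add: D_def t0_def z_def)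
  have sm\<theta>: "smooth_on D \<theta>"
    unfolding smooth_on_def
  proof (intro allI Ck_on_vec oD)
    fix k i
    show "Ck_on k D (\<lambda>x. \<theta> x $ i)"
    proof (cases i)
      case None
      have "(\<lambda>x. x $ None) ` D \<subseteq> ball t0 (e/2)" by (auto simp: D_def)
      then have "Ck_on k D (\<lambda>x. T (x $ None))"
        by (rule Ck_on_compose[OF oD open_ball _ Ck_on_linear[OF bounded_linear_vec_nth oD]])
          (use T(1) in \<open>simp add: smooth_on_def\<close>)
      then show ?thesis by (simp add: None \<theta>_def)
    next
      case (Some \<alpha>)
      then show ?thesis
        using Ck_on_linear[OF bounded_linear_vec_nth oD] by (simp add: \<theta>_def spatial_def)
    qed
  qed
  have D\<theta>: "(\<theta> has_derivative (\<lambda>w. join (w $ None * N (x $ None)) (spatial w))) (at x)" if x: "x \<in> D" for x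
  proof (rule has_derivative_vec)
    fix i
    have "((\<lambda>x. T (x $ None)) has_derivative (\<lambda>w. w $ None * N (x $ None))) (at x)"
      using x by (intro has_derivative_compose[OF bounded_linear_imp_has_derivative[OF bounded_linear_vec_nth] T(2)])
        (simp add: D_def)
    then show "((\<lambda>x. \<theta> x $ i) has_derivative (\<lambda>w. join (w $ None * N (x $ None)) (spatial w) $ i)) (at x)"
      using bounded_linear_imp_has_derivative[OF bounded_linear_vec_nth]
      by (cases i) (simp_all add: \<theta>_def spatial_def)
  qed
  have joinD: "w = 0" if "join (w $ None * N (x $ None)) (spatial w) = 0" "x \<in> D" for w x
  proof -
    have "w $ i = 0" for i
      using arg_cong[OF that(1), of "\<lambda>w. w $ i"] DN(2)[OF that(2)] by (cases i) (simp_all add: spatial_def)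
    then show ?thesis by (simp add: vec_eq_iff)
  qed
  obtain W1 W2 \<eta> where W: "open W1" "W1 \<subseteq> D" "?x0 \<in> W1" "open W2" "homeomorphism W1 W2 \<theta> \<eta>" "smooth_on W2 \<eta>"
  proof (rule smooth_local_inverse[OF oD sm\<theta> x0D])
    show "w = 0" if "dir_deriv w \<theta> ?x0 = 0" for w
      using that joinD[OF _ x0D] unfolding dir_deriv_eq[OF D\<theta>[OF x0D]] by blast
  qed (rule that)
  have hW: "\<theta> x \<in> W2" "\<eta> (\<theta> x) = x" if "x \<in> W1" for x using W(5) that by (auto simp: homeomorphism_def)
  have hW': "\<eta> y \<in> W1" "\<theta> (\<eta> y) = y" if "y \<in> W2" for y using W(5) that by (auto simp: homeomorphism_def)
  obtain r where r: "r > 0" "\<And>t y. \<bar>t - \<theta> ?x0 $ None\<bar> < r \<Longrightarrow> dist y (spatial (\<theta> ?x0)) < r \<Longrightarrow> join t y \<in> W2"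
    using open_boxE[OF W(4) hW(1)[OF W(3)]] by blast
  \<comment> \<open>The image is shrunk to a product box, the shape that \<open>warped_form\<close>
    demands of a chart image; convexity of both factors serves the constancy arguments.\<close>
  define I where "I = ball (\<theta> ?x0 $ None) r"
  define V where "V = ball (spatial (\<theta> ?x0)) r"
  define B where "B = {x :: real^('m option). x $ None \<in> I \<and> spatial x \<in> V}"
  have BW: "B \<subseteq> W2"
  proof
    fix x assume "x \<in> B"
    then have "join (x $ None) (spatial x) \<in> W2"
      by (intro r(2)) (auto simp: B_def I_def V_def dist_real_def dist_commute)
    then show "x \<in> W2" by simp
  qed
  have oB: "open B"
    unfolding B_def I_def V_def by (intro open_cylinder open_ball)
  define W where "W = W1 \<inter> \<theta> -` B"
  have W_open: "open W"
    unfolding W_def using W(1,5) oB by (intro continuous_open_preimage) (auto simp: homeomorphism_def)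
  have hom: "homeomorphism W B \<theta> \<eta>"
  proof (rule homeomorphism_of_subsets[OF W(5)])
    show "W \<subseteq> W1" by (simp add: W_def)
    show "B \<subseteq> W2" by (rule BW)
    show "\<theta> ` W = B"
    proof
      show "B \<subseteq> \<theta> ` W"
      proof
        fix y assume y: "y \<in> B"
        then have "\<eta> y \<in> W" "\<theta> (\<eta> y) = y" using hW'[of y] BW by (auto simp: W_def)
        then show "y \<in> \<theta> ` W" by (metis image_eqI)
      qed
    qed (auto simp: W_def)
  qed
  have WD: "W \<subseteq> D" using W(2) by (auto simp: W_def)
  have WU: "W \<subseteq> ?U" using WD DU by blast
  interpret cc: chart_change X \<A> c W B \<theta> \<eta>
    by (rule chart_change.intro[OF M c W_open WU oB hom smooth_on_subset[OF sm\<theta> WD] smooth_on_subset[OF W(6) BW]])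
  let ?c = "reparam_chart c W \<theta>"
  have D\<eta>: "dir_deriv u \<eta> y = join (u $ None / N (\<eta> y $ None)) (spatial u)" if y: "y \<in> B" for u y
  proof -
    have \<eta>D: "\<eta> y \<in> D" using cc.hom_facts(2)[OF y] WD by blast
    let ?w = "dir_deriv u \<eta> y"
    have "((\<lambda>y. \<theta> (\<eta> y)) has_derivative (\<lambda>u. join (dir_deriv u \<eta> y $ None * N (\<eta> y $ None)) (spatial (dir_deriv u \<eta> y)))) (at y)"
      using y BW by (intro has_derivative_compose[OF smooth_on_derivative[OF W(6)] D\<theta>[OF \<eta>D]]) auto
    from dir_deriv_eq[OF this, of u]
    have "join (?w $ None * N (\<eta> y $ None)) (spatial ?w) = dir_deriv u (\<lambda>y. \<theta> (\<eta> y)) y" ..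
    also have "\<dots> = dir_deriv u (\<lambda>y. y) y"
      by (rule dir_deriv_cong[OF oB y]) (rule cc.hom_facts(4))
    also have "\<dots> = u" by (rule dir_deriv_eq[OF has_derivative_ident])
    finally have eq: "join (?w $ None * N (\<eta> y $ None)) (spatial ?w) = u" .
    have "?w $ None * N (\<eta> y $ None) = u $ None" "spatial ?w = spatial u"
      using arg_cong[OF eq, of "\<lambda>w. w $ None"] arg_cong[OF eq, of spatial] by simp_all
    then have "?w $ None = u $ None / N (\<eta> y $ None)" "spatial ?w = spatial u"
      using DN(2)[OF \<eta>D] by (simp_all add: field_simps)
    then show ?thesis using join_simps(4)[of ?w] by simp
  qed
  show ?thesis
  proof (rule that[OF cc.reparam_in_atlas _ _ , of I V])
    show "p \<in> fst ?c"
    proof -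
      have "\<theta> ?x0 \<in> B" using r(1) by (simp add: B_def I_def V_def)
      then show ?thesis using p W(3) by (simp add: reparam_chart_def W_def)
    qed
    show "chart_image ?c = {x. x $ None \<in> I \<and> spatial x \<in> V}"
      unfolding cc.chart_image B_def ..
    show "open I" "convex I" "I \<noteq> {}" "open V" "convex V" "V \<noteq> {}"
      using r(1) by (simp_all add: I_def V_def)
  next
    fix y \<alpha> assume "y \<in> chart_image ?c"
    then have y: "y \<in> B" by (simp add: cc.chart_image)
    have "((\<lambda>y. \<eta> y $ None) has_derivative (\<lambda>u. dir_deriv u \<eta> y $ None)) (at y)"
      using y BW by (intro bounded_linear.has_derivative[OF bounded_linear_vec_nth smooth_on_derivative[OF W(6)]]) auto
    from dir_deriv_eq[OF this, of "axis (Some \<alpha>) 1"]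
    have "partial (Some \<alpha>) (\<lambda>y. \<eta> y $ None) y = 0" by (simp add: D\<eta>[OF y] axis_def)
    moreover have "partial (Some \<alpha>) (\<psi> \<circ> chart_inv ?c) y = partial (Some \<alpha>) (\<lambda>y. \<eta> y $ None) y"
    proof (rule dir_deriv_cong[OF oB y])
      show "(\<psi> \<circ> chart_inv ?c) y = \<eta> y $ None" if "y \<in> B" for y
      proof -
        have "\<eta> y \<in> ?U" using cc.hom_facts(2)[OF that] WU by blast
        then show ?thesis by (simp add: cc.chart_inv[OF that] \<psi>)
      qed
    qed
    ultimately show "partial (Some \<alpha>) (\<psi> \<circ> chart_inv ?c) y = 0" by simp
  next
    fix y \<alpha> assume "y \<in> chart_image ?c"
    then have y: "y \<in> B" by (simp add: cc.chart_image)
    have \<eta>D: "\<eta> y \<in> D" using cc.hom_facts(2)[OF y] WD by blast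
    note \<eta>U = DU[OF \<eta>D]
    let ?n = "N (\<eta> y $ None)"
    have sp: "spatial (axis None 1 :: real^('m option)) = 0" by (simp add: spatial_def axis_def vec_eq_iff)
    have t: "dir_deriv (axis None 1) \<eta> y = (1 / ?n) *\<^sub>R axis None 1"
      unfolding D\<eta>[OF y] sp join_time by (simp add: axis_def)
    have gN: "g ?c y $ None $ j = (1 / ?n) * ((g c (\<eta> y) *v dir_deriv (axis j 1) \<eta> y) $ None)" for j
      unfolding cc.bilinear_reparam[OF bil y] t by (simp add: inner_axis')
    show "g ?c y $ None $ Some \<alpha> = 0"
      unfolding gN D\<eta>[OF y] by (simp add: matrix_vector_mult_def sum_UNIV_option blk[OF \<eta>U] axis_def)
    show "g ?c y $ None $ None = - 1"
      unfolding gN t using DN[OF \<eta>D]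
      by (simp add: matrix_vector_mult_scaleR matrix_vector_mult_basis column_def power2_eq_square)
  qed
qed

theorem locally_robertson_walker:
  assumes "p \<in> topspace X"
  shows "\<exists>c\<in>\<A>. p \<in> fst c \<and> (\<exists>I q V h. warped_form g c I q V h \<and> constant_sectional_curvature_on V h)"
proof -
  obtain c where c: "c \<in> \<A>" "p \<in> fst c"
    using M assms unfolding smooth_manifold_def by blast
  obtain c1 where c1: "c1 \<in> \<A>" "p \<in> fst c1" "\<And>y. y \<in> chart_image c1 \<Longrightarrow> \<psi> (chart_inv c1 y) = y $ None"
    using straighten_time[OF c] by blast
  obtain c2 where c2: "c2 \<in> \<A>" "p \<in> fst c2" "\<And>y. y \<in> chart_image c2 \<Longrightarrow> \<psi> (chart_inv c2 y) = y $ None"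
    "\<And>y \<alpha>. y \<in> chart_image c2 \<Longrightarrow> g c2 y $ None $ Some \<alpha> = 0"
    "\<And>y. y \<in> chart_image c2 \<Longrightarrow> g c2 y $ None $ None < 0"
  proof (rule straighten_gradient[OF c1(1,2)])
    show "\<psi> (chart_inv c1 y) = y $ None" if "y \<in> chart_image c1" for y by (rule c1(3)[OF that])
  qed (rule that)
  obtain c3 I V where c3: "c3 \<in> \<A>" "p \<in> fst c3"
    "chart_image c3 = {x. x $ None \<in> I \<and> spatial x \<in> V}" "open I" "convex I" "I \<noteq> {}" "open V" "convex V" "V \<noteq> {}"
    "\<And>x \<alpha>. x \<in> chart_image c3 \<Longrightarrow> partial (Some \<alpha>) (\<psi> \<circ> chart_inv c3) x = 0"
    "\<And>x \<alpha>. x \<in> chart_image c3 \<Longrightarrow> g c3 x $ None $ Some \<alpha> = 0"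
    "\<And>x. x \<in> chart_image c3 \<Longrightarrow> g c3 x $ None $ None = - 1"
  proof (rule straighten_proper_time[OF c2(1,2)])
    show "\<psi> (chart_inv c2 y) = y $ None" if "y \<in> chart_image c2" for y by (rule c2(3)[OF that])
    show "g c2 y $ None $ Some \<alpha> = 0" if "y \<in> chart_image c2" for y \<alpha> by (rule c2(4)[OF that])
    show "g c2 y $ None $ None < 0" if "y \<in> chart_image c2" for y by (rule c2(5)[OF that])
  qed (rule that)
  have neg: "g c3 x $ None $ None < 0" if "x \<in> chart_image c3" for x
    using c3(12)[OF that] by simp
  interpret R: recurrent_chart "g c3" "chart_image c3" "A c3" "\<lambda>x. \<beta> (chart_inv c3 x)" "\<lambda>x. \<psi> (chart_inv c3 x)"
    by (rule recurrent_chart[OF c3(1)]) (fact c3 neg)+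
  interpret C: cosmic_chart "g c3" "chart_image c3" "A c3" "\<lambda>x. \<beta> (chart_inv c3 x)" "\<lambda>x. \<psi> (chart_inv c3 x)" I V
  proof unfold_locales
    show "partial (Some \<alpha>) (\<lambda>x. \<psi> (chart_inv c3 x)) x = 0" if "x \<in> chart_image c3" for x \<alpha>
      using c3(10)[OF that] by (simp add: comp_def)
    show "v \<bullet> ((\<chi> \<alpha> \<beta>. g c3 x $ Some \<alpha> $ Some \<beta>) *v v) > 0" if "x \<in> chart_image c3" "v \<noteq> 0" for x v
      by (rule space_positive[OF c3(1) that(1) c3(11)[OF that(1)] neg[OF that(1)] that(2)])
  qed (fact c3)+
  obtain q h where qh: "smooth_on I q" "\<And>t. t \<in> I \<Longrightarrow> q t > 0" "riemannian_metric_on V h"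
    "\<And>x \<alpha> \<beta>. x \<in> chart_image c3 \<Longrightarrow> g c3 x $ Some \<alpha> $ Some \<beta> = (q (x $ None))\<^sup>2 * h (spatial x) $ \<alpha> $ \<beta>"
    "constant_sectional_curvature_on V h"
    using C.robertson_walker_form by blast
  have "warped_form g c3 I q V h"
    unfolding warped_form_def
    using c3(3-9,11,12) qh R.block' by (auto simp: is_interval_convex_1 convex_connected)
  then show ?thesis using c3(1,2) qh(5) by blast
qed

end

theorem theorem3p2:
  fixes X :: "'a topology"
    and \<A> :: "('a, 'm::finite option) chart set"
    and g :: "('a, 'm option) bilinear_field"
    and A :: "('a, 'm option) covector_field"
  assumes "CARD('m option) > 3"
    and "lorentzian X \<A> g"
    and "extended_recurrent X \<A> g A"
    and "timelike \<A> g A"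
  shows "robertson_walker X \<A> g"
proof -
  obtain \<beta> \<psi> where sm: "smooth_function \<A> \<beta>" "smooth_function \<A> \<psi>"
    and nz: "\<And>p. p \<in> topspace X \<Longrightarrow> \<beta> p \<noteq> 0 \<and> \<psi> p \<noteq> 0"
    and eqs: "\<And>c x. c \<in> \<A> \<Longrightarrow> x \<in> chart_image c \<Longrightarrow>
           let b = \<beta> (chart_inv c x); s = \<psi> (chart_inv c x); a = A c x; G = metric_G (g c) in
           (\<forall>j. partial j (\<psi> \<circ> chart_inv c) x = b * a $ j) \<and>
           (\<forall>i j k l m.
              cov_deriv4 (g c) (riemann (g c)) i j k l m x =
                a $ i * riemann (g c) j k l m x + (b - s) * a $ i * G j k l m x
                + b / 2 * (a $ j * G i k l m x + a $ k * G j i l m x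
                           + a $ l * G j k i m x + a $ m * G j k l i x))"
    using assms(3) unfolding extended_recurrent_def by blast
  interpret extended_recurrent_spacetime X \<A> g A \<beta> \<psi>
  proof
    \<comment> \<open>One index of the option type is time, so n > 3 leaves at least three spatial
      directions.\<close>
    show "CARD('m) \<ge> 3" using assms(1) by (simp add: card_UNIV_option)
    show "\<beta> p \<noteq> 0" if "p \<in> topspace X" for p using nz[OF that] by simp
  qed (use assms sm eqs in \<open>auto simp: Let_def\<close>)
  have "CARD('m option) \<ge> 3" using assms(1) by simp
  then show ?thesis
    using assms(2) locally_robertson_walker
    unfolding robertson_walker_def generalized_robertson_walker_def by blast
qed

end
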